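(* Fix three non-collinear points $z_1,z_2,z_3\in\mathbb C$ and consider configurations $\mathbf z=(z_4,\dots,z_{N+3})$ of points in the open triangle with vertices $z_1,z_2,z_3$, such that $z_1,\dots,z_{N+3}$ are pairwise distinct. For configurations where the Delaunay triangulation $T=T(\mathbf z)$ of $\{z_1,\dots,z_{N+3}\}$ is unique, define $\mathcal A_T(\mathbf z)=-\sum_{f}\mathrm{Vol}(f)$, the sum over the (counterclockwise oriented) triangles $f$ of $T$, and $D_{u\bar v}(\mathbf z)=\frac{\partial^2}{\partial z_u\partial\bar z_v}\mathcal A_T(\mathbf z)$ for $u,v\in\{4,\dots,N+3\}$. Then the Hermitian form $D$ is positive, i.e. $\sum_{u,v}\xi_uD_{u\bar v}\bar\xi_v\ge0$ for all $\xi\in\mathbb C^N$, and $D$ extends continuously to all configurations of pairwise distinct points (in particular across edge flips of the Delaunay triangulation); thus $D$ is a continuous Kähler form with prepotential $\mathcal A_T$.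
   Context: For a triangle $f=(z_a,z_b,z_c)$ listed counterclockwise, $\mathrm{Vol}(f)=\mathrm{Im}\,\mathrm{Li}_2(w)+\ln|w|\,\mathrm{Arg}(1-w)$ with $w=\frac{z_c-z_a}{z_b-z_a}$ (Bloch–Wigner function); it is the hyperbolic volume of the ideal tetrahedron with vertices $z_a,z_b,z_c,\infty$ in the upper half-space model of $\mathbb H_3$, and equals $Л(\alpha_1)+Л(\alpha_2)+Л(\alpha_3)$ with $Л(\alpha)=-\int_0^\alpha\log(2\sin t)\,dt$ and $\alpha_i$ the angles of $f$. $\partial/\partial z$, $\partial/\partial\bar z$ are Wirtinger derivatives. *)

theory Defs
  imports "HOL-Complex_Analysis.Complex_Analysis"
begin

text \<open>Principal branch of the dilogarithm, Li2(w) = - integral from 0 to w of log(1-t)/t dt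
  along the straight segment (valid for w outside [1,infinity)).\<close>
definition dilog :: "complex \<Rightarrow> complex" where
  "dilog w = - contour_integral (linepath 0 w) (\<lambda>t. Ln (1 - t) / t)"

definition bloch_wigner :: "complex \<Rightarrow> real" where
  "bloch_wigner w = Im (dilog w) + ln (cmod w) * Arg (1 - w)"

definition ccw :: "complex \<Rightarrow> complex \<Rightarrow> complex \<Rightarrow> bool" where
  "ccw a b c \<longleftrightarrow> Im (cnj (b - a) * (c - a)) > 0"

definition tri_vol :: "complex set \<Rightarrow> real" where
  "tri_vol F = (case (SOME (a, b, c). F = {a, b, c} \<and> ccw a b c) of
      (a, b, c) \<Rightarrow> bloch_wigner ((c - a) / (b - a)))"

definition triangulation :: "complex set \<Rightarrow> complex set set \<Rightarrow> bool" where
  "triangulation P T \<longleftrightarrow>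
     finite T \<and>
     (\<forall>F\<in>T. F \<subseteq> P \<and> card F = 3 \<and> \<not> collinear F) \<and>
     (\<forall>F\<in>T. \<forall>G\<in>T. F \<noteq> G \<longrightarrow>
        interior (convex hull F) \<inter> interior (convex hull G) = {}) \<and>
     \<Union> ((\<lambda>F. convex hull F) ` T) = convex hull P \<and>
     (\<forall>F\<in>T. P \<inter> convex hull F = F)"

definition delaunay_triangulation :: "complex set \<Rightarrow> complex set set \<Rightarrow> bool" where
  "delaunay_triangulation P T \<longleftrightarrow> triangulation P T \<and>
     (\<forall>F\<in>T. \<exists>c r. (\<forall>q\<in>F. dist q c = r) \<and> (\<forall>p\<in>P. r \<le> dist p c))"

definition delaunay_unique :: "complex set \<Rightarrow> bool" where
  "delaunay_unique P \<longleftrightarrow> (\<exists>!T. delaunay_triangulation P T)"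

definition the_delaunay :: "complex set \<Rightarrow> complex set set" where
  "the_delaunay P = (THE T. delaunay_triangulation P T)"

definition config_points :: "complex \<Rightarrow> complex \<Rightarrow> complex \<Rightarrow> complex ^ 'n \<Rightarrow> complex set" where
  "config_points z1 z2 z3 z = {z1, z2, z3} \<union> range (\<lambda>u. z $ u)"

definition admissible :: "complex \<Rightarrow> complex \<Rightarrow> complex \<Rightarrow> complex ^ 'n \<Rightarrow> bool" where
  "admissible z1 z2 z3 z \<longleftrightarrow>
     (\<forall>u. z $ u \<in> interior (convex hull {z1, z2, z3})) \<and> inj (\<lambda>u. z $ u)"

definition unique_region :: "complex \<Rightarrow> complex \<Rightarrow> complex \<Rightarrow> (complex ^ 'n) set" where
  "unique_region z1 z2 z3 =
     {z. admissible z1 z2 z3 z \<and> delaunay_unique (config_points z1 z2 z3 z)}"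

definition prepot :: "complex \<Rightarrow> complex \<Rightarrow> complex \<Rightarrow> complex ^ 'n \<Rightarrow> real" where
  "prepot z1 z2 z3 z =
     - (\<Sum>F\<in>the_delaunay (config_points z1 z2 z3 z). tri_vol F)"

definition dir_deriv :: "(complex ^ 'n \<Rightarrow> complex) \<Rightarrow> complex ^ 'n \<Rightarrow> complex ^ 'n \<Rightarrow> complex" where
  "dir_deriv g v z = vector_derivative (\<lambda>t::real. g (z + t *\<^sub>R v)) (at 0)"

definition wirt :: "(complex ^ 'n \<Rightarrow> complex) \<Rightarrow> 'n \<Rightarrow> complex ^ 'n \<Rightarrow> complex" where
  "wirt g u z = (dir_deriv g (axis u 1) z - \<i> * dir_deriv g (axis u \<i>) z) / 2"

definition wirt_bar :: "(complex ^ 'n \<Rightarrow> complex) \<Rightarrow> 'n \<Rightarrow> complex ^ 'n \<Rightarrow> complex" where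
  "wirt_bar g u z = (dir_deriv g (axis u 1) z + \<i> * dir_deriv g (axis u \<i>) z) / 2"

definition levi :: "complex \<Rightarrow> complex \<Rightarrow> complex \<Rightarrow> complex ^ 'n \<Rightarrow> 'n \<Rightarrow> 'n \<Rightarrow> complex" where
  "levi z1 z2 z3 z u v =
     wirt (\<lambda>w. wirt_bar (\<lambda>y. complex_of_real (prepot z1 z2 z3 y)) v w) u z"

end

theory Submission
  imports Defs
begin

text \<open>
  Write \<open>\<xi>[a, b, c]\<close> for the second divided difference of \<open>\<xi>\<close> at the vertices of a triangle.
  Differentiating the volume, \<open>dVol = - \<Sum> ln \<bar>opposite side\<bar> d(angle)\<close>, once more
  shows that a single triangle \<open>f\<close> contributes \<open>area f * \<bar>\<xi>[f]\<bar>\<^sup>2\<close> to the Levi form, which gives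
  positivity triangle by triangle.

  For continuity, the entry at a pair \<open>u \<noteq> v\<close> only involves the triangles adjacent to the edge
  \<open>uv\<close>. If the circle centres on the bisector of \<open>uv\<close> are parametrised by
  \<open>(u + v)/2 + \<i> s (v - u)/2\<close>, the two triangles contribute \<open>- 1 / (s - \<i>)\<close> and
  \<open>1 / (s - \<i>)\<close> at their circumcentres, so that their sum is the integral of \<open>1 / (s - \<i>)\<^sup>2\<close> over
  the Voronoi edge dual to \<open>uv\<close>, up to the factor \<open>1 / (2 \<bar>u - v\<bar>\<^sup>2)\<close>. Unlike the triangulation, the Voronoi edge is
  cut out by inequalities depending continuously on the points, so this expression makes sense and is
  continuous for all configurations by dominated convergence. The diagonal entries follow from
  translation invariance.

  That the triangulation is locally constant uses two facts about lower hulls of lifted points: they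
  triangulate the convex hull for every generic height function, and by perturbing
  the heights \<open>\<bar>p\<bar>\<^sup>2\<close> every triangle with empty circumcircle lies in some Delaunay triangulation.
  Hence uniqueness excludes four cocircular points on an empty circle.
\<close>


section \<open>Orientation and the in-circle determinant\<close>

text \<open>Uniqueness of the triangulation is a combinatorial hypothesis, whereas local constancy
  needs strict inequalities that survive small motions. The bridge is
  \<open>generic_heights sqn\<close>: an empty circumcircle carries only its own three points. A
  second obstacle are collinear triples: their orientation is 0, so a small motion might open them
  into thin Delaunay triangles. This is ruled out by \<open>two_sided\<close>: a line through an
  interior point and another point of the configuration has points of the configuration strictly on
  both sides. The same property bounds every Voronoi edge at an interior point, so that the integral
  over it is a difference of two values of the primitive \<open>- 1 / (s - \<i>)\<close>. Only rows
  of the Levi form at interior points are needed, but the row sums that determine the diagonal run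
  over the three fixed vertices as well. At an edge flip one Voronoi edge shrinks to a point and
  another grows out of a point; points have measure zero, hence no jump.\<close>

definition orient :: "complex \<Rightarrow> complex \<Rightarrow> complex \<Rightarrow> real" where
  "orient a b c = Im (cnj (b - a) * (c - a))"

text \<open>Lift each point \<open>q\<close> to height \<open>h q\<close>. The value is
  \<open>orient a b c\<close> times the signed height of the lifted \<open>p\<close> above the plane
  through the lifted \<open>a\<close>, \<open>b\<close>, \<open>c\<close>. For
  \<open>h = sqn\<close> and a counterclockwise triangle it is nonnegative exactly when
  \<open>p\<close> is not strictly inside the circumcircle.\<close>

definition incirc :: "(complex \<Rightarrow> real) \<Rightarrow> complex \<Rightarrow> complex \<Rightarrow> complex \<Rightarrow> complex \<Rightarrow> real" where
  "incirc h a b c p =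
     h p * orient a b c - h a * orient p b c - h b * orient a p c - h c * orient a b p"

text \<open>No genericity is built in: if a face of the lower hull carries more than three lifted
  points, all nondegenerate triangles on it belong to the set, overlapping ones included.\<close>

definition lower_triangles :: "(complex \<Rightarrow> real) \<Rightarrow> complex set \<Rightarrow> complex set set" where
  "lower_triangles h P = {{a, b, c} | a b c. a \<in> P \<and> b \<in> P \<and> c \<in> P \<and> 0 < orient a b c \<and>
     (\<forall>p\<in>P. 0 \<le> incirc h a b c p)}"

abbreviation sqn :: "complex \<Rightarrow> real" where "sqn p \<equiv> (Re p)\<^sup>2 + (Im p)\<^sup>2"

lemma orient_eq:
  "orient a b c = (Re b - Re a) * (Im c - Im a) - (Im b - Im a) * (Re c - Re a)"
  by (simp add: orient_def algebra_simps)

lemma orient_same [simp]: "orient a a c = 0" "orient a c a = 0" "orient c a a = 0"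
  by (auto simp: orient_eq)

lemma orient_cyclic: "orient b c a = orient a b c"
  by (simp add: orient_eq algebra_simps)

lemma orient_swap: "orient b a c = - orient a b c"
  by (simp add: orient_eq algebra_simps)

lemma orient_swap': "orient a c b = - orient a b c"
  by (simp add: orient_eq algebra_simps)

lemma orient_sum: "orient p b c + orient a p c + orient a b p = orient a b c"
  by (simp add: orient_eq algebra_simps)

lemma orient_affine:
  assumes "u + v + w = 1"
  shows "orient p q (u *\<^sub>R a + v *\<^sub>R b + w *\<^sub>R c) = u * orient p q a + v * orient p q b + w * orient p q c"
proof -
  have u: "u = 1 - v - w" using assms by simp
  show ?thesis unfolding u by (simp add: orient_eq algebra_simps)
qed

lemma collinear_iff_orient: "collinear {a, b, c} \<longleftrightarrow> orient a b c = 0"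
proof
  assume "collinear {a, b, c}"
  then consider "a = c" | u where "b = u *\<^sub>R a + (1 - u) *\<^sub>R c"
    unfolding collinear_3_expand by blast
  then show "orient a b c = 0"
  proof cases
    case (2 u)
    show ?thesis unfolding 2 by (simp add: orient_eq algebra_simps)
  qed simp
next
  assume *: "orient a b c = 0"
  show "collinear {a, b, c}"
  proof (cases "a = c")
    case False
    define u where "u = Re ((b - c) / (a - c))"
    \<comment> \<open>Orientation zero means that this product is real; hence so is
      \<open>(b - c) / (a - c)\<close>, which becomes the affine coefficient.\<close>
    have "cnj (a - c) * (b - c) = complex_of_real (Re (cnj (a - c) * (b - c)))"
      using * by (simp add: complex_eq_iff orient_eq algebra_simps)
    have "(b - c) / (a - c) = (cnj (a - c) * (b - c)) / (cnj (a - c) * (a - c))"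
      using False by simp
    also have "\<dots> = complex_of_real (Re (cnj (a - c) * (b - c)) / (cmod (a - c))\<^sup>2)"
      by (subst \<open>cnj (a - c) * (b - c) = _\<close>)
        (simp only: complex_norm_square of_real_divide mult.commute[of "cnj (a - c)"])
    finally have "(b - c) / (a - c) = complex_of_real u"
      unfolding u_def by simp
    then have "b = u *\<^sub>R a + (1 - u) *\<^sub>R c"
      using False by (simp add: field_simps scaleR_conv_of_real)
    then show ?thesis unfolding collinear_3_expand by blast
  qed (simp add: collinear_3_expand)
qed

lemma orient_distinct: "orient a b c \<noteq> 0 \<Longrightarrow> a \<noteq> b \<and> b \<noteq> c \<and> a \<noteq> c"
  by auto

lemma card_orient: "orient a b c \<noteq> 0 \<Longrightarrow> card {a, b, c} = 3"
  using orient_distinct[of a b c] by simp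

text \<open>Cramer's rule: barycentric coordinates are quotients of signed areas.\<close>

lemma barycentric:
  assumes "orient a b c \<noteq> 0"
  shows "orient p b c / orient a b c + orient a p c / orient a b c + orient a b p / orient a b c = 1"
    "(orient p b c / orient a b c) *\<^sub>R a + (orient a p c / orient a b c) *\<^sub>R b
      + (orient a b p / orient a b c) *\<^sub>R c = p"
proof -
  let ?O = "orient a b c"
  let ?u = "orient p b c / ?O" and ?v = "orient a p c / ?O" and ?w = "orient a b p / ?O"
  show "?u + ?v + ?w = 1"
    using assms orient_sum[of p b c a] by (simp add: add_divide_distrib[symmetric])
  have "?O * Re p = orient p b c * Re a + orient a p c * Re b + orient a b p * Re c"
    "?O * Im p = orient p b c * Im a + orient a p c * Im b + orient a b p * Im c"
    by (simp_all add: orient_eq algebra_simps)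
  then show "?u *\<^sub>R a + ?v *\<^sub>R b + ?w *\<^sub>R c = p"
    using assms by (simp add: complex_eq_iff field_simps)
qed

lemma orient_coords:
  assumes "u + v + w = 1" "p = u *\<^sub>R a + v *\<^sub>R b + w *\<^sub>R c"
  shows "orient p b c = u * orient a b c" "orient a p c = v * orient a b c" "orient a b p = w * orient a b c"
proof -
  have "orient b c p = u * orient a b c" "orient c a p = v * orient a b c" "orient a b p = w * orient a b c"
    unfolding assms(2) orient_affine[OF assms(1)]
    using orient_cyclic[of a b c] orient_cyclic[of b c a] by simp_all
  then show "orient p b c = u * orient a b c" "orient a p c = v * orient a b c" "orient a b p = w * orient a b c"
    using orient_cyclic[of b c p] orient_cyclic[of a p c] by simp_all
qed

lemma incirc_vertex [simp]:
  "incirc h a b c a = 0" "incirc h a b c b = 0" "incirc h a b c c = 0"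
  by (auto simp: incirc_def)

lemma incirc_cyclic: "incirc h b c a p = incirc h a b c p"
  using orient_cyclic[of a b c] orient_cyclic[of p b c] orient_cyclic[of a p c] orient_cyclic[of a b p]
  by (simp add: incirc_def orient_eq algebra_simps)

lemma incirc_swap: "incirc h b a c p = - incirc h a b c p"
  by (simp add: incirc_def orient_eq algebra_simps)

text \<open>Apart from the term \<open>h p\<close>, \<open>incirc\<close> is affine in
  \<open>p\<close>. The last bracket is \<open>orient a b c\<close> times the height at
  \<open>x\<close> of the plane through the lifted \<open>a\<close>, \<open>b\<close>,
  \<open>c\<close>, so two triangles over the same \<open>x\<close> can be compared.\<close>

lemma incirc_combination:
  assumes "u + v + w = 1" "x = u *\<^sub>R d + v *\<^sub>R e + w *\<^sub>R f"
  shows "u * incirc h a b c d + v * incirc h a b c e + w * incirc h a b c f =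
    orient a b c * (u * h d + v * h e + w * h f) - (h x * orient a b c - incirc h a b c x)"
proof -
  have "orient x b c = u * orient d b c + v * orient e b c + w * orient f b c"
    "orient a x c = u * orient a d c + v * orient a e c + w * orient a f c"
    "orient a b x = u * orient a b d + v * orient a b e + w * orient a b f"
    using orient_affine[OF assms(1), of b c d e f] orient_affine[OF assms(1), of c a d e f]
      orient_affine[OF assms(1), of a b d e f]
    unfolding assms(2) orient_cyclic[of b c] orient_cyclic[of a _ c, symmetric] by blast+
  then show ?thesis unfolding incirc_def by (simp add: algebra_simps)
qed

text \<open>At a common point \<open>x\<close> both triangles interpolate the lower hull of the lifted points, so their interpolated heights agree.\<close>

lemma lower_overlap:
  assumes "0 < orient a b c" "0 < orient d e f"
    and I1: "0 \<le> incirc h a b c d" "0 \<le> incirc h a b c e" "0 \<le> incirc h a b c f"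
    and I2: "0 \<le> incirc h d e f a" "0 \<le> incirc h d e f b" "0 \<le> incirc h d e f c"
    and x: "u + v + w = 1" "x = u *\<^sub>R a + v *\<^sub>R b + w *\<^sub>R c" "0 < u" "0 < v" "0 < w"
    and y: "r + s + t = 1" "x = r *\<^sub>R d + s *\<^sub>R e + t *\<^sub>R f" "0 \<le> r" "0 \<le> s" "0 \<le> t"
  shows "incirc h d e f a = 0 \<and> incirc h d e f b = 0 \<and> incirc h d e f c = 0"
proof -
  define S1 S2 where "S1 = u * h a + v * h b + w * h c" and "S2 = r * h d + s * h e + t * h f"
  let ?O1 = "orient a b c" and ?O2 = "orient d e f"
  have 1: "r * incirc h a b c d + s * incirc h a b c e + t * incirc h a b c f = ?O1 * (S2 - S1)"
    using incirc_combination[OF x(1,2), of h a b c] incirc_combination[OF y(1,2), of h a b c]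
    by (simp add: S1_def S2_def algebra_simps)
  have 2: "u * incirc h d e f a + v * incirc h d e f b + w * incirc h d e f c = ?O2 * (S1 - S2)"
    using incirc_combination[OF x(1,2), of h d e f] incirc_combination[OF y(1,2), of h d e f]
    by (simp add: S1_def S2_def algebra_simps)
  have "0 \<le> ?O1 * (S2 - S1)" unfolding 1[symmetric] using I1 y(3-5) by simp
  then have "S1 \<le> S2" using assms(1) by (simp add: zero_le_mult_iff)
  then have "?O2 * (S1 - S2) \<le> 0" using assms(2) by (simp add: mult_le_0_iff)
  with 2 have le: "u * incirc h d e f a + v * incirc h d e f b + w * incirc h d e f c \<le> 0" by simp
  have nn: "0 \<le> u * incirc h d e f a" "0 \<le> v * incirc h d e f b" "0 \<le> w * incirc h d e f c"
    using I2 x(3-5) by simp_all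
  then have "u * incirc h d e f a = 0" "v * incirc h d e f b = 0" "w * incirc h d e f c = 0"
    using le by linarith+
  then show ?thesis using x(3-5) by simp
qed

lemma in_triangle_iff:
  assumes "0 < orient a b c"
  shows "x \<in> convex hull {a, b, c} \<longleftrightarrow> 0 \<le> orient x b c \<and> 0 \<le> orient a x c \<and> 0 \<le> orient a b x"
proof
  assume "x \<in> convex hull {a, b, c}"
  then obtain u v w where *: "0 \<le> u" "0 \<le> v" "0 \<le> w" "u + v + w = 1" "x = u *\<^sub>R a + v *\<^sub>R b + w *\<^sub>R c"
    unfolding convex_hull_3 by auto
  show "0 \<le> orient x b c \<and> 0 \<le> orient a x c \<and> 0 \<le> orient a b x"
    unfolding orient_coords[OF *(4,5)] using *(1-3) assms by simp
next
  assume *: "0 \<le> orient x b c \<and> 0 \<le> orient a x c \<and> 0 \<le> orient a b x"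
  have "0 \<le> orient x b c / orient a b c" "0 \<le> orient a x c / orient a b c"
    "0 \<le> orient a b x / orient a b c"
    using * assms by simp_all
  moreover have ne: "orient a b c \<noteq> 0" using assms by simp
  ultimately show "x \<in> convex hull {a, b, c}"
    unfolding convex_hull_3 mem_Collect_eq
    by (intro exI[of _ "orient x b c / orient a b c"] exI[of _ "orient a x c / orient a b c"]
      exI[of _ "orient a b x / orient a b c"] conjI) (simp_all only: barycentric[OF ne])
qed

lemma in_interior_triangle_iff:
  assumes "0 < orient a b c"
  shows "x \<in> interior (convex hull {a, b, c}) \<longleftrightarrow> 0 < orient x b c \<and> 0 < orient a x c \<and> 0 < orient a b x"
proof -
  have nc: "\<not> collinear {a, b, c}" using assms by (simp add: collinear_iff_orient)
  have eq: "interior (convex hull {a,b,c}) =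
      {v. \<exists>x y z. 0 < x \<and> 0 < y \<and> 0 < z \<and> x + y + z = 1 \<and> x *\<^sub>R a + y *\<^sub>R b + z *\<^sub>R c = v}"
    by (rule interior_convex_hull_3_minimal[OF nc]) simp
  show ?thesis
  proof
    assume "x \<in> interior (convex hull {a, b, c})"
    then obtain u v w where *: "0 < u" "0 < v" "0 < w" "u + v + w = 1" "x = u *\<^sub>R a + v *\<^sub>R b + w *\<^sub>R c"
      unfolding eq by auto
    show "0 < orient x b c \<and> 0 < orient a x c \<and> 0 < orient a b x"
      unfolding orient_coords[OF *(4,5)] using *(1-3) assms by simp
  next
    assume *: "0 < orient x b c \<and> 0 < orient a x c \<and> 0 < orient a b x"
    have "0 < orient x b c / orient a b c" "0 < orient a x c / orient a b c"
      "0 < orient a b x / orient a b c"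
      using * assms by simp_all
    moreover have ne: "orient a b c \<noteq> 0" using assms by simp
    ultimately show "x \<in> interior (convex hull {a, b, c})"
      unfolding eq mem_Collect_eq
      by (intro exI[of _ "orient x b c / orient a b c"] exI[of _ "orient a x c / orient a b c"]
      exI[of _ "orient a b x / orient a b c"] conjI) (simp_all only: barycentric[OF ne])
  qed
qed

lemma ccw_order:
  assumes "\<not> collinear F" "card F = 3"
  obtains a b c where "F = {a, b, c}" "0 < orient a b c"
proof -
  obtain a b c where F: "F = {a, b, c}" using assms(2) by (auto simp: card_3_iff)
  have "orient a b c \<noteq> 0" using assms(1) F collinear_iff_orient by auto
  then consider "0 < orient a b c" | "0 < orient a c b"
    using orient_swap'[of a b c] by linarith
  then show ?thesis using that F by cases (auto simp: insert_commute)
qed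

text \<open>A transposition of vertices reverses the sign of \<open>orient\<close>, so only cyclic
  shifts survive. Objects attached to vertex sets, such as \<open>lower_triangles\<close> and
  \<open>tri_vol\<close>, can thus be evaluated on any counterclockwise ordering.\<close>

lemma ccw_rotation:
  assumes "{a, b, c} = {d, e, f}" "0 < orient a b c" "0 < orient d e f"
  shows "(a = d \<and> b = e \<and> c = f) \<or> (a = e \<and> b = f \<and> c = d) \<or> (a = f \<and> b = d \<and> c = e)"
proof -
  have neq: "a \<noteq> b" "b \<noteq> c" "a \<noteq> c" using assms(2) orient_distinct[of a b c] by auto
  have mem: "a \<in> {d,e,f}" "b \<in> {d,e,f}" "c \<in> {d,e,f}" using assms(1) by blast+
  have "\<not> 0 < orient d f e" "\<not> 0 < orient e d f" "\<not> 0 < orient f e d"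
    using assms(3) orient_swap[of d e f] orient_swap'[of d e f] orient_cyclic[of d f e]
      orient_cyclic[of f e d] by linarith+
  with neq mem assms(2) show ?thesis by blast
qed

lemma lower_triangle_ccw:
  assumes "{a, b, c} \<in> lower_triangles h P" "0 < orient a b c"
  shows "a \<in> P \<and> b \<in> P \<and> c \<in> P \<and> (\<forall>p\<in>P. 0 \<le> incirc h a b c p)"
proof -
  obtain d e f where *: "{a, b, c} = {d, e, f}" "d \<in> P" "e \<in> P" "f \<in> P" "0 < orient d e f"
    "\<forall>p\<in>P. 0 \<le> incirc h d e f p"
    using assms unfolding lower_triangles_def by blast
  consider "a = d" "b = e" "c = f" | "a = e" "b = f" "c = d" | "a = f" "b = d" "c = e"
    using ccw_rotation[OF *(1) assms(2) *(5)] by blast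
  then show ?thesis
  proof cases
    case 1 then show ?thesis using * by blast
  next
    case 2 then show ?thesis using *(2-4,6) by (simp add: incirc_cyclic[of h e f d])
  next
    case 3 then show ?thesis using *(2-4,6) by (simp add: incirc_cyclic[of h d e f, symmetric])
  qed
qed

lemma lower_triangles_cases:
  assumes "F \<in> lower_triangles h P"
  obtains a b c where "F = {a, b, c}" "a \<in> P" "b \<in> P" "c \<in> P" "0 < orient a b c"
     "\<forall>p\<in>P. 0 \<le> incirc h a b c p"
  using assms unfolding lower_triangles_def by blast

lemma lower_trianglesI:
  "\<lbrakk>a \<in> P; b \<in> P; c \<in> P; 0 < orient a b c; \<And>p. p \<in> P \<Longrightarrow> 0 \<le> incirc h a b c p\<rbrakk>
   \<Longrightarrow> {a, b, c} \<in> lower_triangles h P"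
  unfolding lower_triangles_def by blast

lemma finite_lower_triangles: "finite P \<Longrightarrow> finite (lower_triangles h P)"
  by (rule finite_subset[of _ "Pow P"]) (auto simp: lower_triangles_def)

section \<open>Lower hulls of lifted point sets\<close>

text \<open>The lines through two points of \<open>P\<close> are finitely many null sets, and a
  nonempty open set is not null.\<close>

lemma generic_point:
  assumes "finite P" "open U" "U \<noteq> {}"
  obtains x where "x \<in> U" "\<And>a b. \<lbrakk>a \<in> P; b \<in> P; a \<noteq> b\<rbrakk> \<Longrightarrow> orient a b x \<noteq> 0"
proof -
  define B where "B = (\<lambda>(a, b). {x. orient a b x = 0}) ` {(a, b). a \<in> P \<and> b \<in> P \<and> a \<noteq> b}"
  have "finite B" unfolding B_def
    by (intro finite_imageI finite_subset[OF _ finite_cartesian_product[OF assms(1) assms(1)]]) auto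
  moreover have "negligible L" if L: "L \<in> B" for L
  proof -
    obtain a b where ab: "a \<noteq> b" "L = {x. orient a b x = 0}" using L by (auto simp: B_def)
    have "L = {x. Complex (- (Im b - Im a)) (Re b - Re a) \<bullet> x
        = (Re b - Re a) * Im a - (Im b - Im a) * Re a}"
      unfolding ab by (auto simp: orient_eq inner_complex_def algebra_simps)
    moreover have "Complex (- (Im b - Im a)) (Re b - Re a) \<noteq> 0"
      using ab(1) by (auto simp: complex_eq_iff)
    ultimately show ?thesis by (simp only: negligible_hyperplane simp_thms)
  qed
  ultimately have "negligible (\<Union>B)" by (rule negligible_Union)
  then have "\<not> U \<subseteq> \<Union>B" using open_not_negligible[OF assms(2,3)] negligible_subset by blast
  then obtain x where "x \<in> U" "x \<notin> \<Union>B" by blast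
  then show ?thesis using that[of x] by (auto simp: B_def)
qed

text \<open>Height at \<open>x\<close> of the plane through the three lifted points.\<close>

definition interp :: "(complex \<Rightarrow> real) \<Rightarrow> complex \<Rightarrow> complex \<Rightarrow> complex \<Rightarrow> complex \<Rightarrow> real" where
  "interp h x a b c = (h a * orient x b c + h b * orient a x c + h c * orient a b x) / orient a b c"

lemma interp_cyclic: "interp h x b c a = interp h x a b c"
  using orient_cyclic[of b c a] orient_cyclic[of x c a] orient_cyclic[of b x a] orient_cyclic[of b c x]
  by (simp add: interp_def algebra_simps orient_cyclic[of x b c] orient_cyclic[of x c a])

text \<open>Three-term Grassmann-Pluecker relations. Divided by \<open>orient a b c\<close>, they
  express the areas that \<open>x\<close> cuts off in the triangle \<open>p\<close>,
  \<open>b\<close>, \<open>c\<close> through the coordinates of \<open>x\<close> and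
  \<open>p\<close> in \<open>a\<close>, \<open>b\<close>, \<open>c\<close>.\<close>

lemma plucker:
  "orient p x c * orient a b c = orient p b c * orient a x c - orient a p c * orient x b c"
  "orient p b x * orient a b c = orient p b c * orient a b x - orient a b p * orient x b c"
  by (simp_all add: orient_eq algebra_simps)

text \<open>Pivoting step of the minimisation of \<open>interp h x\<close> over the triangles containing \<open>x\<close>; the hypotheses say that \<open>a\<close> is the vertex leaving the triangle when \<open>x\<close> is re-expressed through \<open>p\<close>.\<close>

lemma exchange:
  assumes "0 < orient a b c" "0 < orient p b c" "0 < orient x b c"
    and "orient a p c * orient x b c \<le> orient a x c * orient p b c"
    and "orient a b p * orient x b c \<le> orient a b x * orient p b c"
    and "incirc h a b c p < 0"
  shows "x \<in> convex hull {p, b, c}" "interp h x p b c < interp h x a b c"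
proof -
  have "0 \<le> orient p x c * orient a b c" "0 \<le> orient p b x * orient a b c"
    using assms(4,5) plucker[where a=a and b=b and c=c and p=p and x=x] by (simp_all add: mult.commute)
  then have "0 \<le> orient p x c" "0 \<le> orient p b x"
    using assms(1) by (simp_all add: zero_le_mult_iff)
  then show "x \<in> convex hull {p, b, c}"
    using assms by (simp add: in_triangle_iff)
  have X: "orient p x c = (orient p b c * orient a x c - orient a p c * orient x b c) / orient a b c"
    and Y: "orient p b x = (orient p b c * orient a b x - orient a b p * orient x b c) / orient a b c"
    using assms(1) plucker[where a=a and b=b and c=c and p=p and x=x] by (simp_all add: eq_divide_eq)
  \<comment> \<open>The two planes agree over the line through \<open>b\<close> and
    \<open>c\<close>, so their gap at \<open>x\<close> is proportional to the distance of
    \<open>x\<close> from that line and to the gap at \<open>p\<close>.\<close>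
  have "interp h x p b c - interp h x a b c
      = orient x b c * incirc h a b c p / (orient p b c * orient a b c)"
    unfolding interp_def X Y incirc_def using assms(1,2) by (simp add: field_simps)
  also have "\<dots> < 0" using assms by (intro divide_neg_pos mult_pos_neg mult_pos_pos)
  finally show "interp h x p b c < interp h x a b c" by simp
qed

text \<open>Caratheodory's theorem supplies at most three points. If they were collinear,
  \<open>x\<close> would lie on a line through two points of \<open>P\<close>; when they all
  coincide with \<open>x\<close>, a second point of \<open>P\<close> provides such a line.\<close>

lemma in_some_triangle:
  assumes "x \<in> convex hull P" "p \<in> P" "q \<in> P" "p \<noteq> q"
    and gen: "\<And>a b. \<lbrakk>a \<in> P; b \<in> P; a \<noteq> b\<rbrakk> \<Longrightarrow> orient a b x \<noteq> 0"
  obtains a b c where "a \<in> P" "b \<in> P" "c \<in> P" "0 < orient a b c" "x \<in> convex hull {a, b, c}"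
proof -
  obtain S where S: "finite S" "S \<subseteq> P" "card S \<le> 3" "x \<in> convex hull S"
    using assms(1) unfolding caratheodory[of P] by auto
  have "S \<noteq> {}" using S by auto
  with S(1,3) have "card S = 1 \<or> card S = 2 \<or> card S = 3" by (cases "card S") auto
  then obtain a b c where abc: "S = {a, b, c}"
    by (metis card_1_singletonE card_2_iff card_3_iff insert_absorb2)
  obtain u v w where x: "u + v + w = 1" "x = u *\<^sub>R a + v *\<^sub>R b + w *\<^sub>R c"
    using S(4) unfolding abc convex_hull_3 by auto
  have "orient a b c \<noteq> 0"
  proof
    assume 0: "orient a b c = 0"
    then have 1: "orient a b x = 0" "orient b c x = 0"
      unfolding x(2) orient_affine[OF x(1)] using orient_cyclic[of b c a] by simp_all
    show False
    proof (cases "a = b \<and> b = c")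
      case True
      then have "x = (u + v + w) *\<^sub>R a" using x(2) by (simp only: scaleR_add_left)
      then have "x = a" using x(1) by simp
      moreover obtain r where "r \<in> P" "r \<noteq> a" using assms by metis
      ultimately show False using gen[of a r] S(2) abc by auto
    next
      case False
      then show False using 1 gen[of a b] gen[of b c] S(2) abc by auto
    qed
  qed
  then consider "0 < orient a b c" | "0 < orient a c b"
    using orient_swap'[of a b c] by linarith
  then show ?thesis
  proof cases
    case 1 then show ?thesis using that[of a b c] S abc by auto
  next
    case 2 then show ?thesis using that[of a c b] S abc by (auto simp: insert_commute)
  qed
qed

text \<open>Among the finitely many triangles around \<open>x\<close>, one has the least
  interpolated height at \<open>x\<close>. A lifted point below its plane could replace a vertex and
  lower that height, so there is none.\<close>

lemma lower_cover_generic: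
  assumes "finite P" "x \<in> convex hull P" "p \<in> P" "q \<in> P" "p \<noteq> q"
    and gen: "\<And>a b. \<lbrakk>a \<in> P; b \<in> P; a \<noteq> b\<rbrakk> \<Longrightarrow> orient a b x \<noteq> 0"
  shows "\<exists>F\<in>lower_triangles h P. x \<in> convex hull F"
proof -
  define C where "C = {(a, b, c). a \<in> P \<and> b \<in> P \<and> c \<in> P \<and> 0 < orient a b c \<and> x \<in> convex hull {a, b, c}}"
  have "finite C"
    by (rule finite_subset[of _ "P \<times> P \<times> P"]) (use assms(1) in \<open>auto simp: C_def\<close>)
  moreover have "C \<noteq> {}"
    by (rule in_some_triangle[OF assms(2-6)]) (auto simp: C_def)
  ultimately obtain t where "is_arg_min (\<lambda>(a, b, c). interp h x a b c) (\<lambda>t. t \<in> C) t"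
    using ex_is_arg_min_if_finite[of C] by blast
  then obtain a b c where min: "(a, b, c) \<in> C"
    "\<And>d e f. (d, e, f) \<in> C \<Longrightarrow> interp h x a b c \<le> interp h x d e f"
    unfolding is_arg_min_linorder by (cases t) auto
  then have abc: "a \<in> P" "b \<in> P" "c \<in> P" "0 < orient a b c" "x \<in> convex hull {a, b, c}"
    by (auto simp: C_def)
  have neq: "a \<noteq> b" "b \<noteq> c" "c \<noteq> a" using orient_distinct[of a b c] abc by auto
  have l: "0 < orient x b c" "0 < orient a x c" "0 < orient a b x"
    using abc gen[of b c] gen[of c a] gen[of a b] neq
      orient_cyclic[of b c x] orient_cyclic[of a x c]
    by (auto simp: in_triangle_iff order_less_le)
  have "0 \<le> incirc h a b c p" if "p \<in> P" for p
  proof (rule ccontr)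
    assume neg: "\<not> 0 \<le> incirc h a b c p"
    \<comment> \<open>Coordinates of \<open>p\<close> divided by those of \<open>x\<close>. As in
      the ratio test of the simplex method, the vertex with the largest ratio leaves the
      triangle.\<close>
    define ra rb rc where "ra = orient p b c / orient x b c" and "rb = orient a p c / orient a x c"
      and "rc = orient a b p / orient a b x"
    have mu: "orient p b c = ra * orient x b c" "orient a p c = rb * orient a x c"
      "orient a b p = rc * orient a b x"
      using l by (simp_all add: ra_def rb_def rc_def)
    have pos: "0 < ra \<or> 0 < rb \<or> 0 < rc"
    proof (rule ccontr)
      assume "\<not> ?thesis"
      then have "orient p b c \<le> 0" "orient a p c \<le> 0" "orient a b p \<le> 0"
        unfolding mu using l by (auto intro!: mult_nonpos_nonneg)
      then show False using orient_sum[of p b c a] abc(4) by linarith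
    qed
    have cyc: "orient b c a = orient a b c" "orient c a b = orient a b c"
      "orient p c a = orient a p c" "orient x c a = orient a x c"
      "orient b p a = orient a b p" "orient b x a = orient a b x"
      "orient b c p = orient p b c" "orient b c x = orient x b c"
      "orient p a b = orient a b p" "orient x a b = orient a b x"
      "orient c p b = orient p b c" "orient c x b = orient x b c"
      "orient c a p = orient a p c" "orient c a x = orient a x c"
      by (simp_all add: orient_eq algebra_simps)
    have ic: "incirc h b c a p = incirc h a b c p" "incirc h c a b p = incirc h a b c p"
      by (simp_all only: incirc_cyclic)
    have ip: "interp h x b c a = interp h x a b c" "interp h x c a b = interp h x a b c"
      by (simp_all only: interp_cyclic)
    consider "rb \<le> ra" "rc \<le> ra" | "ra \<le> rb" "rc \<le> rb" | "ra \<le> rc" "rb \<le> rc" by linarith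
    then show False
    proof cases
      case 1
      then have "0 < ra" using pos by linarith
      then have "0 < orient p b c" unfolding mu using l by simp
      moreover have "orient a p c * orient x b c \<le> orient a x c * orient p b c"
        "orient a b p * orient x b c \<le> orient a b x * orient p b c"
        unfolding mu using 1 l by (simp_all add: mult.commute mult_left_mono)
      ultimately have "(p, b, c) \<in> C" "interp h x p b c < interp h x a b c"
        using exchange[of a b c p x h] abc l neg that by (auto simp: C_def)
      then show False using min(2) by fastforce
    next
      case 2
      then have "0 < rb" using pos by linarith
      then have "0 < orient p c a" unfolding cyc mu using l by simp
      moreover have "orient b p a * orient x c a \<le> orient b x a * orient p c a"
        "orient b c p * orient x c a \<le> orient b c x * orient p c a"
        unfolding cyc mu using 2 l by (simp_all add: mult.commute mult_left_mono)
      ultimately have "(p, c, a) \<in> C" "interp h x p c a < interp h x a b c"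
        using exchange[of b c a p x h] abc l neg that by (auto simp: C_def cyc ic ip)
      then show False using min(2) by fastforce
    next
      case 3
      then have "0 < rc" using pos by linarith
      then have "0 < orient p a b" unfolding cyc mu using l by simp
      moreover have "orient c p b * orient x a b \<le> orient c x b * orient p a b"
        "orient c a p * orient x a b \<le> orient c a x * orient p a b"
        unfolding cyc mu using 3 l by (simp_all add: mult.commute mult_left_mono)
      ultimately have "(p, a, b) \<in> C" "interp h x p a b < interp h x a b c"
        using exchange[of c a b p x h] abc l neg that by (auto simp: C_def cyc ic ip)
      then show False using min(2) by fastforce
    qed
  qed
  then have "{a, b, c} \<in> lower_triangles h P" using abc by (intro lower_trianglesI) auto
  then show ?thesis using abc by blast
qed

lemma triangle_interior_point:
  assumes "0 < orient a b c"
  shows "(1/3) *\<^sub>R a + (1/3) *\<^sub>R b + (1/3) *\<^sub>R c \<in> interior (convex hull {a, b, c})"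
proof -
  have "orient ((1/3) *\<^sub>R a + (1/3) *\<^sub>R b + (1/3) *\<^sub>R c) b c = (1/3) * orient a b c"
    "orient a ((1/3) *\<^sub>R a + (1/3) *\<^sub>R b + (1/3) *\<^sub>R c) c = (1/3) * orient a b c"
    "orient a b ((1/3) *\<^sub>R a + (1/3) *\<^sub>R b + (1/3) *\<^sub>R c) = (1/3) * orient a b c"
    by (rule orient_coords[of "1/3" "1/3" "1/3"]; simp)+
  then show ?thesis using assms by (simp add: in_interior_triangle_iff)
qed

text \<open>A finite union of closed triangles is closed, and the hull lies in the closure of its
  interior. A missed point would therefore have missed generic points in the interior
  nearby.\<close>

lemma lower_cover:
  assumes "finite P" "a \<in> P" "b \<in> P" "c \<in> P" "0 < orient a b c"
  shows "convex hull P \<subseteq> \<Union> ((\<lambda>F. convex hull F) ` lower_triangles h P)"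
proof
  fix x assume x: "x \<in> convex hull P"
  define U where "U = \<Union> ((\<lambda>F. convex hull F) ` lower_triangles h P)"
  have "closed U" unfolding U_def
  proof (rule closed_Union)
    show "finite ((\<lambda>F. convex hull F) ` lower_triangles h P)"
      using finite_lower_triangles[OF assms(1)] by simp
    show "\<forall>S\<in>(\<lambda>F. convex hull F) ` lower_triangles h P. closed S"
      by (auto elim!: lower_triangles_cases intro!: compact_imp_closed finite_imp_compact_convex_hull)
  qed
  have "interior (convex hull {a, b, c}) \<subseteq> interior (convex hull P)"
    using assms by (intro interior_mono hull_mono) auto
  then have ne: "interior (convex hull P) \<noteq> {}" using triangle_interior_point[OF assms(5)] by blast
  have cl: "x \<in> closure (interior (convex hull P))"
    using x closure_subset convex_closure_interior[OF convex_convex_hull ne] by auto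
  show "x \<in> \<Union> ((\<lambda>F. convex hull F) ` lower_triangles h P)"
  proof (rule ccontr)
    assume "x \<notin> \<Union> ((\<lambda>F. convex hull F) ` lower_triangles h P)"
    then have "x \<in> - U" by (simp add: U_def)
    moreover have "open (- U)" using \<open>closed U\<close> by auto
    ultimately have "- U \<inter> interior (convex hull P) \<noteq> {}"
      using cl open_Int_closure_eq_empty by blast
    moreover have "open (- U \<inter> interior (convex hull P))" using \<open>open (- U)\<close> by auto
    ultimately obtain y where y: "y \<in> - U \<inter> interior (convex hull P)"
      "\<And>a b. \<lbrakk>a \<in> P; b \<in> P; a \<noteq> b\<rbrakk> \<Longrightarrow> orient a b y \<noteq> 0"
      using generic_point[OF assms(1), of "- U \<inter> interior (convex hull P)"] by blast
    have "y \<in> convex hull P" using y interior_subset by blast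
    moreover have "a \<noteq> b" using assms(5) by auto
    ultimately have "\<exists>F\<in>lower_triangles h P. y \<in> convex hull F"
      using assms y(2) by (intro lower_cover_generic) auto
    then show False using y by (auto simp: U_def)
  qed
qed

section \<open>Circumcircles and the empty-circle condition\<close>

lemma incirc_dist:
  assumes "dist a z = r" "dist b z = r" "dist c z = r"
  shows "incirc sqn a b c p = orient a b c * ((dist p z)\<^sup>2 - r\<^sup>2)"
proof -
  have d: "(dist q z)\<^sup>2 = sqn q - 2 * Re z * Re q - 2 * Im z * Im q + sqn z" for q
    by (simp only: dist_norm cmod_power2) (simp add: power2_eq_square algebra_simps)
  have q: "sqn q = r\<^sup>2 + 2 * Re z * Re q + 2 * Im z * Im q - sqn z" if "dist q z = r" for q
    using d[of q] that by simp
  have R: "orient p b c * Re a + orient a p c * Re b + orient a b p * Re c = orient a b c * Re p"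
    "orient p b c * Im a + orient a p c * Im b + orient a b p * Im c = orient a b c * Im p"
    by (simp_all add: orient_eq algebra_simps)
  have "incirc sqn a b c p = sqn p * orient a b c
    - ((r\<^sup>2 - sqn z) * (orient p b c + orient a p c + orient a b p)
     + 2 * Re z * (orient p b c * Re a + orient a p c * Re b + orient a b p * Re c)
     + 2 * Im z * (orient p b c * Im a + orient a p c * Im b + orient a b p * Im c))"
    unfolding incirc_def q[OF assms(1)] q[OF assms(2)] q[OF assms(3)] by (simp only: algebra_simps)
  also have "\<dots> = orient a b c * ((dist p z)\<^sup>2 - r\<^sup>2)"
    unfolding R orient_sum d by (simp only: algebra_simps)
  finally show ?thesis .
qed

lemma circumcenter:
  assumes "orient a b c \<noteq> 0"
  obtains z where "dist b z = dist a z" "dist c z = dist a z"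
proof -
  define B C where "B = b - a" and "C = c - a"
  \<comment> \<open>Cramer's rule for the centre \<open>a + Complex X Y\<close>: being equidistant
    from \<open>a\<close> and \<open>b\<close>, and from \<open>a\<close> and \<open>c\<close>,
    amounts to two linear equations with determinant proportional to
    \<open>orient a b c\<close>.\<close>
  define X Y where "X = (Im C * sqn B - Im B * sqn C) / (2 * orient a b c)"
    and "Y = (Re B * sqn C - Re C * sqn B) / (2 * orient a b c)"
  have O: "orient a b c = Re B * Im C - Im B * Re C" by (simp add: orient_eq B_def C_def)
  have XY: "2 * orient a b c * X = Im C * sqn B - Im B * sqn C"
    "2 * orient a b c * Y = Re B * sqn C - Re C * sqn B"
    using assms by (simp_all add: X_def Y_def)
  have "orient a b c * (2 * (X * Re B + Y * Im B)) = (2 * orient a b c * X) * Re B + (2 * orient a b c * Y) * Im B"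
    "orient a b c * (2 * (X * Re C + Y * Im C)) = (2 * orient a b c * X) * Re C + (2 * orient a b c * Y) * Im C"
    by (simp_all add: algebra_simps)
  then have "orient a b c * (2 * (X * Re B + Y * Im B)) = orient a b c * sqn B"
    "orient a b c * (2 * (X * Re C + Y * Im C)) = orient a b c * sqn C"
    unfolding XY by (simp_all add: O algebra_simps)
  then have 2: "2 * (X * Re B + Y * Im B) = sqn B" "2 * (X * Re C + Y * Im C) = sqn C"
    using assms by simp_all
  define z where "z = a + Complex X Y"
  have "(dist b z)\<^sup>2 = (dist a z)\<^sup>2 + sqn B - 2 * (X * Re B + Y * Im B)"
    "(dist c z)\<^sup>2 = (dist a z)\<^sup>2 + sqn C - 2 * (X * Re C + Y * Im C)"
    by (simp_all only: dist_norm cmod_power2) (simp_all add: z_def B_def C_def power2_eq_square algebra_simps)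
  then have "(dist b z)\<^sup>2 = (dist a z)\<^sup>2" "(dist c z)\<^sup>2 = (dist a z)\<^sup>2"
    unfolding 2 by simp_all
  then show ?thesis using that[of z] by simp
qed

lemma empty_circle_iff:
  assumes "0 < orient a b c"
  shows "(\<exists>z r. (\<forall>q\<in>{a, b, c}. dist q z = r) \<and> (\<forall>p\<in>P. r \<le> dist p z))
    \<longleftrightarrow> (\<forall>p\<in>P. 0 \<le> incirc sqn a b c p)"
proof
  assume "\<exists>z r. (\<forall>q\<in>{a, b, c}. dist q z = r) \<and> (\<forall>p\<in>P. r \<le> dist p z)"
  then obtain z r where *: "dist a z = r" "dist b z = r" "dist c z = r" "\<forall>p\<in>P. r \<le> dist p z" by auto
  have "0 \<le> r" using *(1) by auto
  then show "\<forall>p\<in>P. 0 \<le> incirc sqn a b c p"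
    unfolding incirc_dist[OF *(1-3)] using *(4) assms by (auto intro!: mult_nonneg_nonneg power_mono)
next
  assume *: "\<forall>p\<in>P. 0 \<le> incirc sqn a b c p"
  obtain z where z: "dist b z = dist a z" "dist c z = dist a z"
    using circumcenter[of a b c] assms by auto
  have "dist a z \<le> dist p z" if "p \<in> P" for p
  proof -
    have "0 \<le> (dist p z)\<^sup>2 - (dist a z)\<^sup>2"
      using * that assms unfolding incirc_dist[OF refl z] by (simp add: zero_le_mult_iff)
    then show ?thesis by (simp add: power2_le_iff_abs_le)
  qed
  then show "\<exists>z r. (\<forall>q\<in>{a, b, c}. dist q z = r) \<and> (\<forall>p\<in>P. r \<le> dist p z)"
    using z by (intro exI[of _ z] exI[of _ "dist a z"]) auto
qed

section \<open>Uniqueness of the Delaunay triangulation\<close>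

text \<open>Only lower triangles are constrained. For \<open>h = sqn\<close>, cocircular quadruples
  remain allowed when their circle has a point strictly inside.\<close>

definition generic_heights :: "(complex \<Rightarrow> real) \<Rightarrow> complex set \<Rightarrow> bool" where
  "generic_heights h P \<longleftrightarrow> (\<forall>a\<in>P. \<forall>b\<in>P. \<forall>c\<in>P. 0 < orient a b c \<longrightarrow>
     (\<forall>p\<in>P. 0 \<le> incirc h a b c p) \<longrightarrow> (\<forall>p\<in>P - {a, b, c}. 0 < incirc h a b c p))"

lemma generic_heightsD:
  "\<lbrakk>generic_heights h P; a \<in> P; b \<in> P; c \<in> P; 0 < orient a b c;
    \<forall>p\<in>P. 0 \<le> incirc h a b c p; p \<in> P; incirc h a b c p = 0\<rbrakk> \<Longrightarrow> p \<in> {a, b, c}"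
  unfolding generic_heights_def by (metis DiffI less_irrefl)

lemma hull_interior_coords:
  assumes "0 < orient a b c" "x \<in> interior (convex hull {a, b, c})"
  obtains u v w where "u + v + w = 1" "x = u *\<^sub>R a + v *\<^sub>R b + w *\<^sub>R c" "0 < u" "0 < v" "0 < w"
proof -
  have ne: "orient a b c \<noteq> 0" using assms(1) by simp
  show ?thesis
    using assms
    by (intro that[OF barycentric(1)[OF ne, of x] barycentric(2)[OF ne, of x, symmetric]])
      (simp_all add: in_interior_triangle_iff)
qed

text \<open>By \<open>lower_overlap\<close> the vertices of \<open>F\<close>, once lifted, lie in
  the plane of \<open>G\<close>, and genericity leaves only the vertices of \<open>G\<close>
  there.\<close>

lemma generic_lower_unique:
  assumes "generic_heights h P" "F \<in> lower_triangles h P" "G \<in> lower_triangles h P"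
    and "x \<in> interior (convex hull F)" "x \<in> convex hull G"
  shows "F = G"
proof -
  obtain a b c where F: "F = {a, b, c}" "a \<in> P" "b \<in> P" "c \<in> P" "0 < orient a b c"
    "\<forall>p\<in>P. 0 \<le> incirc h a b c p"
    by (rule lower_triangles_cases[OF assms(2)]) (rule that)
  obtain d e f where G: "G = {d, e, f}" "d \<in> P" "e \<in> P" "f \<in> P" "0 < orient d e f"
    "\<forall>p\<in>P. 0 \<le> incirc h d e f p"
    by (rule lower_triangles_cases[OF assms(3)]) (rule that)
  obtain u v w where x: "u + v + w = 1" "x = u *\<^sub>R a + v *\<^sub>R b + w *\<^sub>R c" "0 < u" "0 < v" "0 < w"
    using hull_interior_coords[OF F(5)] assms(4) F(1) by blast
  obtain r s t where y: "r + s + t = 1" "x = r *\<^sub>R d + s *\<^sub>R e + t *\<^sub>R f" "0 \<le> r" "0 \<le> s" "0 \<le> t"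
    using assms(5) unfolding G(1) convex_hull_3 by blast
  have 0: "incirc h d e f a = 0 \<and> incirc h d e f b = 0 \<and> incirc h d e f c = 0"
    by (rule lower_overlap[OF F(5) G(5) _ _ _ _ _ _ x y]) (use F(2-4,6) G(2-4,6) in blast)+
  have "p \<in> G" if "p \<in> P" "incirc h d e f p = 0" for p
    using generic_heightsD[OF assms(1) G(2-6) that] G(1) by blast
  then have "F \<subseteq> G" using 0 F(1-4) by blast
  moreover have "card F = 3" "card G = 3"
    unfolding F(1) G(1) using F(5) G(5) by (simp_all only: card_orient less_imp_neq[symmetric] not_False_eq_True)
  moreover have "finite G" using G(1) by simp
  ultimately show ?thesis by (simp add: card_subset_eq)
qed

text \<open>The variance of a three-point distribution, written as a sum over pairs.\<close>

lemma variance_three_points: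
  fixes a b c :: real
  assumes "u + v + w = 1"
  shows "u * a\<^sup>2 + v * b\<^sup>2 + w * c\<^sup>2 - (u * a + v * b + w * c)\<^sup>2
    = u * v * (a - b)\<^sup>2 + u * w * (a - c)\<^sup>2 + v * w * (b - c)\<^sup>2"
proof -
  have u: "u = 1 - v - w" using assms by simp
  show ?thesis unfolding u by (simp add: power2_eq_square algebra_simps)
qed

lemma strict_convexity:
  assumes "u + v + w = 1"
  shows "u * sqn a + v * sqn b + w * sqn c - sqn (u *\<^sub>R a + v *\<^sub>R b + w *\<^sub>R c)
    = u * v * sqn (a - b) + u * w * sqn (a - c) + v * w * sqn (b - c)"
  using variance_three_points[OF assms, of "Re a" "Re b" "Re c"]
    variance_three_points[OF assms, of "Im a" "Im b" "Im c"]
  by (simp only: plus_complex.simps minus_complex.simps scaleR_complex.simps distrib_left)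

text \<open>By strict convexity of \<open>sqn\<close>, every point of the closed triangle other than
  a vertex has negative power with respect to the circumcircle.\<close>

lemma empty_circle_hull:
  assumes "0 < orient a b c" "0 \<le> incirc sqn a b c p" "p \<in> convex hull {a, b, c}"
  shows "p \<in> {a, b, c}"
proof -
  obtain u v w where p: "0 \<le> u" "0 \<le> v" "0 \<le> w" "u + v + w = 1" "p = u *\<^sub>R a + v *\<^sub>R b + w *\<^sub>R c"
    using assms(3) unfolding convex_hull_3 by blast
  have d: "a \<noteq> b" "b \<noteq> c" "a \<noteq> c" using orient_distinct[of a b c] assms(1) by auto
  have sq: "sqn z = 0 \<longleftrightarrow> z = 0" for z by (simp add: complex_eq_iff sum_power2_eq_zero_iff)
  have eq: "incirc sqn a b c p = orient a b c * (sqn p - (u * sqn a + v * sqn b + w * sqn c))"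
    unfolding incirc_def orient_coords[OF p(4,5)] by (simp only: algebra_simps)
  have "0 \<le> sqn p - (u * sqn a + v * sqn b + w * sqn c)"
    using assms(1,2) unfolding eq by (simp add: zero_le_mult_iff)
  then have le: "u * v * sqn (a - b) + u * w * sqn (a - c) + v * w * sqn (b - c) \<le> 0"
    using strict_convexity[OF p(4), of a b c] p(5) by simp
  have nn: "0 \<le> u * v * sqn (a - b)" "0 \<le> u * w * sqn (a - c)" "0 \<le> v * w * sqn (b - c)"
    using p(1-3) by simp_all
  have z: "u * v * sqn (a - b) = 0" "u * w * sqn (a - c) = 0" "v * w * sqn (b - c) = 0"
    using le nn by linarith+
  have "u = 0 \<or> v = 0" "u = 0 \<or> w = 0" "v = 0 \<or> w = 0"
    using z d unfolding mult_eq_0_iff sq by simp_all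
  then consider "v = 0" "w = 0" | "u = 0" "w = 0" | "u = 0" "v = 0" by blast
  then show ?thesis using p(4,5) by cases simp_all
qed

text \<open>The inclusion in \<open>lower_triangles sqn P\<close> serves the last clause of
  \<open>triangulation\<close>: for general heights a point may hover above a lower triangle without
  being one of its vertices, while an empty circle excludes it.\<close>

lemma triangulation_lower:
  assumes "finite P" "a \<in> P" "b \<in> P" "c \<in> P" "0 < orient a b c"
    and gen: "generic_heights h P" and sub: "lower_triangles h P \<subseteq> lower_triangles sqn P"
  shows "triangulation P (lower_triangles h P)"
  unfolding triangulation_def
proof (intro conjI ballI impI)
  show "finite (lower_triangles h P)" by (rule finite_lower_triangles[OF assms(1)])
next
  fix F assume "F \<in> lower_triangles h P"
  then obtain d e f where F: "F = {d, e, f}" "d \<in> P" "e \<in> P" "f \<in> P" "0 < orient d e f"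
    "\<forall>p\<in>P. 0 \<le> incirc h d e f p"
    by (rule lower_triangles_cases) (rule that)
  show "F \<subseteq> P" using F by simp
  show "card F = 3" unfolding F(1) by (rule card_orient) (use F(5) in simp)
  show "\<not> collinear F" unfolding F(1) collinear_iff_orient using F(5) by simp
next
  fix F G assume "F \<in> lower_triangles h P" "G \<in> lower_triangles h P" "F \<noteq> G"
  then show "interior (convex hull F) \<inter> interior (convex hull G) = {}"
    using generic_lower_unique[OF gen] interior_subset by blast
next
  have "convex hull F \<subseteq> convex hull P" if "F \<in> lower_triangles h P" for F
    using that by (intro hull_mono) (auto elim!: lower_triangles_cases)
  then show "\<Union> ((\<lambda>F. convex hull F) ` lower_triangles h P) = convex hull P"
    using lower_cover[OF assms(1-5), of h] by blast
next
  fix F assume "F \<in> lower_triangles h P"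
  then have "F \<in> lower_triangles sqn P" using sub by blast
  then obtain d e f where F: "F = {d, e, f}" "d \<in> P" "e \<in> P" "f \<in> P" "0 < orient d e f"
    "\<forall>p\<in>P. 0 \<le> incirc sqn d e f p"
    by (rule lower_triangles_cases) (rule that)
  show "P \<inter> convex hull F = F"
    using F empty_circle_hull[OF F(5) bspec[OF F(6)]] hull_subset[of F convex] by blast
qed

lemma triangulationD:
  assumes "triangulation P T"
  shows "F \<in> T \<Longrightarrow> F \<subseteq> P \<and> card F = 3 \<and> \<not> collinear F"
    and "\<Union> ((\<lambda>F. convex hull F) ` T) = convex hull P"
    and "\<lbrakk>F \<in> T; G \<in> T; F \<noteq> G\<rbrakk> \<Longrightarrow> interior (convex hull F) \<inter> interior (convex hull G) = {}"
  using assms unfolding triangulation_def by simp_all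

lemma delaunay_iff:
  "delaunay_triangulation P T \<longleftrightarrow> triangulation P T \<and> T \<subseteq> lower_triangles sqn P"
proof -
  have key: "(\<exists>z r. (\<forall>q\<in>F. dist q z = r) \<and> (\<forall>p\<in>P. r \<le> dist p z)) \<longleftrightarrow> F \<in> lower_triangles sqn P"
    if tri: "triangulation P T" "F \<in> T" for F
  proof -
    have F: "F \<subseteq> P" "card F = 3" "\<not> collinear F" using triangulationD(1)[OF tri] by simp_all
    obtain a b c where abc: "F = {a, b, c}" "0 < orient a b c" using ccw_order[OF F(3,2)] by blast
    have "{a, b, c} \<in> lower_triangles sqn P \<longleftrightarrow> (\<forall>p\<in>P. 0 \<le> incirc sqn a b c p)"
    proof
      assume "{a, b, c} \<in> lower_triangles sqn P"
      from lower_triangle_ccw[OF this abc(2)] show "\<forall>p\<in>P. 0 \<le> incirc sqn a b c p" by (elim conjE)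
    next
      assume *: "\<forall>p\<in>P. 0 \<le> incirc sqn a b c p"
      show "{a, b, c} \<in> lower_triangles sqn P"
        by (rule lower_trianglesI[OF _ _ _ abc(2)]) (use F(1) abc(1) * in blast)+
    qed
    then show ?thesis
      unfolding abc(1) by (simp only: empty_circle_iff[OF abc(2)])
  qed
  show ?thesis unfolding delaunay_triangulation_def
  proof (rule conj_cong[OF refl])
    assume tri: "triangulation P T"
    show "(\<forall>F\<in>T. \<exists>z r. (\<forall>q\<in>F. dist q z = r) \<and> (\<forall>p\<in>P. r \<le> dist p z)) \<longleftrightarrow> T \<subseteq> lower_triangles sqn P"
      unfolding subset_eq by (rule ball_cong[OF refl]) (rule key[OF tri])
  qed
qed

text \<open>Any Delaunay triangulation covers the centroid of a given lower triangle
  \<open>F\<close> by some lower triangle, and generic heights force that one to be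
  \<open>F\<close>.\<close>

lemma delaunay_generic:
  assumes "finite P" "a \<in> P" "b \<in> P" "c \<in> P" "0 < orient a b c" "generic_heights sqn P"
  shows "delaunay_unique P" "the_delaunay P = lower_triangles sqn P"
proof -
  have D: "delaunay_triangulation P (lower_triangles sqn P)"
    using triangulation_lower[OF assms] by (simp add: delaunay_iff)
  have U: "T = lower_triangles sqn P" if T: "delaunay_triangulation P T" for T
  proof
    show "T \<subseteq> lower_triangles sqn P" using T by (simp add: delaunay_iff)
    show "lower_triangles sqn P \<subseteq> T"
    proof
      fix F assume F: "F \<in> lower_triangles sqn P"
      then obtain d e f where def: "F = {d, e, f}" "d \<in> P" "e \<in> P" "f \<in> P" "0 < orient d e f"
        "\<forall>p\<in>P. 0 \<le> incirc sqn d e f p"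
        by (rule lower_triangles_cases) (rule that)
      obtain x where x: "x \<in> interior (convex hull F)"
        using triangle_interior_point[OF def(5)] def(1) by blast
      have "x \<in> convex hull P"
        using x interior_subset[of "convex hull F"] hull_mono[of F P convex] def by blast
      moreover have "\<Union> ((\<lambda>F. convex hull F) ` T) = convex hull P"
        using T unfolding delaunay_iff by (intro triangulationD(2)) simp
      ultimately obtain G where G: "G \<in> T" "x \<in> convex hull G" by blast
      then have "G \<in> lower_triangles sqn P" using T unfolding delaunay_iff by blast
      then have "F = G" using generic_lower_unique[OF assms(6) F _ x G(2)] by blast
      then show "F \<in> T" using G by simp
    qed
  qed
  show "delaunay_unique P" unfolding delaunay_unique_def using D U by blast
  show "the_delaunay P = lower_triangles sqn P"
    unfolding the_delaunay_def using D U by (rule the_equality)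
qed

text \<open>As a polynomial in \<open>t\<close> the determinant has coefficient \<open>orient a b c\<close> at \<open>t ^ (idx p + 2)\<close>.\<close>

lemma incirc_lift_poly:
  fixes idx :: "complex \<Rightarrow> nat" and g :: "complex \<Rightarrow> real"
  assumes "inj_on idx {a, b, c, p}" "p \<notin> {a, b, c}" "orient a b c \<noteq> 0"
  shows "\<forall>\<^sub>F t in at_right 0. incirc (\<lambda>p. h p + t * g p + t ^ (idx p + 2)) a b c p \<noteq> 0"
proof -
  define q where "q = [:incirc h a b c p, incirc g a b c p:] + monom (orient a b c) (idx p + 2)
    - monom (orient p b c) (idx a + 2) - monom (orient a p c) (idx b + 2) - monom (orient a b p) (idx c + 2)"
  have "idx a \<noteq> idx p" "idx b \<noteq> idx p" "idx c \<noteq> idx p"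
    using assms(1,2) unfolding inj_on_def by blast+
  \<comment> \<open>The offset 2 keeps this power clear of the linear part, and injectivity of
    \<open>idx\<close> keeps it clear of the other three monomials.\<close>
  then have "coeff q (idx p + 2) = orient a b c"
    by (simp add: q_def numeral_2_eq_2)
  then have "q \<noteq> 0" using assms(3) by auto
  then have "finite {t. poly q t = 0}" by (rule poly_roots_finite)
  then have "\<forall>\<^sub>F t in at_right 0. t \<notin> {t. poly q t = 0}"
    using filter_leD[OF at_within_le_at] islimpt_finite islimpt_iff_eventually by blast
  moreover have "poly q t = incirc (\<lambda>p. h p + t * g p + t ^ (idx p + 2)) a b c p" for t
    unfolding q_def incirc_def by (simp add: poly_monom algebra_simps)
  ultimately show ?thesis by simp
qed

lemma eventually_const_imp: "(C \<Longrightarrow> eventually Q F) \<Longrightarrow> eventually (\<lambda>t. C \<longrightarrow> Q t) F"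
  by (cases C) auto

text \<open>Two perturbations on different scales: \<open>t * g\<close> lifts all points outside
  \<open>F0\<close> to first order, which keeps \<open>F0\<close> a lower triangle even if its
  circle carries further points, and the distinct higher powers of \<open>t\<close> make the heights
  generic. Strict violations of emptiness persist for small \<open>t\<close>, so no new triangles
  arise.\<close>

lemma delaunay_containing:
  assumes "finite P" "F0 \<in> lower_triangles sqn P"
  shows "\<exists>T. delaunay_triangulation P T \<and> F0 \<in> T"
proof -
  obtain a0 b0 c0 where F0: "F0 = {a0, b0, c0}" "a0 \<in> P" "b0 \<in> P" "c0 \<in> P" "0 < orient a0 b0 c0"
    "\<forall>p\<in>P. 0 \<le> incirc sqn a0 b0 c0 p"
    by (rule lower_triangles_cases[OF assms(2)]) (rule that)
  obtain idx :: "complex \<Rightarrow> nat" where idx: "inj_on idx P"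
    using finite_imp_inj_to_nat_seg[OF assms(1)] by blast
  define g :: "complex \<Rightarrow> real" where "g p = (if p \<in> F0 then 0 else 1)" for p
  define h where "h t p = sqn p + t * g p + t ^ (idx p + 2)" for t p
  have lim: "((\<lambda>t. incirc (h t) a b c p) \<longlongrightarrow> incirc sqn a b c p) (at_right 0)" for a b c p
  proof -
    have "((\<lambda>t. h t q) \<longlongrightarrow> sqn q + 0 * g q + 0 ^ (idx q + 2)) (at_right 0)" for q
      unfolding h_def by (intro tendsto_intros)
    then have "((\<lambda>t. h t q) \<longlongrightarrow> sqn q) (at_right 0)" for q by simp
    then show ?thesis unfolding incirc_def by (intro tendsto_intros)
  qed
  have 1: "\<forall>\<^sub>F t in at_right 0. incirc (h t) a b c p \<noteq> 0"
    if "a \<in> P" "b \<in> P" "c \<in> P" "0 < orient a b c" "p \<in> P - {a, b, c}" for a b c p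
    unfolding h_def
    by (rule incirc_lift_poly[OF inj_on_subset[OF idx]]) (use that in auto)
  have 2: "\<forall>\<^sub>F t in at_right 0. incirc (h t) a b c p < 0" if "incirc sqn a b c p < 0" for a b c p
    using order_tendstoD(2)[OF lim that] .
  have 3: "\<forall>\<^sub>F t in at_right 0. 0 < incirc (h t) a0 b0 c0 p" if p: "p \<in> P - F0" for p
  proof -
    \<comment> \<open>The perturbation of the determinant divided by \<open>t\<close>. Since
      \<open>g\<close> is 1 at \<open>p\<close> and 0 at the vertices of \<open>F0\<close>, its
      limit is \<open>orient a0 b0 c0\<close>.\<close>
    define k where "k t = orient a0 b0 c0 + t ^ (idx p + 1) * orient a0 b0 c0 - t ^ (idx a0 + 1) * orient p b0 c0
      - t ^ (idx b0 + 1) * orient a0 p c0 - t ^ (idx c0 + 1) * orient a0 b0 p" for t :: real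
    have eq: "incirc (h t) a0 b0 c0 p = incirc sqn a0 b0 c0 p + t * k t" for t
      using p unfolding incirc_def h_def k_def g_def F0(1) by (simp add: algebra_simps)
    have "(k \<longlongrightarrow> orient a0 b0 c0 + 0 ^ (idx p + 1) * orient a0 b0 c0 - 0 ^ (idx a0 + 1) * orient p b0 c0
      - 0 ^ (idx b0 + 1) * orient a0 p c0 - 0 ^ (idx c0 + 1) * orient a0 b0 p) (at_right 0)"
      unfolding k_def by (intro tendsto_intros)
    then have "(k \<longlongrightarrow> orient a0 b0 c0) (at_right 0)" by simp
    from order_tendstoD(1)[OF this F0(5)] have "\<forall>\<^sub>F t in at_right 0. 0 < k t" .
    moreover have "\<forall>\<^sub>F t in at_right (0::real). 0 < t" by (simp add: eventually_at_filter)
    ultimately show ?thesis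
      by eventually_elim (use bspec[OF F0(6), of p] p eq in \<open>auto intro: add_nonneg_pos\<close>)
  qed
  have "\<forall>\<^sub>F t in at_right 0. \<forall>a\<in>P. \<forall>b\<in>P. \<forall>c\<in>P. \<forall>p\<in>P.
      (0 < orient a b c \<and> p \<notin> {a, b, c} \<longrightarrow> incirc (h t) a b c p \<noteq> 0) \<and>
      (incirc sqn a b c p < 0 \<longrightarrow> incirc (h t) a b c p < 0) \<and>
      (p \<notin> F0 \<longrightarrow> 0 < incirc (h t) a0 b0 c0 p)"
    by (intro eventually_ball_finite ballI eventually_conj assms(1) eventually_const_imp)
      (blast intro: 1 2 3)+
  from eventually_happens'[OF _ this] obtain t where t0: "\<forall>a\<in>P. \<forall>b\<in>P. \<forall>c\<in>P. \<forall>p\<in>P.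
      (0 < orient a b c \<and> p \<notin> {a, b, c} \<longrightarrow> incirc (h t) a b c p \<noteq> 0) \<and>
      (incirc sqn a b c p < 0 \<longrightarrow> incirc (h t) a b c p < 0) \<and>
      (p \<notin> F0 \<longrightarrow> 0 < incirc (h t) a0 b0 c0 p)"
    by auto
  have t: "\<And>a b c p. \<lbrakk>a \<in> P; b \<in> P; c \<in> P; p \<in> P; 0 < orient a b c; p \<notin> {a, b, c}\<rbrakk> \<Longrightarrow> incirc (h t) a b c p \<noteq> 0"
    "\<And>a b c p. \<lbrakk>a \<in> P; b \<in> P; c \<in> P; p \<in> P; incirc sqn a b c p < 0\<rbrakk> \<Longrightarrow> incirc (h t) a b c p < 0"
    "\<And>p. \<lbrakk>p \<in> P; p \<notin> F0\<rbrakk> \<Longrightarrow> 0 < incirc (h t) a0 b0 c0 p"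
    using t0 by blast+
  have gen: "generic_heights (h t) P"
    unfolding generic_heights_def using t(1) by (metis DiffD1 DiffD2 order_less_le)
  have sub: "lower_triangles (h t) P \<subseteq> lower_triangles sqn P"
  proof
    fix F assume "F \<in> lower_triangles (h t) P"
    then obtain d e f where F: "F = {d, e, f}" "d \<in> P" "e \<in> P" "f \<in> P" "0 < orient d e f"
      "\<forall>p\<in>P. 0 \<le> incirc (h t) d e f p"
      by (rule lower_triangles_cases) (rule that)
    have "0 \<le> incirc sqn d e f p" if "p \<in> P" for p
      using bspec[OF F(6) that] t(2)[OF F(2-4) that] by (meson not_le)
    then show "F \<in> lower_triangles sqn P" unfolding F(1) using F by (intro lower_trianglesI)
  qed
  have "F0 \<in> lower_triangles (h t) P" unfolding F0(1)
  proof (rule lower_trianglesI)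
    fix p assume "p \<in> P"
    then show "0 \<le> incirc (h t) a0 b0 c0 p" using t(3)[of p] F0(1) by (cases "p \<in> F0") auto
  qed (use F0 in auto)
  moreover have "delaunay_triangulation P (lower_triangles (h t) P)"
    unfolding delaunay_iff using triangulation_lower[OF assms(1) F0(2-5) gen sub] sub by blast
  ultimately show ?thesis by blast
qed

text \<open>A point close enough to the midpoint of the common edge, on the common side, is interior
  to both triangles.\<close>

lemma triangles_same_side_overlap:
  assumes "0 < orient a b c" "0 < orient d b c"
  shows "interior (convex hull {a, b, c}) \<inter> interior (convex hull {d, b, c}) \<noteq> {}"
proof -
  let ?O = "orient a b c"
  define M where "M = \<bar>orient a d c\<bar> + \<bar>orient a b d\<bar>"
  \<comment> \<open>The weight of \<open>d\<close> in the point \<open>y\<close>. The areas that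
    \<open>y\<close> cuts off at the other two edges of \<open>a\<close>, \<open>b\<close>,
    \<open>c\<close> are at least \<open>(1 - \<gamma>) / 2 * orient a b c - \<gamma> * M\<close>,
    which this choice makes positive.\<close>
  define \<gamma> where "\<gamma> = ?O / (2 * (?O + 2 * M))"
  have M: "0 \<le> M" by (simp add: M_def)
  have g: "0 < \<gamma>" "\<gamma> * (?O + 2 * M) = ?O / 2" using assms(1) M by (simp_all add: \<gamma>_def field_simps)
  have "\<gamma> * ?O \<le> \<gamma> * (?O + 2 * M)" using g(1) M by (intro mult_left_mono) auto
  then have g1: "\<gamma> < 1" using g(2) assms(1) by (simp add: mult_le_cancel_right)
  define y where "y = \<gamma> *\<^sub>R d + ((1 - \<gamma>) / 2) *\<^sub>R b + ((1 - \<gamma>) / 2) *\<^sub>R c"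
  have s: "\<gamma> + (1 - \<gamma>) / 2 + (1 - \<gamma>) / 2 = 1" by (simp add: field_simps)
  have "0 < orient y b c" "0 < orient d y c" "0 < orient d b y"
    unfolding orient_coords[OF s y_def] using g g1 assms by simp_all
  then have in2: "y \<in> interior (convex hull {d, b, c})" using assms by (simp add: in_interior_triangle_iff)
  have oy: "orient y b c = \<gamma> * orient d b c" by (rule orient_coords[OF s y_def])
  have "orient c a y = \<gamma> * orient c a d + (1 - \<gamma>) / 2 * orient c a b + (1 - \<gamma>) / 2 * orient c a c"
    "orient a b y = \<gamma> * orient a b d + (1 - \<gamma>) / 2 * orient a b b + (1 - \<gamma>) / 2 * orient a b c"
    unfolding y_def by (rule orient_affine[OF s])+
  then have o: "orient a y c = \<gamma> * orient a d c + (1 - \<gamma>) / 2 * ?O"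
     "orient a b y = \<gamma> * orient a b d + (1 - \<gamma>) / 2 * ?O"
    using orient_cyclic[of a y c] orient_cyclic[of a d c] orient_cyclic[of a b c] by simp_all
  have "\<gamma> * - M \<le> \<gamma> * orient a d c" "\<gamma> * - M \<le> \<gamma> * orient a b d"
    using g(1) by (intro mult_left_mono; simp add: M_def)+
  moreover have "\<gamma> * M < (1 - \<gamma>) / 2 * ?O"
    using g(2) assms(1) by (simp add: field_simps)
  ultimately have "0 < orient a y c" "0 < orient a b y" unfolding o by simp_all
  moreover have "0 < orient y b c" unfolding oy using g assms by simp
  ultimately have "y \<in> interior (convex hull {a, b, c})" using assms by (simp add: in_interior_triangle_iff)
  with in2 show ?thesis by blast
qed

text \<open>Every lower triangle lies in some Delaunay triangulation, hence in the unique one. A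
  fourth point \<open>d\<close> on an empty circle would produce a second lower triangle on an edge
  of the first, on the same side, and the two would overlap.\<close>

lemma unique_imp_generic:
  assumes "finite P" "delaunay_unique P"
  shows "generic_heights sqn P"
proof -
  obtain T where T: "delaunay_triangulation P T" "\<And>T'. delaunay_triangulation P T' \<Longrightarrow> T' = T"
    using assms(2) unfolding delaunay_unique_def by blast
  have "lower_triangles sqn P \<subseteq> T" using delaunay_containing[OF assms(1)] T(2) by blast
  then have disj: "interior (convex hull F) \<inter> interior (convex hull G) = {}"
    if "F \<in> lower_triangles sqn P" "G \<in> lower_triangles sqn P" "F \<noteq> G" for F G
    using triangulationD(3)[of P T F G] that T(1) \<open>lower_triangles sqn P \<subseteq> T\<close> unfolding delaunay_iff by blast
  have key: False if abc: "a \<in> P" "b \<in> P" "c \<in> P" "d \<in> P" "d \<notin> {a, b, c}" "0 < orient a b c"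
    "\<And>p. p \<in> P \<Longrightarrow> 0 \<le> incirc sqn a b c p" "incirc sqn a b c d = 0" "0 < orient d b c" for a b c d
  proof -
    obtain z where z: "dist b z = dist a z" "dist c z = dist a z"
      using circumcenter[of a b c] abc(6) by auto
    have "(dist d z)\<^sup>2 - (dist a z)\<^sup>2 = 0"
      using abc(6,8) unfolding incirc_dist[OF refl z] by simp
    then have dz: "dist d z = dist a z" by simp
    have "0 \<le> incirc sqn d b c p" if "p \<in> P" for p
      using abc(7)[OF that] abc(6,9) unfolding incirc_dist[OF refl z] incirc_dist[OF dz z]
      by (simp add: zero_le_mult_iff)
    then have "{d, b, c} \<in> lower_triangles sqn P" using abc by (intro lower_trianglesI)
    moreover have "{a, b, c} \<in> lower_triangles sqn P" using abc by (intro lower_trianglesI)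
    moreover have "{d, b, c} \<noteq> {a, b, c}" using abc(5) by blast
    ultimately show False using disj triangles_same_side_overlap[OF abc(6,9)] by blast
  qed
  show ?thesis unfolding generic_heights_def
  proof (intro ballI impI)
    fix a b c d
    assume abc: "a \<in> P" "b \<in> P" "c \<in> P" "0 < orient a b c" "\<forall>p\<in>P. 0 \<le> incirc sqn a b c p"
      and d: "d \<in> P - {a, b, c}"
    show "0 < incirc sqn a b c d"
    proof (rule ccontr)
      assume "\<not> 0 < incirc sqn a b c d"
      then have 0: "incirc sqn a b c d = 0" using abc(5) d by force
      have cyc: "orient b c a = orient a b c" "orient c a b = orient a b c"
        "orient d c a = orient a d c" "orient d a b = orient a b d"
        by (simp_all add: orient_eq algebra_simps)
      have ic: "incirc sqn b c a p = incirc sqn a b c p" "incirc sqn c a b p = incirc sqn a b c p" for p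
        by (simp_all only: incirc_cyclic)
      \<comment> \<open>The three areas add up to \<open>orient a b c\<close>, so \<open>d\<close>
        lies strictly on the inner side of at least one edge.\<close>
      consider "0 < orient d b c" | "0 < orient a d c" | "0 < orient a b d"
        using orient_sum[of d b c a] abc(4) by linarith
      then show False
      proof cases
        case 1 then show False using key[of a b c d] abc d 0 by blast
      next
        case 2 then show False using key[of b c a d] abc d 0 unfolding cyc ic by blast
      next
        case 3 then show False using key[of c a b d] abc d 0 unfolding cyc ic by blast
      qed
    qed
  qed
qed

section \<open>The Bloch--Wigner function\<close>

lemma segment_slit:
  assumes "1 - w \<notin> \<real>\<^sub>\<le>\<^sub>0"
  shows "closed_segment 0 w \<subseteq> {z::complex. 1 - z \<notin> \<real>\<^sub>\<le>\<^sub>0}"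
proof
  fix z assume "z \<in> closed_segment 0 w"
  then obtain u where u: "0 \<le> u" "u \<le> 1" "z = u *\<^sub>R w" by (auto simp: in_segment)
  show "z \<in> {z::complex. 1 - z \<notin> \<real>\<^sub>\<le>\<^sub>0}"
  proof (rule ccontr)
    assume "\<not> ?thesis"
    then have z: "Im z = 0" "1 \<le> Re z" by (auto simp: complex_nonpos_Reals_iff)
    then have "0 < u" using u by (cases "u = 0") auto
    then have "Im w = 0" using z u by simp
    moreover have "1 \<le> Re w"
    proof -
      have "1 \<le> u * Re w" using z(2) u(3) by simp
      moreover have "0 < Re w" using \<open>1 \<le> u * Re w\<close> \<open>0 < u\<close> by (smt (verit) mult_nonneg_nonpos)
      then have "u * Re w \<le> 1 * Re w" using u(2) by (intro mult_right_mono) auto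
      ultimately show ?thesis by simp
    qed
    ultimately show False using assms by (auto simp: complex_nonpos_Reals_iff)
  qed
qed

lemma starlike_slit: "starlike {z::complex. 1 - z \<notin> \<real>\<^sub>\<le>\<^sub>0}"
  unfolding starlike_def using segment_slit by (intro bexI[of _ 0]) auto

text \<open>The slit plane is starlike about 0, so the integrand with its singularity removed has a
  primitive \<open>G\<close> there, and \<open>dilog\<close> is \<open>G 0 - G\<close>.\<close>

lemma dilog_has_field_derivative:
  assumes "1 - w \<notin> \<real>\<^sub>\<le>\<^sub>0" "w \<noteq> 0"
  shows "(dilog has_field_derivative - Ln (1 - w) / w) (at w)"
proof -
  define S where "S = {z::complex. 1 - z \<notin> \<real>\<^sub>\<le>\<^sub>0}"
  \<comment> \<open>The value -1 is the limit at 0, where division by zero would give 0. The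
    correction alters the integrand at one parameter of the segment only, which the integral
    ignores.\<close>
  define g where "g t = (if t = 0 then - 1 else Ln (1 - t) / t)" for t :: complex
  have S: "S = (\<lambda>z. 1 - z) -` (- \<real>\<^sub>\<le>\<^sub>0)" by (auto simp: S_def)
  have "open S" unfolding S
    by (intro continuous_open_vimage continuous_intros) auto
  have Ln: "((\<lambda>t. Ln (1 - t)) has_field_derivative - 1 / (1 - t)) (at t)" if "t \<in> S" for t
    using that unfolding S_def by (auto intro!: derivative_eq_intros simp: inverse_eq_divide)
  have diff: "(g has_field_derivative (- 1 / (1 - t) * t - Ln (1 - t) * 1) / (t * t)) (at t)" if "t \<in> S - {0}" for t
  proof (rule has_field_derivative_transform_within_open[of "\<lambda>t. Ln (1 - t) / t" _ _ "- {0}"])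
    show "((\<lambda>t. Ln (1 - t) / t) has_field_derivative (- 1 / (1 - t) * t - Ln (1 - t) * 1) / (t * t)) (at t)"
      using that by (intro DERIV_divide Ln DERIV_ident) auto
  qed (use that in \<open>auto simp: g_def\<close>)
  have "continuous_on S g"
  proof (rule continuous_at_imp_continuous_on, rule ballI)
    fix t assume "t \<in> S"
    show "isCont g t"
    proof (cases "t = 0")
      case False
      then show ?thesis using diff[of t] \<open>t \<in> S\<close> by (auto intro: DERIV_isCont)
    next
      case True
      have "((\<lambda>h. (Ln (1 - (0 + h)) - Ln (1 - 0)) / h) \<longlongrightarrow> - 1 / (1 - 0)) (at 0)"
        using Ln[of 0] by (simp only: DERIV_def) (simp add: S_def)
      then have "((\<lambda>h. Ln (1 - h) / h) \<longlongrightarrow> - 1) (at 0)" by simp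
      then have "(g \<longlongrightarrow> - 1) (at 0)"
        by (rule Lim_transform_eventually) (simp add: g_def eventually_at_filter)
      then show ?thesis unfolding True isCont_def by (simp add: g_def)
    qed
  qed
  then obtain G where G: "\<And>x. x \<in> S \<Longrightarrow> (G has_field_derivative g x) (at x)"
    using holomorphic_starlike_primitive[of S g "{0}"] \<open>open S\<close> starlike_slit diff
    unfolding S_def field_differentiable_def by blast
  have dilog: "dilog x = G 0 - G x" if "x \<in> S" "x \<noteq> 0" for x
  proof -
    have "closed_segment 0 x \<subseteq> S" using segment_slit[of x] that(1) unfolding S_def by simp
    then have "(g has_contour_integral (G (pathfinish (linepath 0 x)) - G (pathstart (linepath 0 x)))) (linepath 0 x)"
      by (intro contour_integral_primitive[of S G g]) (auto intro: has_field_derivative_at_within[OF G])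
    then have "((\<lambda>t. g (linepath 0 x t) * (x - 0)) has_integral (G x - G 0)) {0..1}"
      by (simp add: has_contour_integral_linepath)
    then have "((\<lambda>t. (\<lambda>t. Ln (1 - t) / t) (linepath 0 x t) * (x - 0)) has_integral (G x - G 0)) {0..1}"
      by (rule has_integral_spike_finite[of "{0}", rotated 2])
        (use that in \<open>auto simp: g_def linepath_def\<close>)
    then have "((\<lambda>t. Ln (1 - t) / t) has_contour_integral (G x - G 0)) (linepath 0 x)"
      unfolding has_contour_integral_linepath .
    then show ?thesis unfolding dilog_def by (simp add: contour_integral_unique)
  qed
  have "((\<lambda>x. G 0 - G x) has_field_derivative 0 - g w) (at w)"
    using G[of w] assms by (intro derivative_intros) (auto simp: S_def)
  then have "(dilog has_field_derivative 0 - g w) (at w)"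
    by (rule has_field_derivative_transform_within_open[of _ _ _ "S - {0}"])
      (use \<open>open S\<close> assms dilog in \<open>auto simp: S_def\<close>)
  then show ?thesis using assms by (simp add: g_def)
qed

text \<open>The dilogarithm contributes \<open>- Arg (1 - w)\<close> times the differential of
  \<open>ln (cmod w)\<close>, which the product rule in the second summand cancels. What remains is
  \<open>ln (cmod w)\<close> d arg(1 - w) minus \<open>ln (cmod (1 - w))\<close> d arg w.\<close>

lemma bloch_wigner_has_derivative:
  assumes "0 < Im w"
  shows "(bloch_wigner has_derivative
    (\<lambda>h. - ln (cmod (1 - w)) * Im (h / w) - ln (cmod w) * Im (h / (1 - w)))) (at w)"
proof -
  have w: "w \<noteq> 0" "1 - w \<noteq> 0" "w \<notin> \<real>\<^sub>\<le>\<^sub>0" "1 - w \<notin> \<real>\<^sub>\<le>\<^sub>0"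
    using assms by (auto simp: complex_nonpos_Reals_iff complex_eq_iff)
  have 1: "((\<lambda>x. Im (dilog x)) has_derivative (\<lambda>h. Im (- Ln (1 - w) / w * h))) (at w)"
    using bounded_linear.has_derivative[OF bounded_linear_Im
      dilog_has_field_derivative[OF w(4,1), unfolded has_field_derivative_def]] .
  have "(Ln has_field_derivative 1 / w) (at w)"
    using w(3) by (auto intro!: derivative_eq_intros simp: divide_inverse)
  then have 2: "((\<lambda>x. Re (Ln x)) has_derivative (\<lambda>h. Re (1 / w * h))) (at w)"
    unfolding has_field_derivative_def by (rule bounded_linear.has_derivative[OF bounded_linear_Re])
  have "((\<lambda>x. Ln (1 - x)) has_field_derivative - 1 / (1 - w)) (at w)"
    using w(4) by (auto intro!: derivative_eq_intros simp: inverse_eq_divide)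
  then have 3: "((\<lambda>x. Im (Ln (1 - x))) has_derivative (\<lambda>h. Im (- 1 / (1 - w) * h))) (at w)"
    unfolding has_field_derivative_def by (rule bounded_linear.has_derivative[OF bounded_linear_Im])
  have "((\<lambda>x. Im (dilog x) + Re (Ln x) * Im (Ln (1 - x))) has_derivative
    (\<lambda>h. Im (- Ln (1 - w) / w * h) + (Re (Ln w) * Im (- 1 / (1 - w) * h) + Re (1 / w * h) * Im (Ln (1 - w))))) (at w)"
    by (intro has_derivative_add has_derivative_mult 1 2 3)
  moreover have "(\<lambda>h. Im (- Ln (1 - w) / w * h) + (Re (Ln w) * Im (- 1 / (1 - w) * h) + Re (1 / w * h) * Im (Ln (1 - w))))
     = (\<lambda>h. - ln (cmod (1 - w)) * Im (h / w) - ln (cmod w) * Im (h / (1 - w)))"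
  proof
    fix h
    have a: "- Ln (1 - w) / w * h = - (Ln (1 - w) * (h / w))" "- 1 / (1 - w) * h = - (h / (1 - w))"
      "1 / w * h = h / w" by simp_all
    have L: "Re (Ln w) = ln (cmod w)" "Re (Ln (1 - w)) = ln (cmod (1 - w))"
      using w by simp_all
    show "Im (- Ln (1 - w) / w * h) + (Re (Ln w) * Im (- 1 / (1 - w) * h) + Re (1 / w * h) * Im (Ln (1 - w)))
      = - ln (cmod (1 - w)) * Im (h / w) - ln (cmod w) * Im (h / (1 - w))"
      unfolding a L[symmetric] by (simp only: uminus_complex.simps times_complex.simps algebra_simps)
  qed
  ultimately have "((\<lambda>x. Im (dilog x) + Re (Ln x) * Im (Ln (1 - x))) has_derivative
    (\<lambda>h. - ln (cmod (1 - w)) * Im (h / w) - ln (cmod w) * Im (h / (1 - w)))) (at w)" by simp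
  then show ?thesis
    by (rule has_derivative_transform_within_open[of _ _ _ _ "- {0, 1}"])
      (use w in \<open>auto simp: bloch_wigner_def Arg_def\<close>)
qed

text \<open>Both sides have the same derivative on the upper half plane, and \<open>w \<mapsto> 1 / (1 - w)\<close> has the fixed point \<open>(1 + \<i> \<surd>3) / 2\<close> there.\<close>

lemma bloch_wigner_cyclic:
  assumes "0 < Im w"
  shows "bloch_wigner (1 / (1 - w)) = bloch_wigner w"
proof -
  define H where "H = {w::complex. 0 < Im w}"
  have im: "0 < Im (1 / (1 - w))" if "0 < Im w" for w
  proof -
    have "0 < (1 - Re w)\<^sup>2 + (Im w)\<^sup>2" using that by (simp add: add_nonneg_pos)
    then show ?thesis using that by (simp add: Im_divide)
  qed
  have d0: "((\<lambda>w. bloch_wigner (1 / (1 - w)) - bloch_wigner w) has_derivative (\<lambda>h. 0)) (at w within H)"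
    if "w \<in> H" for w
  proof (rule has_derivative_at_withinI)
    have w: "0 < Im w" "w \<noteq> 0" "1 - w \<noteq> 0" using that by (auto simp: H_def complex_eq_iff)
    define v where "v = 1 / (1 - w)"
    have "((\<lambda>w. 1 / (1 - w)) has_field_derivative 1 / (1 - w)\<^sup>2) (at w)"
      using w(3) by (auto intro!: derivative_eq_intros simp: power2_eq_square)
    then have "((\<lambda>w. 1 / (1 - w)) has_derivative (\<lambda>h. 1 / (1 - w)\<^sup>2 * h)) (at w)"
      unfolding has_field_derivative_def .
    from has_derivative_compose[OF this bloch_wigner_has_derivative[OF im[OF w(1)]]]
    have 1: "((\<lambda>w. bloch_wigner (1 / (1 - w))) has_derivative
      (\<lambda>h. - ln (cmod (1 - v)) * Im ((1 / (1 - w)\<^sup>2 * h) / v) - ln (cmod v) * Im ((1 / (1 - w)\<^sup>2 * h) / (1 - v)))) (at w)"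
      unfolding v_def .
    have e: "1 - v = - w / (1 - w)" using w by (simp add: v_def field_simps)
    have l: "ln (cmod (1 - v)) = ln (cmod w) - ln (cmod (1 - w))" "ln (cmod v) = - ln (cmod (1 - w))"
      unfolding e using w by (simp_all add: v_def norm_divide ln_div)
    have d1: "(1 / (1 - w)\<^sup>2 * h) / v = h / (1 - w)" for h
      using w by (simp add: v_def power2_eq_square)
    have d2: "(1 / (1 - w)\<^sup>2 * h) / (1 - v) = - (h / w + h / (1 - w))" for h
      unfolding e using w by (simp add: power2_eq_square divide_simps) (simp add: algebra_simps)
    have 2: "((\<lambda>w. bloch_wigner (1 / (1 - w))) has_derivative
      (\<lambda>h. - ln (cmod (1 - w)) * Im (h / w) - ln (cmod w) * Im (h / (1 - w)))) (at w)"
    proof -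
      have "(\<lambda>h. - ln (cmod (1 - v)) * Im ((1 / (1 - w)\<^sup>2 * h) / v) - ln (cmod v) * Im ((1 / (1 - w)\<^sup>2 * h) / (1 - v)))
        = (\<lambda>h. - ln (cmod (1 - w)) * Im (h / w) - ln (cmod w) * Im (h / (1 - w)))"
        unfolding d1 d2 l uminus_complex.simps plus_complex.simps by (rule ext) (simp add: algebra_simps)
      with 1 show ?thesis by (simp only:)
    qed
    show "((\<lambda>w. bloch_wigner (1 / (1 - w)) - bloch_wigner w) has_derivative (\<lambda>h. 0)) (at w)"
      using has_derivative_diff[OF 2 bloch_wigner_has_derivative[OF w(1)]] by simp
  qed
  have "convex H" unfolding H_def by (rule convex_halfspace_Im_gt)
  from has_derivative_zero_constant[OF this d0]
  obtain c where c0: "\<forall>w\<in>H. bloch_wigner (1 / (1 - w)) - bloch_wigner w = c" ..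
  note c = bspec[OF c0]
  define z where "z = Complex (1/2) (sqrt 3 / 2)"
  have "z * (1 - z) = 1" by (simp add: z_def complex_eq_iff)
  then have "1 / (1 - z) = z" by (metis mult_not_zero nonzero_divide_eq_eq zero_neq_one)
  moreover have "z \<in> H" by (simp add: z_def H_def)
  ultimately have "c = 0" using c[of z] by simp
  then show ?thesis using c[of w] assms by (simp add: H_def)
qed

section \<open>The volume as a function of the ordered vertices\<close>

definition ideal_vol :: "complex \<Rightarrow> complex \<Rightarrow> complex \<Rightarrow> real" where
  "ideal_vol a b c = bloch_wigner ((c - a) / (b - a))"

lemma Im_ratio_pos: "0 < orient a b c \<Longrightarrow> 0 < Im ((c - a) / (b - a))"
proof -
  assume o: "0 < orient a b c"
  then have "b - a \<noteq> 0" by auto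
  moreover have "(c - a) / (b - a) = cnj (b - a) * (c - a) / of_real ((cmod (b - a))\<^sup>2)"
    using \<open>b - a \<noteq> 0\<close> by (simp only: complex_norm_square) simp
  then have "Im ((c - a) / (b - a)) = orient a b c / (cmod (b - a))\<^sup>2"
    unfolding orient_def by (simp only: Im_divide_of_real)
  ultimately show ?thesis using o by simp
qed

text \<open>Rotating the vertices turns the shape parameter \<open>w\<close> into
  \<open>1 / (1 - w)\<close>.\<close>

lemma ideal_vol_cyclic:
  assumes "0 < orient a b c"
  shows "ideal_vol b c a = ideal_vol a b c"
proof -
  have "a \<noteq> b" "b \<noteq> c" using orient_distinct[of a b c] assms by auto
  then have "1 / (1 - (c - a) / (b - a)) = (a - b) / (c - b)"
    by (simp add: divide_simps) (simp add: algebra_simps)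
  then show ?thesis
    using bloch_wigner_cyclic[OF Im_ratio_pos[OF assms]] by (simp add: ideal_vol_def)
qed

lemma tri_vol_ccw:
  assumes o: "0 < orient a b c"
  shows "tri_vol {a, b, c} = ideal_vol a b c"
proof -
  define t where "t = (SOME (d, e, f). {a, b, c} = {d, e, f} \<and> ccw d e f)"
  have "case t of (d, e, f) \<Rightarrow> {a, b, c} = {d, e, f} \<and> ccw d e f"
    unfolding t_def by (rule someI[of _ "(a, b, c)"]) (use o in \<open>simp add: ccw_def orient_def\<close>)
  then obtain d e f where t: "t = (d, e, f)" "{a, b, c} = {d, e, f}" "0 < orient d e f"
    by (cases t) (auto simp: ccw_def orient_def)
  consider "a = d" "b = e" "c = f" | "a = e" "b = f" "c = d" | "a = f" "b = d" "c = e"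
    using ccw_rotation[OF t(2) o t(3)] by blast
  then have "ideal_vol d e f = ideal_vol a b c"
    using ideal_vol_cyclic[OF o] ideal_vol_cyclic[OF t(3)] by cases simp_all
  then show ?thesis unfolding tri_vol_def t_def[symmetric] t(1) by (simp add: ideal_vol_def)
qed

text \<open>\<open>X\<close>, \<open>Y\<close>, \<open>Z\<close> are the logarithmic derivatives of
  the sides opposite to \<open>A\<close>, \<open>B\<close>, \<open>C\<close>, so that
  \<open>Im (Y h - Z h)\<close> is the variation of the angle at \<open>A\<close>. The symmetric
  form arises from the derivative in \<open>w\<close> because the three angle variations sum to
  zero.\<close>

lemma ideal_vol_has_derivative:
  fixes A B C :: "'a::real_normed_vector \<Rightarrow> complex"
  assumes o: "0 < orient (A x) (B x) (C x)"
    and d: "(A has_derivative A') (at x)" "(B has_derivative B') (at x)" "(C has_derivative C') (at x)"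
  defines "X \<equiv> \<lambda>h. (C' h - B' h) / (C x - B x)" and "Y \<equiv> \<lambda>h. (A' h - C' h) / (A x - C x)"
    and "Z \<equiv> \<lambda>h. (B' h - A' h) / (B x - A x)"
  shows "((\<lambda>y. ideal_vol (A y) (B y) (C y)) has_derivative
    (\<lambda>h. - (ln (cmod (C x - B x)) * Im (Y h - Z h) + ln (cmod (A x - C x)) * Im (Z h - X h)
      + ln (cmod (B x - A x)) * Im (X h - Y h)))) (at x)"
proof -
  define w where "w = (C x - A x) / (B x - A x)"
  have n: "A x \<noteq> B x" "B x \<noteq> C x" "A x \<noteq> C x" using o orient_distinct[of "A x" "B x" "C x"] by auto
  have w: "0 < Im w" unfolding w_def by (rule Im_ratio_pos[OF o])
  then have w0: "w \<noteq> 0" "1 - w \<noteq> 0" by (auto simp: complex_eq_iff)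
  have ba: "B x - A x \<noteq> 0" "C x - A x \<noteq> 0" "C x - B x \<noteq> 0" "A x - C x \<noteq> 0" using n by auto
  have 1: "((\<lambda>y. (C y - A y) / (B y - A y)) has_derivative (\<lambda>h. w * (Y h - Z h))) (at x)"
  proof -
    have "((\<lambda>y. (C y - A y) / (B y - A y)) has_derivative
       (\<lambda>h. ((C' h - A' h) * (B x - A x) - (C x - A x) * (B' h - A' h)) / ((B x - A x) * (B x - A x)))) (at x)"
      using ba by (intro has_derivative_divide' has_derivative_diff d)
    moreover have "((C' h - A' h) * (B x - A x) - (C x - A x) * (B' h - A' h)) / ((B x - A x) * (B x - A x))
       = w * (Y h - Z h)" for h
    proof -
      have Y: "Y h = (C' h - A' h) / (C x - A x)"
        unfolding Y_def using ba by (metis minus_diff_eq minus_divide_divide)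
      show ?thesis unfolding Y Z_def w_def using ba by (simp add: divide_simps)
    qed
    ultimately show ?thesis by simp
  qed
  have w1: "1 - w = (B x - C x) / (B x - A x)" using ba by (simp add: w_def divide_simps)
  have e1: "w * (Y h - Z h) / w = Y h - Z h" for h using w0 by simp
  have e2: "w * (Y h - Z h) / (1 - w) = Z h - X h" for h
  proof -
    have Y: "Y h = (C' h - A' h) / (C x - A x)"
      unfolding Y_def using ba by (metis minus_diff_eq minus_divide_divide)
    have "w * (Y h - Z h) = ((C' h - A' h) - w * (B' h - A' h)) / (B x - A x)"
      unfolding Y Z_def w_def using ba by (simp add: divide_simps)
    also have "\<dots> = (1 - w) * (Z h - X h)"
    proof -
      have "(1 - w) * (Z h - X h) = (1 - w) * Z h + ((C' h - B' h) / (B x - A x))"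
        unfolding X_def w1 using ba by (simp add: divide_simps) (simp add: algebra_simps)
      also have "\<dots> = ((C' h - A' h) - w * (B' h - A' h)) / (B x - A x)"
        unfolding Z_def using ba by (simp add: divide_simps) (simp add: algebra_simps)
      finally show ?thesis by simp
    qed
    finally show ?thesis using w0 by simp
  qed
  have l1: "ln (cmod (1 - w)) = ln (cmod (C x - B x)) - ln (cmod (B x - A x))"
    unfolding w1 using ba n by (simp add: norm_divide ln_div norm_minus_commute)
  have l2: "ln (cmod w) = ln (cmod (A x - C x)) - ln (cmod (B x - A x))"
    unfolding w_def using ba n by (simp add: norm_divide ln_div norm_minus_commute)
  have "((\<lambda>y. bloch_wigner ((C y - A y) / (B y - A y))) has_derivative
    (\<lambda>h. - ln (cmod (1 - w)) * Im (w * (Y h - Z h) / w) - ln (cmod w) * Im (w * (Y h - Z h) / (1 - w)))) (at x)"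
    using has_derivative_compose[OF 1 bloch_wigner_has_derivative[OF w[unfolded w_def]]] unfolding w_def .
  then show ?thesis
    unfolding e1 e2 l1 l2 ideal_vol_def by (simp add: algebra_simps)
qed

section \<open>Stability of the Delaunay triangles\<close>

text \<open>Every Delaunay triangle occurs three times, once for each counterclockwise ordering of its vertices; this is the origin of the factors \<open>1/3\<close> below.\<close>

definition delaunay_triples :: "('i \<Rightarrow> complex) \<Rightarrow> ('i \<times> 'i \<times> 'i) set" where
  "delaunay_triples x = {(i, j, k). 0 < orient (x i) (x j) (x k) \<and>
     (\<forall>l. 0 \<le> incirc sqn (x i) (x j) (x k) (x l))}"

lemma delaunay_triples_iff:
  "(i, j, k) \<in> delaunay_triples x \<longleftrightarrow> 0 < orient (x i) (x j) (x k) \<and>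
     (\<forall>l. 0 \<le> incirc sqn (x i) (x j) (x k) (x l))"
  by (simp add: delaunay_triples_def)

lemma delaunay_triples_cyclic:
  "(j, k, i) \<in> delaunay_triples x \<longleftrightarrow> (i, j, k) \<in> delaunay_triples x"
  using orient_cyclic[of "x j" "x k" "x i"] incirc_cyclic[of sqn "x j" "x k" "x i"]
  by (simp add: delaunay_triples_iff)

lemma sum_tri_vol:
  fixes x :: "'i::finite \<Rightarrow> complex"
  assumes "inj x"
  shows "(\<Sum>F\<in>lower_triangles sqn (range x). tri_vol F)
    = (\<Sum>(i, j, k)\<in>delaunay_triples x. ideal_vol (x i) (x j) (x k)) / 3"
proof -
  define vs where "vs = (\<lambda>(i, j, k). {x i, x j, x k})"
  have img: "vs ` delaunay_triples x = lower_triangles sqn (range x)"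
  proof
    show "vs ` delaunay_triples x \<subseteq> lower_triangles sqn (range x)"
      by (auto simp: vs_def delaunay_triples_iff intro!: lower_trianglesI)
    show "lower_triangles sqn (range x) \<subseteq> vs ` delaunay_triples x"
    proof
      fix F assume "F \<in> lower_triangles sqn (range x)"
      then obtain a b c where F: "F = {a, b, c}" "a \<in> range x" "b \<in> range x" "c \<in> range x"
        "0 < orient a b c" "\<forall>p\<in>range x. 0 \<le> incirc sqn a b c p"
        by (rule lower_triangles_cases) (rule that)
      then obtain i j k where "a = x i" "b = x j" "c = x k" by blast
      then show "F \<in> vs ` delaunay_triples x"
        using F by (intro image_eqI[of _ _ "(i, j, k)"]) (auto simp: vs_def delaunay_triples_iff)
    qed
  qed
  have fiber: "(\<Sum>t\<in>{t \<in> delaunay_triples x. vs t = F}. tri_vol F) = 3 * tri_vol F"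
    if F: "F \<in> vs ` delaunay_triples x" for F
  proof -
    obtain i j k where t: "(i, j, k) \<in> delaunay_triples x" "F = {x i, x j, x k}"
      using F by (auto simp: vs_def)
    have o: "0 < orient (x i) (x j) (x k)" using t(1) by (simp add: delaunay_triples_iff)
    have "{t \<in> delaunay_triples x. vs t = F} = {(i, j, k), (j, k, i), (k, i, j)}"
    proof
      show "{(i, j, k), (j, k, i), (k, i, j)} \<subseteq> {t \<in> delaunay_triples x. vs t = F}"
        using t delaunay_triples_cyclic[of j k i x] delaunay_triples_cyclic[of k i j x]
        by (auto simp: vs_def)
      show "{t \<in> delaunay_triples x. vs t = F} \<subseteq> {(i, j, k), (j, k, i), (k, i, j)}"
      proof
        fix s assume s: "s \<in> {t \<in> delaunay_triples x. vs t = F}"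
        obtain p q r where pqr: "s = (p, q, r)" by (cases s)
        have "{x p, x q, x r} = {x i, x j, x k}" "0 < orient (x p) (x q) (x r)"
          using s t(2) by (auto simp: pqr vs_def delaunay_triples_iff)
        from ccw_rotation[OF this o] show "s \<in> {(i, j, k), (j, k, i), (k, i, j)}"
          using assms unfolding pqr by (auto simp: inj_eq)
      qed
    qed
    moreover have "i \<noteq> j" "j \<noteq> k" "i \<noteq> k" using orient_distinct[of "x i" "x j" "x k"] o by auto
    ultimately show ?thesis by simp
  qed
  have "(\<Sum>(i, j, k)\<in>delaunay_triples x. ideal_vol (x i) (x j) (x k)) = (\<Sum>t\<in>delaunay_triples x. tri_vol (vs t))"
    by (rule sum.cong[OF refl]) (auto simp: vs_def delaunay_triples_iff tri_vol_ccw)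
  also have "\<dots> = (\<Sum>F\<in>vs ` delaunay_triples x. \<Sum>t\<in>{t \<in> delaunay_triples x. vs t = F}. tri_vol (vs t))"
    by (rule sum.image_gen) simp
  also have "\<dots> = (\<Sum>F\<in>vs ` delaunay_triples x. 3 * tri_vol F)"
  proof (rule sum.cong[OF refl])
    fix F assume F: "F \<in> vs ` delaunay_triples x"
    have "(\<Sum>t\<in>{t \<in> delaunay_triples x. vs t = F}. tri_vol (vs t)) = (\<Sum>t\<in>{t \<in> delaunay_triples x. vs t = F}. tri_vol F)"
      by (rule sum.cong) auto
    then show "(\<Sum>t\<in>{t \<in> delaunay_triples x. vs t = F}. tri_vol (vs t)) = 3 * tri_vol F"
      using fiber[OF F] by simp
  qed
  finally show ?thesis unfolding img by (simp add: sum_distrib_left[symmetric])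
qed

text \<open>\<open>side u v p - s * orient u v p\<close> is the power of \<open>p\<close> with respect to the circle through \<open>u\<close> and \<open>v\<close> with centre \<open>(u + v)/2 + \<i> s (v - u)/2\<close>.\<close>

definition side :: "complex \<Rightarrow> complex \<Rightarrow> complex \<Rightarrow> real" where
  "side u v p = Re ((p - u) * cnj (p - v))"

lemma side_orient: "(p - u) * cnj (p - v) = Complex (side u v p) (- orient u v p)"
  by (simp add: complex_eq_iff side_def orient_eq algebra_simps)

text \<open>In the pencil of circles through \<open>u\<close> and \<open>v\<close>, the one through
  \<open>p\<close> has parameter \<open>side u v p / orient u v p\<close>. Clearing this denominator
  yields a formula that also covers collinear \<open>u\<close>, \<open>v\<close>,
  \<open>p\<close>.\<close>

lemma incirc_side:
  "incirc sqn u v p q = orient u v p * side u v q - side u v p * orient u v q"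
proof -
  have s: "side u v p = sqn p - Re p * (Re u + Re v) - Im p * (Im u + Im v) + (Re u * Re v + Im u * Im v)" for p
    by (simp add: side_def power2_eq_square algebra_simps)
  have c: "orient q v p * Re u + orient u q p * Re v + orient u v q * Re p = orient u v p * Re q"
    "orient q v p * Im u + orient u q p * Im v + orient u v q * Im p = orient u v p * Im q"
    by (simp_all add: orient_eq algebra_simps)
  have e: "orient q v p + orient u q p = orient u v p - orient u v q" using orient_sum[of q v p u] by linarith
  define m1 m2 where "m1 = Re u + Re v" and "m2 = Im u + Im v"
  have u: "sqn u = Re u * m1 + Im u * m2 - (Re u * Re v + Im u * Im v)"
    and v: "sqn v = Re v * m1 + Im v * m2 - (Re u * Re v + Im u * Im v)"
    by (simp_all add: m1_def m2_def power2_eq_square algebra_simps)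
  have "incirc sqn u v p q = sqn q * orient u v p - sqn p * orient u v q
     - ((orient q v p * Re u + orient u q p * Re v + orient u v q * Re p) * m1
       + (orient q v p * Im u + orient u q p * Im v + orient u v q * Im p) * m2)
     + orient u v q * (Re p * m1 + Im p * m2) + (orient q v p + orient u q p) * (Re u * Re v + Im u * Im v)"
    unfolding incirc_def u v by (simp only: algebra_simps)
  also have "\<dots> = orient u v p * side u v q - side u v p * orient u v q"
    unfolding c e s m1_def[symmetric] m2_def[symmetric] by (simp only: algebra_simps)
  finally show ?thesis .
qed

lemma side_nonzero:
  assumes "orient u v p = 0" "p \<noteq> u" "p \<noteq> v"
  shows "side u v p \<noteq> 0"
proof
  assume "side u v p = 0"
  then have "(p - u) * cnj (p - v) = 0" unfolding side_orient assms(1) by (simp add: complex_eq_iff)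
  then show False using assms(2,3) by simp
qed

definition two_sided :: "('i \<Rightarrow> complex) \<Rightarrow> 'i \<Rightarrow> bool" where
  "two_sided x u \<longleftrightarrow> (\<forall>v. v \<noteq> u \<longrightarrow>
     (\<exists>p. 0 < orient (x u) (x v) (x p)) \<and> (\<exists>p. orient (x u) (x v) (x p) < 0))"

text \<open>For a collinear triple, \<open>incirc_side\<close> reduces the determinant to
  \<open>- side * orient\<close> with \<open>side\<close> nonzero, so it is negative on one side of
  the line, and that side contains a point.\<close>

lemma two_sided_collinear:
  assumes "inj x" "two_sided x u" "u \<noteq> v" "p \<noteq> u" "p \<noteq> v" "orient (x u) (x v) (x p) = 0"
  shows "\<exists>l. incirc sqn (x u) (x v) (x p) (x l) < 0"
proof -
  have "side (x u) (x v) (x p) \<noteq> 0"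
    using assms by (intro side_nonzero) (auto simp: inj_eq)
  moreover obtain l m where "0 < orient (x u) (x v) (x l)" "orient (x u) (x v) (x m) < 0"
    using assms(2,3) unfolding two_sided_def by metis
  ultimately have "side (x u) (x v) (x p) * orient (x u) (x v) (x l) > 0
      \<or> side (x u) (x v) (x p) * orient (x u) (x v) (x m) > 0"
    by (cases "0 < side (x u) (x v) (x p)") (auto intro: mult_neg_neg)
  then show ?thesis unfolding incirc_side assms(6) by auto
qed

lemma tendsto_orient [tendsto_intros]:
  assumes "(f \<longlongrightarrow> a) F" "(g \<longlongrightarrow> b) F" "(h \<longlongrightarrow> c) F"
  shows "((\<lambda>z. orient (f z) (g z) (h z)) \<longlongrightarrow> orient a b c) F"
  unfolding orient_def by (intro tendsto_intros assms)

lemma tendsto_side [tendsto_intros]: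
  assumes "(f \<longlongrightarrow> a) F" "(g \<longlongrightarrow> b) F" "(h \<longlongrightarrow> c) F"
  shows "((\<lambda>z. side (f z) (g z) (h z)) \<longlongrightarrow> side a b c) F"
  unfolding side_def by (intro tendsto_intros assms)

lemma tendsto_incirc [tendsto_intros]:
  assumes "(f \<longlongrightarrow> a) F" "(g \<longlongrightarrow> b) F" "(h \<longlongrightarrow> c) F" "(k \<longlongrightarrow> p) F"
  shows "((\<lambda>z. incirc sqn (f z) (g z) (h z) (k z)) \<longlongrightarrow> incirc sqn a b c p) F"
  unfolding incirc_def by (intro tendsto_intros assms)

text \<open>Both belonging and not belonging to the Delaunay triples are witnessed by strict
  inequalities: generic heights give them for members, \<open>col\<close> for collinear triples.
  Finitely many strict inequalities persist along \<open>F\<close>; triples with a repeated index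
  have orientation zero throughout.\<close>

lemma delaunay_triples_stable:
  fixes X :: "'a \<Rightarrow> 'i::finite \<Rightarrow> complex"
  assumes lim: "\<And>i. ((\<lambda>z. X z i) \<longlongrightarrow> x i) F"
    and "inj x" and gen: "generic_heights sqn (range x)"
    and col: "\<And>i j k. \<lbrakk>i \<noteq> j; j \<noteq> k; i \<noteq> k; orient (x i) (x j) (x k) = 0\<rbrakk>
        \<Longrightarrow> \<exists>l. incirc sqn (x i) (x j) (x k) (x l) < 0"
  shows "\<forall>\<^sub>F z in F. delaunay_triples (X z) = delaunay_triples x \<and> generic_heights sqn (range (X z))"
proof -
  note lim_o = tendsto_orient[OF lim lim lim] and lim_i = tendsto_incirc[OF lim lim lim lim]
  have 1: "\<forall>\<^sub>F z in F. 0 < orient (X z i) (X z j) (X z k) \<and>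
      (\<forall>l. l \<notin> {i, j, k} \<longrightarrow> 0 < incirc sqn (X z i) (X z j) (X z k) (X z l))"
    if t: "(i, j, k) \<in> delaunay_triples x" for i j k
  proof (intro eventually_conj eventually_all_finite)
    show "\<forall>\<^sub>F z in F. 0 < orient (X z i) (X z j) (X z k)"
      using t order_tendstoD(1)[OF lim_o] by (simp add: delaunay_triples_iff)
    fix l
    show "\<forall>\<^sub>F z in F. l \<notin> {i, j, k} \<longrightarrow> 0 < incirc sqn (X z i) (X z j) (X z k) (X z l)"
    proof (rule eventually_const_imp)
      assume "l \<notin> {i, j, k}"
      then have "x l \<in> range x - {x i, x j, x k}" using assms(2) by (auto simp: inj_eq)
      then have "0 < incirc sqn (x i) (x j) (x k) (x l)"
        using gen t unfolding generic_heights_def delaunay_triples_iff by blast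
      then show "\<forall>\<^sub>F z in F. 0 < incirc sqn (X z i) (X z j) (X z k) (X z l)"
        by (rule order_tendstoD(1)[OF lim_i])
    qed
  qed
  have 2: "\<forall>\<^sub>F z in F. (i, j, k) \<notin> delaunay_triples (X z)" if t: "(i, j, k) \<notin> delaunay_triples x" for i j k
  proof (cases "i \<noteq> j \<and> j \<noteq> k \<and> i \<noteq> k")
    case False
    then show ?thesis by (auto simp: delaunay_triples_iff)
  next
    case True
    then consider "orient (x i) (x j) (x k) < 0" | l where "incirc sqn (x i) (x j) (x k) (x l) < 0"
      using t col[of i j k] unfolding delaunay_triples_iff by (metis not_le linorder_neqE)
    then show ?thesis
    proof cases
      case 1
      from order_tendstoD(2)[OF lim_o this] show ?thesis
        by eventually_elim (simp add: delaunay_triples_iff)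
    next
      case 2
      from order_tendstoD(2)[OF lim_i this] show ?thesis
        by eventually_elim (auto simp: delaunay_triples_iff not_le)
    qed
  qed
  have "\<forall>\<^sub>F z in F. \<forall>i j k.
      ((i, j, k) \<in> delaunay_triples x \<longrightarrow> 0 < orient (X z i) (X z j) (X z k) \<and>
        (\<forall>l. l \<notin> {i, j, k} \<longrightarrow> 0 < incirc sqn (X z i) (X z j) (X z k) (X z l))) \<and>
      ((i, j, k) \<notin> delaunay_triples x \<longrightarrow> (i, j, k) \<notin> delaunay_triples (X z))"
    by (intro eventually_all_finite eventually_conj eventually_const_imp 1 2)
  then show ?thesis
  proof eventually_elim
    case (elim z)
    have a: "0 < orient (X z i) (X z j) (X z k)"
      "l \<notin> {i, j, k} \<Longrightarrow> 0 < incirc sqn (X z i) (X z j) (X z k) (X z l)"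
      if "(i, j, k) \<in> delaunay_triples x" for i j k l
      using elim that by simp_all
    have b: "(i, j, k) \<in> delaunay_triples x" if "(i, j, k) \<in> delaunay_triples (X z)" for i j k
      using elim that by metis
    have c: "(i, j, k) \<in> delaunay_triples (X z)" if "(i, j, k) \<in> delaunay_triples x" for i j k
    proof -
      have "0 \<le> incirc sqn (X z i) (X z j) (X z k) (X z l)" for l
        using a(2)[OF that, of l] by (cases "l \<in> {i, j, k}") auto
      then show ?thesis using a(1)[OF that] by (simp add: delaunay_triples_iff)
    qed
    have "delaunay_triples (X z) = delaunay_triples x" using b c by auto
    moreover have "generic_heights sqn (range (X z))"
      unfolding generic_heights_def
    proof (intro ballI impI)
      fix p q r s
      assume "p \<in> range (X z)" "q \<in> range (X z)" "r \<in> range (X z)"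
        and o: "0 < orient p q r" and i: "\<forall>s\<in>range (X z). 0 \<le> incirc sqn p q r s"
        and s: "s \<in> range (X z) - {p, q, r}"
      then obtain i j k l where e: "p = X z i" "q = X z j" "r = X z k" "s = X z l" by blast
      then have "(i, j, k) \<in> delaunay_triples (X z)" using o i by (simp add: delaunay_triples_iff)
      moreover have "l \<notin> {i, j, k}" using s e by auto
      ultimately show "0 < incirc sqn p q r s" unfolding e by (intro a(2) b)
    qed
    ultimately show ?case by simp
  qed
qed

section \<open>The Levi form and the Voronoi edges\<close>

text \<open>The parameters of those centres whose circle through \<open>x u\<close> and
  \<open>x v\<close> has no point \<open>x p\<close> strictly inside.\<close>

definition voronoi_edge :: "('i \<Rightarrow> complex) \<Rightarrow> 'i \<Rightarrow> 'i \<Rightarrow> real set" where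
  "voronoi_edge x u v = {s. \<forall>p. s * orient (x u) (x v) (x p) \<le> side (x u) (x v) (x p)}"

definition edge_weight :: "('i \<Rightarrow> complex) \<Rightarrow> 'i \<Rightarrow> 'i \<Rightarrow> complex" where
  "edge_weight x u v = complex_of_real (1 / (2 * (cmod (x u - x v))\<^sup>2)) *
     (\<integral>s. indicator (voronoi_edge x u v) s *\<^sub>R (1 / (complex_of_real s - \<i>)\<^sup>2) \<partial>lborel)"

text \<open>This function is the modulus of the kernel, hence a majorant that does not depend on the
  configuration.\<close>

lemma integrable_inverse_1_plus_square: "integrable lborel (\<lambda>s::real. inverse (1 + s\<^sup>2))"
proof -
  have "set_integrable lborel (einterval (-\<infinity>) \<infinity>) (\<lambda>s::real. inverse (1 + s\<^sup>2))"
  proof (rule interval_integral_FTC_nonneg(1)[of _ _ arctan])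
    show "isCont (\<lambda>s. inverse (1 + s\<^sup>2)) x" for x :: real
      by (intro continuous_intros) (simp add: add_nonneg_eq_0_iff)
    show "((arctan \<circ> real_of_ereal) \<longlongrightarrow> - (pi / 2)) (at_right (- \<infinity>))"
      "((arctan \<circ> real_of_ereal) \<longlongrightarrow> pi / 2) (at_left \<infinity>)"
      unfolding ereal_tendsto_simps by (rule tendsto_arctan_at_bot tendsto_arctan_at_top)+
  qed (auto intro: DERIV_arctan)
  moreover have "einterval (-\<infinity>) \<infinity> = UNIV" by (auto simp: einterval_def)
  ultimately show ?thesis by (simp add: set_integrable_def)
qed

lemma of_real_minus_i_nonzero: "complex_of_real s - \<i> \<noteq> 0"
  by (simp add: complex_eq_iff)

lemma of_real_neq_i: "complex_of_real s \<noteq> \<i>"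
  by (simp add: complex_eq_iff)

lemma norm_kernel: "norm (1 / (complex_of_real s - \<i>)\<^sup>2) = inverse (1 + s\<^sup>2)"
  by (simp add: norm_divide norm_power cmod_power2 inverse_eq_divide add.commute)

lemma closed_voronoi_edge: "closed (voronoi_edge x u v)"
  unfolding voronoi_edge_def by (intro closed_Collect_all closed_Collect_le continuous_intros)

lemma edge_kernel_measurable:
  "(\<lambda>s. indicator (voronoi_edge x u v) s *\<^sub>R (1 / (complex_of_real s - \<i>)\<^sup>2)) \<in> borel_measurable lborel"
proof -
  have "(\<lambda>s. 1 / (complex_of_real s - \<i>)\<^sup>2) \<in> borel_measurable borel"
    by (intro borel_measurable_continuous_onI continuous_intros) (simp add: of_real_neq_i)
  moreover have "voronoi_edge x u v \<in> sets borel" using closed_voronoi_edge by (rule borel_closed)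
  ultimately show ?thesis by simp
qed

text \<open>The indicator converges at each \<open>s\<close> where no defining inequality is an
  equality. The exceptional set \<open>N\<close> is finite: for \<open>p\<close> outside
  \<open>{u, v}\<close> the equation is linear in \<open>s\<close>, with nonzero slope, or with
  slope zero and a nonzero constant.\<close>

lemma edge_weight_tendsto:
  fixes X :: "nat \<Rightarrow> 'i::finite \<Rightarrow> complex"
  assumes lim: "\<And>i. (\<lambda>n. X n i) \<longlonglongrightarrow> x i" and "inj x" "u \<noteq> v"
  shows "(\<lambda>n. edge_weight (X n) u v) \<longlonglongrightarrow> edge_weight x u v"
proof -
  define N where "N = (\<Union>p\<in>- {u, v}. {s. s * orient (x u) (x v) (x p) = side (x u) (x v) (x p)})"
  have "finite {s. s * orient (x u) (x v) (x p) = side (x u) (x v) (x p)}" if "p \<in> - {u, v}" for p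
  proof (cases "orient (x u) (x v) (x p) = 0")
    case True
    then have "side (x u) (x v) (x p) \<noteq> 0"
      using that assms(2) by (intro side_nonzero) (auto simp: inj_eq)
    then show ?thesis using True by simp
  next
    case False
    then have "{s. s * orient (x u) (x v) (x p) = side (x u) (x v) (x p)}
        \<subseteq> {side (x u) (x v) (x p) / orient (x u) (x v) (x p)}"
      by (auto simp: field_simps)
    then show ?thesis by (rule finite_subset) simp
  qed
  then have "finite N" unfolding N_def by (intro finite_UN_I) auto
  then have "N \<in> null_sets lborel" by (rule finite_imp_null_set_lborel)
  then have AE_N: "AE s in lborel. s \<notin> N" by (rule AE_not_in)
  have "(\<lambda>n. \<integral>s. indicator (voronoi_edge (X n) u v) s *\<^sub>R (1 / (complex_of_real s - \<i>)\<^sup>2) \<partial>lborel)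
    \<longlonglongrightarrow> (\<integral>s. indicator (voronoi_edge x u v) s *\<^sub>R (1 / (complex_of_real s - \<i>)\<^sup>2) \<partial>lborel)"
  proof (rule integral_dominated_convergence[OF edge_kernel_measurable edge_kernel_measurable
        integrable_inverse_1_plus_square])
    show "AE s in lborel. norm (indicator (voronoi_edge (X n) u v) s *\<^sub>R (1 / (complex_of_real s - \<i>)\<^sup>2))
        \<le> inverse (1 + s\<^sup>2)" for n
      by (intro AE_I2) (simp only: norm_scaleR norm_kernel, simp add: indicator_def)
    show "AE s in lborel. (\<lambda>n. indicator (voronoi_edge (X n) u v) s *\<^sub>R (1 / (complex_of_real s - \<i>)\<^sup>2))
        \<longlonglongrightarrow> indicator (voronoi_edge x u v) s *\<^sub>R (1 / (complex_of_real s - \<i>)\<^sup>2)"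
      using AE_N
    proof eventually_elim
      case (elim s)
      note lim_o = tendsto_mult[OF tendsto_const tendsto_orient[OF lim lim lim], of s]
        and lim_s = tendsto_side[OF lim lim lim]
      have "\<forall>\<^sub>F n in sequentially. (s * orient (X n u) (X n v) (X n p) \<le> side (X n u) (X n v) (X n p))
          \<longleftrightarrow> (s * orient (x u) (x v) (x p) \<le> side (x u) (x v) (x p))" for p
      proof (cases "p \<in> {u, v}")
        case True
        then show ?thesis by (auto simp: side_def)
      next
        case False
        then have "s * orient (x u) (x v) (x p) \<noteq> side (x u) (x v) (x p)"
          using elim by (auto simp: N_def)
        then consider "s * orient (x u) (x v) (x p) < side (x u) (x v) (x p)"
          | "side (x u) (x v) (x p) < s * orient (x u) (x v) (x p)" by linarith
        then show ?thesis
        proof cases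
          case 1
          from tendsto_diff[OF lim_s lim_o, THEN order_tendstoD(1), of 0] 1
          have "\<forall>\<^sub>F n in sequentially. 0 < side (X n u) (X n v) (X n p) - s * orient (X n u) (X n v) (X n p)"
            by simp
          then show ?thesis by eventually_elim (use 1 in simp)
        next
          case 2
          from tendsto_diff[OF lim_o lim_s, THEN order_tendstoD(1), of 0] 2
          have "\<forall>\<^sub>F n in sequentially. 0 < s * orient (X n u) (X n v) (X n p) - side (X n u) (X n v) (X n p)"
            by simp
          then show ?thesis by eventually_elim (use 2 in simp)
        qed
      qed
      then have "\<forall>\<^sub>F n in sequentially. \<forall>p. (s * orient (X n u) (X n v) (X n p) \<le> side (X n u) (X n v) (X n p))
          \<longleftrightarrow> (s * orient (x u) (x v) (x p) \<le> side (x u) (x v) (x p))"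
        by (rule eventually_all_finite)
      then have "\<forall>\<^sub>F n in sequentially. s \<in> voronoi_edge (X n) u v \<longleftrightarrow> s \<in> voronoi_edge x u v"
        by eventually_elim (simp add: voronoi_edge_def)
      then have "\<forall>\<^sub>F n in sequentially. indicator (voronoi_edge (X n) u v) s *\<^sub>R (1 / (complex_of_real s - \<i>)\<^sup>2)
          = indicator (voronoi_edge x u v) s *\<^sub>R (1 / (complex_of_real s - \<i>)\<^sup>2)"
        by eventually_elim (simp add: indicator_def)
      then show ?case by (rule tendsto_eventually)
    qed
  qed
  moreover have "(\<lambda>n. complex_of_real (1 / (2 * (cmod (X n u - X n v))\<^sup>2)))
      \<longlonglongrightarrow> complex_of_real (1 / (2 * (cmod (x u - x v))\<^sup>2))"
    using assms(2,3) by (intro tendsto_intros lim) (auto simp: inj_eq)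
  ultimately show ?thesis unfolding edge_weight_def by (intro tendsto_mult)
qed

lemma integral_kernel_Icc:
  assumes "a \<le> b"
  shows "(\<integral>s. indicator {a..b} s *\<^sub>R (1 / (complex_of_real s - \<i>)\<^sup>2) \<partial>lborel)
    = 1 / (complex_of_real a - \<i>) - 1 / (complex_of_real b - \<i>)"
proof -
  have "(\<integral>s. indicator {a..b} s *\<^sub>R (1 / (complex_of_real s - \<i>)\<^sup>2) \<partial>lborel)
    = (- (1 / (complex_of_real b - \<i>))) - (- (1 / (complex_of_real a - \<i>)))"
  proof (rule integral_FTC_atLeastAtMost[OF assms])
    fix s :: real
    have "((\<lambda>z. - (1 / (z - \<i>))) has_field_derivative 1 / (complex_of_real s - \<i>)\<^sup>2) (at (complex_of_real s))"
      using of_real_minus_i_nonzero[of s]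
      by (auto intro!: derivative_eq_intros simp: power2_eq_square)
    then show "((\<lambda>s. - (1 / (complex_of_real s - \<i>))) has_vector_derivative 1 / (complex_of_real s - \<i>)\<^sup>2) (at s within {a..b})"
      by (rule has_vector_derivative_real_field)
  next
    show "continuous_on {a..b} (\<lambda>s. 1 / (complex_of_real s - \<i>)\<^sup>2)"
      by (intro continuous_intros) (simp add: of_real_neq_i)
  qed
  then show ?thesis by simp
qed

text \<open>Position of the circumcentre on the bisector. By the inscribed angle theorem it is the
  cotangent of the oriented angle at \<open>x p\<close>.\<close>

definition center_param :: "('i \<Rightarrow> complex) \<Rightarrow> 'i \<Rightarrow> 'i \<Rightarrow> 'i \<Rightarrow> real" where
  "center_param x u v p = side (x u) (x v) (x p) / orient (x u) (x v) (x p)"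

lemma delaunay_left_iff:
  "(u, v, p) \<in> delaunay_triples x \<longleftrightarrow>
     0 < orient (x u) (x v) (x p) \<and> center_param x u v p \<in> voronoi_edge x u v"
  unfolding delaunay_triples_iff voronoi_edge_def center_param_def incirc_side mem_Collect_eq
  by (intro conj_cong refl iff_allI) (simp add: field_simps)

lemma delaunay_right_iff:
  "(v, u, p) \<in> delaunay_triples x \<longleftrightarrow>
     orient (x u) (x v) (x p) < 0 \<and> center_param x u v p \<in> voronoi_edge x u v"
proof -
  have o: "orient (x v) (x u) (x p) = - orient (x u) (x v) (x p)" by (rule orient_swap)
  have i: "incirc sqn (x v) (x u) (x p) q = - incirc sqn (x u) (x v) (x p) q" for q by (rule incirc_swap)
  show ?thesis
    unfolding delaunay_triples_iff o i neg_0_less_iff_less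
    unfolding voronoi_edge_def center_param_def incirc_side mem_Collect_eq
    by (intro conj_cong refl iff_allI) (simp add: field_simps)
qed

text \<open>Points to the left of the line from \<open>x u\<close> to \<open>x v\<close> bound
  \<open>s\<close> from above, those to the right from below. A nonempty edge is thus an interval
  ending at circumcentre parameters, and genericity allows one triangle at each end.\<close>

lemma voronoi_edge_integral:
  fixes x :: "'i::finite \<Rightarrow> complex"
  assumes "inj x" "generic_heights sqn (range x)" "two_sided x u" "u \<noteq> v"
  shows "(\<integral>s. indicator (voronoi_edge x u v) s *\<^sub>R (1 / (complex_of_real s - \<i>)\<^sup>2) \<partial>lborel)
    = (\<Sum>p | (v, u, p) \<in> delaunay_triples x. 1 / (complex_of_real (center_param x u v p) - \<i>))
    - (\<Sum>p | (u, v, p) \<in> delaunay_triples x. 1 / (complex_of_real (center_param x u v p) - \<i>))"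
proof (cases "voronoi_edge x u v = {}")
  case True
  then show ?thesis unfolding delaunay_left_iff[of u v] delaunay_right_iff[of v u] by simp
next
  case False
  then obtain s0 where s0: "s0 \<in> voronoi_edge x u v" by blast
  define W where "W p = orient (x u) (x v) (x p)" for p
  define B where "B p = side (x u) (x v) (x p)" for p
  define c where "c p = center_param x u v p" for p
  have c: "c p * W p = B p" if "W p \<noteq> 0" for p using that by (simp add: c_def center_param_def W_def B_def)
  have V: "s \<in> voronoi_edge x u v \<longleftrightarrow> (\<forall>p. (0 < W p \<longrightarrow> s \<le> c p) \<and> (W p < 0 \<longrightarrow> c p \<le> s))" for s
  proof -
    have "s * W p \<le> B p \<longleftrightarrow> (0 < W p \<longrightarrow> s \<le> c p) \<and> (W p < 0 \<longrightarrow> c p \<le> s)" for p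
    proof (cases "W p = 0")
      case True
      have "s0 * W p \<le> B p" using s0 by (simp add: voronoi_edge_def W_def B_def)
      then show ?thesis using True by simp
    next
      case False
      then show ?thesis unfolding c[OF False, symmetric] by (auto simp: mult_le_cancel_right)
    qed
    then show ?thesis by (simp add: voronoi_edge_def W_def B_def)
  qed
  define L R where "L = {p. 0 < W p}" and "R = {p. W p < 0}"
  have LR: "finite L" "finite R" "L \<noteq> {}" "R \<noteq> {}"
    using assms(3,4) unfolding two_sided_def L_def R_def W_def by auto
  obtain l where l: "l \<in> L" "\<And>p. p \<in> L \<Longrightarrow> c l \<le> c p"
    using ex_is_arg_min_if_finite[OF LR(1,3), of c] unfolding is_arg_min_linorder by blast
  obtain r where r: "r \<in> R" "\<And>p. p \<in> R \<Longrightarrow> c p \<le> c r"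
    using ex_is_arg_min_if_finite[OF LR(2,4), of "\<lambda>p. - c p"] unfolding is_arg_min_linorder by auto
  have Icc: "voronoi_edge x u v = {c r..c l}"
  proof
    show "voronoi_edge x u v \<subseteq> {c r..c l}" using V l(1) r(1) by (auto simp: L_def R_def)
    show "{c r..c l} \<subseteq> voronoi_edge x u v"
      using V l(2) r(2) by (auto simp: L_def R_def) (meson order_trans)+
  qed
  with s0 have le: "c r \<le> c l" by auto
  \<comment> \<open>Equal parameters put \<open>x p\<close> and \<open>x q\<close> on one circle
    with \<open>x u\<close> and \<open>x v\<close>.\<close>
  have eq: "p = q" if "W p \<noteq> 0" "W q \<noteq> 0" "c p = c q" "(u, v, p) \<in> delaunay_triples x \<or> (v, u, p) \<in> delaunay_triples x" for p q
  proof -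
    have "incirc sqn (x u) (x v) (x p) (x q) = W p * (c q * W q) - (c p * W p) * W q"
      unfolding incirc_side W_def[symmetric] B_def[symmetric] c[OF that(1)] c[OF that(2)] by simp
    also have "\<dots> = 0" using that(3) by simp
    finally have 0: "incirc sqn (x u) (x v) (x p) (x q) = 0" "incirc sqn (x v) (x u) (x p) (x q) = 0"
      using incirc_swap[of sqn "x u" "x v" "x p" "x q"] by simp_all
    have "x q \<in> {x u, x v, x p}"
      using that(4)
    proof
      assume "(u, v, p) \<in> delaunay_triples x"
      then show ?thesis using generic_heightsD[OF assms(2), of "x u" "x v" "x p" "x q"] 0
        by (simp add: delaunay_triples_iff)
    next
      assume "(v, u, p) \<in> delaunay_triples x"
      then have "x q \<in> {x v, x u, x p}"
        using generic_heightsD[OF assms(2), of "x v" "x u" "x p" "x q"] 0 by (simp add: delaunay_triples_iff)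
      then show ?thesis by blast
    qed
    moreover have "q \<noteq> u" "q \<noteq> v" using that(2) by (auto simp: W_def)
    ultimately show ?thesis using assms(1) by (auto simp: inj_eq)
  qed
  have left: "{p. (u, v, p) \<in> delaunay_triples x} = {l}"
  proof -
    have lin: "(u, v, l) \<in> delaunay_triples x"
      unfolding delaunay_left_iff Icc using l(1) le by (simp add: L_def W_def c_def)
    moreover have "p = l" if p: "(u, v, p) \<in> delaunay_triples x" for p
    proof -
      have "0 < W p" "c p \<le> c l" using p unfolding delaunay_left_iff Icc by (auto simp: W_def c_def)
      moreover have "c l \<le> c p" using l(2) \<open>0 < W p\<close> by (simp add: L_def)
      ultimately show ?thesis using eq[of p l] l(1) p by (auto simp: L_def)
    qed
    ultimately show ?thesis by blast
  qed
  have right: "{p. (v, u, p) \<in> delaunay_triples x} = {r}"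
  proof -
    have rin: "(v, u, r) \<in> delaunay_triples x"
      unfolding delaunay_right_iff Icc using r(1) le by (simp add: R_def W_def c_def)
    moreover have "p = r" if p: "(v, u, p) \<in> delaunay_triples x" for p
    proof -
      have "W p < 0" "c r \<le> c p" using p unfolding delaunay_right_iff Icc by (auto simp: W_def c_def)
      moreover have "c p \<le> c r" using r(2) \<open>W p < 0\<close> by (simp add: R_def)
      ultimately show ?thesis using eq[of p r] r(1) p by (auto simp: R_def)
    qed
    ultimately show ?thesis by blast
  qed
  show ?thesis unfolding left right Icc using integral_kernel_Icc[OF le] by (simp add: c_def)
qed

section \<open>Divided differences and the matrix entries of the Levi form\<close>

definition ddiff :: "('i \<Rightarrow> complex) \<Rightarrow> 'i \<Rightarrow> 'i \<Rightarrow> 'i \<Rightarrow> ('i \<Rightarrow> complex) \<Rightarrow> complex" where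
  "ddiff x i j k \<xi> = \<xi> i / ((x i - x j) * (x i - x k)) + \<xi> j / ((x j - x i) * (x j - x k))
     + \<xi> k / ((x k - x i) * (x k - x j))"

text \<open>Half of \<open>orient\<close> is the area; the form is linear in \<open>\<xi>\<close>
  and conjugate linear in \<open>\<eta>\<close>.\<close>

definition tri_form :: "('i \<Rightarrow> complex) \<Rightarrow> 'i \<Rightarrow> 'i \<Rightarrow> 'i \<Rightarrow> ('i \<Rightarrow> complex) \<Rightarrow> ('i \<Rightarrow> complex) \<Rightarrow> complex" where
  "tri_form x i j k \<xi> \<eta> = complex_of_real (orient (x i) (x j) (x k) / 2) * ddiff x i j k \<xi> * cnj (ddiff x i j k \<eta>)"

definition levi_form :: "('i \<Rightarrow> complex) \<Rightarrow> ('i \<Rightarrow> complex) \<Rightarrow> ('i \<Rightarrow> complex) \<Rightarrow> complex" where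
  "levi_form x \<xi> \<eta> = (\<Sum>(i, j, k)\<in>delaunay_triples x. tri_form x i j k \<xi> \<eta>) / 3"

abbreviation unit_fun :: "'i \<Rightarrow> 'i \<Rightarrow> complex" where
  "unit_fun p \<equiv> (\<lambda>i. if i = p then 1 else 0)"

lemma ddiff_cyclic: "ddiff x j k i \<xi> = ddiff x i j k \<xi>"
  by (simp add: ddiff_def mult.commute add.commute add.left_commute)

lemma tri_form_cyclic: "tri_form x j k i \<xi> \<eta> = tri_form x i j k \<xi> \<eta>"
  by (simp only: tri_form_def ddiff_cyclic[of x j k i] orient_cyclic[of "x j" "x k" "x i"])

text \<open>The denominators contain \<open>(x p - x k) * cnj (x q - x k)\<close>, which equals
  \<open>orient\<close> times \<open>center_param - \<i>\<close>. The orientation cancels against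
  the area, leaving the primitive of the kernel; exchanging \<open>p\<close> and \<open>q\<close>
  reverses only the sign of the area.\<close>

lemma tri_form_edge:
  assumes "p \<noteq> q" "inj x" "orient (x p) (x q) (x k) \<noteq> 0"
  shows "tri_form x p q k (unit_fun p) (unit_fun q) =
    - complex_of_real (1 / (2 * (cmod (x p - x q))\<^sup>2)) * (1 / (complex_of_real (center_param x p q k) - \<i>))"
    and "tri_form x q p k (unit_fun p) (unit_fun q) =
    complex_of_real (1 / (2 * (cmod (x p - x q))\<^sup>2)) * (1 / (complex_of_real (center_param x p q k) - \<i>))"
proof -
  have k: "k \<noteq> p" "k \<noteq> q" using assms(3) by auto
  let ?O = "complex_of_real (orient (x p) (x q) (x k))"
  let ?c = "complex_of_real (center_param x p q k) - \<i>"
  let ?m = "complex_of_real ((cmod (x p - x q))\<^sup>2)"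
  have d: "ddiff x p q k (unit_fun p) = 1 / ((x p - x q) * (x p - x k))"
    "ddiff x p q k (unit_fun q) = 1 / ((x q - x p) * (x q - x k))"
    "ddiff x q p k (unit_fun p) = 1 / ((x p - x q) * (x p - x k))"
    "ddiff x q p k (unit_fun q) = 1 / ((x q - x p) * (x q - x k))"
    using k assms(1) by (simp_all add: ddiff_def)
  have m: "(x p - x q) * cnj (x q - x p) = - ?m"
  proof -
    have "(x p - x q) * cnj (x q - x p) = - ((x p - x q) * cnj (x p - x q))" by (simp add: algebra_simps)
    then show ?thesis by (simp only: complex_norm_square)
  qed
  have "(x p - x k) * cnj (x q - x k) = (x k - x p) * cnj (x k - x q)" by (simp add: algebra_simps)
  also have "\<dots> = ?O * ?c"
    unfolding side_orient using assms(3) by (simp add: center_param_def complex_eq_iff)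
  finally have s: "(x p - x k) * cnj (x q - x k) = ?O * ?c" .
  have "1 / ((x p - x q) * (x p - x k)) * cnj (1 / ((x q - x p) * (x q - x k)))
     = 1 / (((x p - x q) * cnj (x q - x p)) * ((x p - x k) * cnj (x q - x k)))" by (simp add: ac_simps)
  also have "\<dots> = - (1 / (?m * (?O * ?c)))" unfolding m s by simp
  finally have e: "1 / ((x p - x q) * (x p - x k)) * cnj (1 / ((x q - x p) * (x q - x k))) = - (1 / (?m * (?O * ?c)))" .
  have "w \<noteq> 0 \<Longrightarrow> w / 2 * - (1 / (m * (w * c))) = - (1 / (2 * m)) * (1 / c)" for w m c :: complex
    by (simp add: divide_simps)
  from this[of ?O ?m ?c] have r: "?O / 2 * - (1 / (?m * (?O * ?c))) = - (1 / (2 * ?m)) * (1 / ?c)"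
    using assms(3) by simp
  show "tri_form x p q k (unit_fun p) (unit_fun q) = - complex_of_real (1 / (2 * (cmod (x p - x q))\<^sup>2)) * (1 / ?c)"
    unfolding tri_form_def d mult.assoc e using r by simp
  show "tri_form x q p k (unit_fun p) (unit_fun q) = complex_of_real (1 / (2 * (cmod (x p - x q))\<^sup>2)) * (1 / ?c)"
    unfolding tri_form_def d mult.assoc e orient_swap[of "x q" "x p"] using r by simp
qed

text \<open>A surviving triple contains \<open>p\<close> and \<open>q\<close> at two cyclically
  adjacent places, in either order; each order occurs in three rotations. \<open>g a b\<close>
  selects the triples that begin with \<open>a\<close>, \<open>b\<close>.\<close>

lemma sum_triples_edge:
  fixes f :: "'i::finite \<Rightarrow> 'i \<Rightarrow> 'i \<Rightarrow> complex"
  assumes pq: "p \<noteq> q" and cyc: "\<And>i j k. f j k i = f i j k"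
    and zero: "\<And>i j k. \<not> (p \<in> {i, j, k} \<and> q \<in> {i, j, k}) \<Longrightarrow> f i j k = 0"
    and dist: "\<And>i j k. i = j \<or> j = k \<or> i = k \<Longrightarrow> f i j k = 0"
  shows "(\<Sum>i\<in>UNIV. \<Sum>j\<in>UNIV. \<Sum>k\<in>UNIV. f i j k) = 3 * (\<Sum>k\<in>UNIV. f p q k) + 3 * (\<Sum>k\<in>UNIV. f q p k)"
proof -
  define g where "g a b i j k = (if i = a then if j = b then f i j k else 0 else 0)" for a b i j k
  have split: "f i j k = g p q i j k + g p q j k i + g p q k i j + g q p i j k + g q p j k i + g q p k i j" for i j k
  proof (cases "f i j k = 0")
    case True
    then have z: "f i j k = 0" "f j k i = 0" "f k i j = 0" using cyc[of k i j] cyc[of i j k] by simp_all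
    show ?thesis unfolding g_def z by simp
  next
    case False
    then have "p \<in> {i, j, k}" "q \<in> {i, j, k}" "i \<noteq> j" "j \<noteq> k" "i \<noteq> k"
      using zero dist by blast+
    then show ?thesis using pq cyc[of j k i] cyc[of i j k] by (elim insertE emptyE) (simp_all add: g_def)
  qed
  have g: "(\<Sum>i\<in>UNIV. \<Sum>j\<in>UNIV. \<Sum>k\<in>UNIV. g a b i j k) = (\<Sum>k\<in>UNIV. f a b k)" for a b
  proof -
    have "(\<Sum>k\<in>UNIV. g a b i j k) = (if i = a then if j = b then (\<Sum>k\<in>UNIV. f i j k) else 0 else 0)" for i j
      by (simp add: g_def)
    then have "(\<Sum>j\<in>UNIV. \<Sum>k\<in>UNIV. g a b i j k) = (if i = a then (\<Sum>k\<in>UNIV. f i b k) else 0)" for i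
      by simp
    then show ?thesis by simp
  qed
  have g2: "(\<Sum>i\<in>UNIV. \<Sum>j\<in>UNIV. \<Sum>k\<in>UNIV. g a b j k i) = (\<Sum>k\<in>UNIV. f a b k)" for a b
  proof -
    have "(\<Sum>i\<in>UNIV. \<Sum>j\<in>UNIV. \<Sum>k\<in>UNIV. g a b j k i) = (\<Sum>j\<in>UNIV. \<Sum>i\<in>UNIV. \<Sum>k\<in>UNIV. g a b j k i)"
      by (rule sum.swap)
    also have "\<dots> = (\<Sum>j\<in>UNIV. \<Sum>k\<in>UNIV. \<Sum>i\<in>UNIV. g a b j k i)"
      by (rule sum.cong[OF refl], rule sum.swap)
    finally show ?thesis using g by simp
  qed
  have g3: "(\<Sum>i\<in>UNIV. \<Sum>j\<in>UNIV. \<Sum>k\<in>UNIV. g a b k i j) = (\<Sum>k\<in>UNIV. f a b k)" for a b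
  proof -
    have "(\<Sum>i\<in>UNIV. \<Sum>j\<in>UNIV. \<Sum>k\<in>UNIV. g a b k i j) = (\<Sum>i\<in>UNIV. \<Sum>k\<in>UNIV. \<Sum>j\<in>UNIV. g a b k i j)"
      by (rule sum.cong[OF refl], rule sum.swap)
    also have "\<dots> = (\<Sum>k\<in>UNIV. \<Sum>i\<in>UNIV. \<Sum>j\<in>UNIV. g a b k i j)"
      by (rule sum.swap)
    finally show ?thesis using g by simp
  qed
  show ?thesis
    by (subst split) (simp add: sum.distrib g g2 g3)
qed

lemma levi_form_edge:
  fixes x :: "'i::finite \<Rightarrow> complex"
  assumes "inj x" "generic_heights sqn (range x)" "two_sided x p" "p \<noteq> q"
  shows "levi_form x (unit_fun p) (unit_fun q) = edge_weight x p q"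
proof -
  define f where "f i j k = (if (i, j, k) \<in> delaunay_triples x
    then tri_form x i j k (unit_fun p) (unit_fun q) else 0)" for i j k
  have cyc: "f j k i = f i j k" for i j k
    by (simp add: f_def delaunay_triples_cyclic tri_form_cyclic)
  have zero: "f i j k = 0" if "\<not> (p \<in> {i, j, k} \<and> q \<in> {i, j, k})" for i j k
    using that by (auto simp: f_def tri_form_def ddiff_def)
  have dist: "f i j k = 0" if "i = j \<or> j = k \<or> i = k" for i j k
    using that by (auto simp: f_def delaunay_triples_iff)
  have "(\<Sum>(i, j, k)\<in>delaunay_triples x. tri_form x i j k (unit_fun p) (unit_fun q))
      = (\<Sum>(i, j, k)\<in>UNIV. f i j k)"
    by (rule sum.mono_neutral_cong_left) (auto simp: f_def)
  also have "\<dots> = (\<Sum>i\<in>UNIV. \<Sum>j\<in>UNIV. \<Sum>k\<in>UNIV. f i j k)"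
    by (simp only: UNIV_Times_UNIV[symmetric] sum.cartesian_product[symmetric] case_prod_unfold fst_conv snd_conv)
      (simp add: sum.cartesian_product case_prod_unfold)
  also have "\<dots> = 3 * (\<Sum>k\<in>UNIV. f p q k) + 3 * (\<Sum>k\<in>UNIV. f q p k)"
    by (rule sum_triples_edge[OF assms(4) cyc zero dist])
  finally have L: "levi_form x (unit_fun p) (unit_fun q) = (\<Sum>k\<in>UNIV. f p q k) + (\<Sum>k\<in>UNIV. f q p k)"
    unfolding levi_form_def by simp
  let ?m = "complex_of_real (1 / (2 * (cmod (x p - x q))\<^sup>2))"
  let ?t = "\<lambda>k. 1 / (complex_of_real (center_param x p q k) - \<i>)"
  have l: "(\<Sum>k\<in>UNIV. f p q k) = (\<Sum>k | (p, q, k) \<in> delaunay_triples x. - ?m * ?t k)"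
  proof (rule sum.mono_neutral_cong_right)
    fix k assume "k \<in> {k. (p, q, k) \<in> delaunay_triples x}"
    then have d: "(p, q, k) \<in> delaunay_triples x" by simp
    then have "orient (x p) (x q) (x k) \<noteq> 0" by (simp add: delaunay_triples_iff)
    from tri_form_edge(1)[OF assms(4,1) this] d show "f p q k = - ?m * ?t k" by (simp only: f_def if_True)
  qed (auto simp: f_def)
  have r: "(\<Sum>k\<in>UNIV. f q p k) = (\<Sum>k | (q, p, k) \<in> delaunay_triples x. ?m * ?t k)"
  proof (rule sum.mono_neutral_cong_right)
    fix k assume "k \<in> {k. (q, p, k) \<in> delaunay_triples x}"
    then have d: "(q, p, k) \<in> delaunay_triples x" by simp
    then have "orient (x p) (x q) (x k) \<noteq> 0" by (simp add: delaunay_right_iff)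
    from tri_form_edge(2)[OF assms(4,1) this] d show "f q p k = ?m * ?t k" by (simp only: f_def if_True)
  qed (auto simp: f_def)
  show ?thesis
    unfolding L l r edge_weight_def voronoi_edge_integral[OF assms]
    by (simp only: sum_distrib_left[symmetric] right_diff_distrib) simp
qed

lemma levi_form_sum_right:
  "levi_form x \<xi> (\<lambda>i. \<Sum>q\<in>Q. \<eta> q i) = (\<Sum>q\<in>Q. levi_form x \<xi> (\<eta> q))"
proof -
  have "ddiff x i j k (\<lambda>i. \<Sum>q\<in>Q. \<eta> q i) = (\<Sum>q\<in>Q. ddiff x i j k (\<eta> q))" for i j k
    by (simp add: ddiff_def sum_divide_distrib sum.distrib)
  then have "tri_form x i j k \<xi> (\<lambda>i. \<Sum>q\<in>Q. \<eta> q i) = (\<Sum>q\<in>Q. tri_form x i j k \<xi> (\<eta> q))" for i j k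
    by (simp add: tri_form_def sum_distrib_left)
  then show ?thesis
    unfolding levi_form_def sum_divide_distrib[symmetric]
    by (subst sum.swap) (simp add: case_prod_unfold)
qed

lemma levi_form_const: "levi_form x \<xi> (\<lambda>_. 1) = 0"
proof -
  have "ddiff x i j k (\<lambda>_. 1) = 0" if "(i, j, k) \<in> delaunay_triples x" for i j k
  proof -
    have "x i \<noteq> x j" "x j \<noteq> x k" "x i \<noteq> x k"
      using that orient_distinct[of "x i" "x j" "x k"] by (auto simp: delaunay_triples_iff)
    then have ne: "x i - x j \<noteq> 0" "x i - x k \<noteq> 0" "x j - x i \<noteq> 0" "x j - x k \<noteq> 0" "x k - x i \<noteq> 0" "x k - x j \<noteq> 0"
      by auto
    then show ?thesis unfolding ddiff_def
      by (simp add: divide_simps) (simp add: algebra_simps)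
  qed
  then show ?thesis unfolding levi_form_def by (auto simp: tri_form_def intro!: sum.neutral)
qed

text \<open>The constant vector is the sum of all \<open>unit_fun q\<close> and is annihilated by
  every second divided difference, so the full row sums to zero.\<close>

lemma levi_form_vertex:
  fixes x :: "'i::finite \<Rightarrow> complex"
  assumes "inj x" "generic_heights sqn (range x)" "two_sided x p"
  shows "levi_form x (unit_fun p) (unit_fun p) = - (\<Sum>q\<in>- {p}. edge_weight x p q)"
proof -
  have "(\<lambda>_::'i. 1::complex) = (\<lambda>i. \<Sum>q\<in>UNIV. unit_fun q i)" by (simp add: fun_eq_iff)
  then have "0 = (\<Sum>q\<in>UNIV. levi_form x (unit_fun p) (unit_fun q))"
    using levi_form_const[of x "unit_fun p"] by (simp only: levi_form_sum_right)
  also have "\<dots> = levi_form x (unit_fun p) (unit_fun p) + (\<Sum>q\<in>- {p}. levi_form x (unit_fun p) (unit_fun q))"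
    by (subst sum.remove[of _ p]) (simp_all add: Compl_eq_Diff_UNIV)
  also have "(\<Sum>q\<in>- {p}. levi_form x (unit_fun p) (unit_fun q)) = (\<Sum>q\<in>- {p}. edge_weight x p q)"
    by (rule sum.cong[OF refl]) (use levi_form_edge[OF assms] in auto)
  finally show ?thesis by (simp add: eq_neg_iff_add_eq_0)
qed

section \<open>Wirtinger derivatives of the prepotential\<close>

lemma ln_cmod_has_derivative:
  assumes "(D has_derivative D') (at x)" "D x \<noteq> 0"
  shows "((\<lambda>y. ln (cmod (D y))) has_derivative (\<lambda>h. Re (D' h / D x))) (at x)"
proof -
  have half: "1/2 * (2 * a * inverse b) = a / b" for a b :: real by (simp add: field_simps)
  have pos: "0 < (Re (D x))\<^sup>2 + (Im (D x))\<^sup>2"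
    using assms(2) by (simp add: complex_neq_0)
  have "((\<lambda>y. (Re (D y))\<^sup>2 + (Im (D y))\<^sup>2) has_derivative
     (\<lambda>h. 2 * (Re (D' h) * Re (D x) + Im (D' h) * Im (D x)))) (at x)"
    by (auto intro!: derivative_eq_intros assms(1) simp: fun_eq_iff algebra_simps)
  from has_derivative_mult_right[OF has_derivative_ln[OF pos this], of "1/2"]
  have "((\<lambda>y. 1/2 * ln ((Re (D y))\<^sup>2 + (Im (D y))\<^sup>2)) has_derivative
     (\<lambda>h. Re (D' h / D x))) (at x)"
    by (simp only: half Re_divide)
  moreover have "ln (cmod w) = 1/2 * ln ((Re w)\<^sup>2 + (Im w)\<^sup>2)" for w
    by (cases "w = 0") (simp_all add: cmod_def ln_sqrt complex_neq_0)
  ultimately show ?thesis by (simp only:)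
qed

lemma ln_cnj_has_derivative:
  assumes "(D has_derivative D') (at x)" "(Q has_derivative Q') (at x)" "D x \<noteq> 0"
  shows "((\<lambda>y. complex_of_real (ln (cmod (D y))) * cnj (Q y)) has_derivative
    (\<lambda>h. complex_of_real (ln (cmod (D x))) * cnj (Q' h) + complex_of_real (Re (D' h / D x)) * cnj (Q x))) (at x)"
  by (intro has_derivative_mult bounded_linear.has_derivative[OF bounded_linear_of_real]
      bounded_linear.has_derivative[OF bounded_linear_cnj] ln_cmod_has_derivative assms)

text \<open>The indices 1 and 2 stand for a direction and its multiple by \<open>\<i>\<close>. The
  conjugated factor is antiholomorphic and drops out, while \<open>ln \<bar>D\<bar>\<close>
  contributes half of its holomorphic logarithmic derivative.\<close>

lemma ln_cnj_wirtinger: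
  assumes "d2 = \<i> * d1" "q2 = \<i> * q1"
  shows "((L * cnj q1 + complex_of_real (Re (d1 / w)) * cnj q) - \<i> * (L * cnj q2 + complex_of_real (Re (d2 / w)) * cnj q)) / 2
    = (d1 / w) * cnj q / 2"
proof -
  have "complex_of_real (Re (d1 / w)) - \<i> * complex_of_real (Re (d2 / w)) = d1 / w"
  proof -
    have "d2 / w = \<i> * (d1 / w)" unfolding assms(1) by simp
    then have "Re (d2 / w) = - Im (d1 / w)" by (simp only: Re_i_times)
    then show ?thesis by (simp only: complex_eq_iff) simp
  qed
  moreover have "((L * cnj q1 + complex_of_real (Re (d1 / w)) * cnj q) - \<i> * (L * cnj q2 + complex_of_real (Re (d2 / w)) * cnj q)) / 2
    = (L * (cnj q1 - \<i> * cnj q2) + (complex_of_real (Re (d1 / w)) - \<i> * complex_of_real (Re (d2 / w))) * cnj q) / 2"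
    by (simp only: algebra_simps)
  moreover have "cnj q1 - \<i> * cnj q2 = 0" unfolding assms(2) by (simp add: complex_eq_iff)
  ultimately show ?thesis by simp
qed

lemma quotient_has_derivative:
  fixes A B :: "'a::real_normed_vector \<Rightarrow> complex"
  assumes "(A has_derivative A') (at x)" "(B has_derivative B') (at x)" "A x \<noteq> B x"
  shows "((\<lambda>y. k / (A y - B y)) has_derivative (\<lambda>h. - (k / (A x - B x)\<^sup>2) * (A' h - B' h))) (at x)"
proof -
  have "((\<lambda>w. k / w) has_field_derivative - (k / (A x - B x)\<^sup>2)) (at (A x - B x))"
    using assms(3) by (auto intro!: derivative_eq_intros simp: power2_eq_square)
  then show ?thesis
    unfolding has_field_derivative_def
    by (rule has_derivative_compose[OF has_derivative_diff[OF assms(1,2)]])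
qed

text \<open>First divided difference of \<open>\<xi>\<close>; equally, the logarithmic derivative of
  the side \<open>x j - x i\<close> when the points move along \<open>\<xi>\<close>.\<close>

definition slope :: "('i \<Rightarrow> complex) \<Rightarrow> ('i \<Rightarrow> complex) \<Rightarrow> 'i \<Rightarrow> 'i \<Rightarrow> complex" where
  "slope x \<xi> i j = (\<xi> j - \<xi> i) / (x j - x i)"

text \<open>Differences of slopes are sides times the second divided difference. The terms in the
  common slope \<open>X\<close> cancel because the sides sum to zero, and the remaining bracket in
  the sides is \<open>- 2 * \<i>\<close> times the orientation.\<close>

lemma tri_form_slope:
  assumes "0 < orient (x i) (x j) (x k)"
  shows "(\<i> / 4) * (slope x \<xi> j k * cnj (slope x \<eta> k i - slope x \<eta> i j)
      + slope x \<xi> k i * cnj (slope x \<eta> i j - slope x \<eta> j k)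
      + slope x \<xi> i j * cnj (slope x \<eta> j k - slope x \<eta> k i)) = tri_form x i j k \<xi> \<eta>"
proof -
  define a b c where "a = x i" and "b = x j" and "c = x k"
  have "a \<noteq> b" "b \<noteq> c" "a \<noteq> c"
    using assms orient_distinct[of "x i" "x j" "x k"] by (auto simp: a_def b_def c_def)
  then have ne: "a - b \<noteq> 0" "b - a \<noteq> 0" "a - c \<noteq> 0" "c - a \<noteq> 0" "b - c \<noteq> 0" "c - b \<noteq> 0" by auto
  have sd: "slope x \<zeta> k i - slope x \<zeta> j k = (a - b) * ddiff x i j k \<zeta>"
    "slope x \<zeta> i j - slope x \<zeta> k i = (b - c) * ddiff x i j k \<zeta>"
    "slope x \<zeta> j k - slope x \<zeta> i j = (c - a) * ddiff x i j k \<zeta>" for \<zeta>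
    unfolding slope_def ddiff_def a_def[symmetric] b_def[symmetric] c_def[symmetric]
    using ne by (simp_all add: divide_simps) (simp_all add: algebra_simps)
  define q r where "q = ddiff x i j k \<xi>" and "r = ddiff x i j k \<eta>"
  define X where "X = slope x \<xi> j k"
  have Y: "slope x \<xi> k i = X + (a - b) * q" and Z: "slope x \<xi> i j = X - (c - a) * q"
    using sd(1,3)[of \<xi>] by (simp_all add: X_def q_def algebra_simps)
  have d: "slope x \<eta> k i - slope x \<eta> i j = - ((b - c) * r)" "slope x \<eta> i j - slope x \<eta> j k = - ((c - a) * r)"
    "slope x \<eta> j k - slope x \<eta> k i = - ((a - b) * r)"
    using sd[of \<eta>] by (simp_all add: r_def algebra_simps)
  have "X * cnj (- ((b - c) * r)) + (X + (a - b) * q) * cnj (- ((c - a) * r)) + (X - (c - a) * q) * cnj (- ((a - b) * r))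
    = ((c - a) * cnj (a - b) - (a - b) * cnj (c - a)) * q * cnj r"
    by (simp add: algebra_simps)
  also have "(c - a) * cnj (a - b) - (a - b) * cnj (c - a) = - (2 * \<i>) * complex_of_real (orient a b c)"
    by (simp add: complex_eq_iff orient_eq algebra_simps)
  finally have e: "X * cnj (- ((b - c) * r)) + (X + (a - b) * q) * cnj (- ((c - a) * r)) + (X - (c - a) * q) * cnj (- ((a - b) * r))
    = - (2 * \<i>) * complex_of_real (orient a b c) * q * cnj r" .
  show ?thesis
    unfolding d Y Z X_def[symmetric] e tri_form_def q_def[symmetric] r_def[symmetric]
      a_def[symmetric] b_def[symmetric] c_def[symmetric]
    by (simp add: mult.assoc)
qed

section \<open>First and second derivatives for a single triangle\<close>

definition vol_gradient :: "('i \<Rightarrow> complex) \<Rightarrow> 'i \<Rightarrow> 'i \<Rightarrow> 'i \<Rightarrow> ('i \<Rightarrow> complex) \<Rightarrow> real" where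
  "vol_gradient x i j k \<xi> = - (ln (cmod (x k - x j)) * Im (slope x \<xi> k i - slope x \<xi> i j)
     + ln (cmod (x i - x k)) * Im (slope x \<xi> i j - slope x \<xi> j k)
     + ln (cmod (x j - x i)) * Im (slope x \<xi> j k - slope x \<xi> k i))"

text \<open>Derivative of minus the volume with respect to the conjugate variable in the direction
  \<open>\<xi>\<close>; the sign of the prepotential is already included.\<close>

definition vol_antiholo :: "('i \<Rightarrow> complex) \<Rightarrow> 'i \<Rightarrow> 'i \<Rightarrow> 'i \<Rightarrow> ('i \<Rightarrow> complex) \<Rightarrow> complex" where
  "vol_antiholo x i j k \<xi> = (\<i> / 2) *
     (complex_of_real (ln (cmod (x k - x j))) * cnj (slope x \<xi> k i - slope x \<xi> i j)
     + complex_of_real (ln (cmod (x i - x k))) * cnj (slope x \<xi> i j - slope x \<xi> j k)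
     + complex_of_real (ln (cmod (x j - x i))) * cnj (slope x \<xi> j k - slope x \<xi> k i))"

lemma slope_scale: "slope x (\<lambda>l. c * \<xi> l) i j = c * slope x \<xi> i j"
  by (simp add: slope_def right_diff_distrib)

text \<open>Termwise this is \<open>Im \<kappa> + \<i> * Im (\<i> * \<kappa>) = \<i> * cnj
  \<kappa>\<close>, which extracts the conjugate linear part.\<close>

lemma vol_gradient_wirtinger:
  "(complex_of_real (- vol_gradient x i j k \<xi>) + \<i> * complex_of_real (- vol_gradient x i j k (\<lambda>l. \<i> * \<xi> l))) / 2
    = vol_antiholo x i j k \<xi>"
proof -
  have w: "complex_of_real (Im \<kappa>) + \<i> * complex_of_real (Im (\<i> * \<kappa>)) = \<i> * cnj \<kappa>" for \<kappa>
    by (simp add: complex_eq_iff)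
  define p q r where "p = slope x \<xi> k i - slope x \<xi> i j" and "q = slope x \<xi> i j - slope x \<xi> j k"
    and "r = slope x \<xi> j k - slope x \<xi> k i"
  define a b c where "a = complex_of_real (ln (cmod (x k - x j)))" and "b = complex_of_real (ln (cmod (x i - x k)))"
    and "c = complex_of_real (ln (cmod (x j - x i)))"
  have 1: "complex_of_real (- vol_gradient x i j k \<xi>) = a * Im p + b * Im q + c * Im r"
    by (simp add: vol_gradient_def p_def q_def r_def a_def b_def c_def)
  have 2: "complex_of_real (- vol_gradient x i j k (\<lambda>l. \<i> * \<xi> l)) = a * Im (\<i> * p) + b * Im (\<i> * q) + c * Im (\<i> * r)"
    by (simp add: vol_gradient_def slope_scale p_def q_def r_def a_def b_def c_def)
  have "(a * Im p + b * Im q + c * Im r) + \<i> * (a * Im (\<i> * p) + b * Im (\<i> * q) + c * Im (\<i> * r))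
    = a * (complex_of_real (Im p) + \<i> * complex_of_real (Im (\<i> * p)))
    + b * (complex_of_real (Im q) + \<i> * complex_of_real (Im (\<i> * q)))
    + c * (complex_of_real (Im r) + \<i> * complex_of_real (Im (\<i> * r)))"
    by (simp only: algebra_simps)
  also have "\<dots> = \<i> * (a * cnj p + b * cnj q + c * cnj r)" unfolding w by (simp add: algebra_simps)
  finally have e: "(a * Im p + b * Im q + c * Im r) + \<i> * (a * Im (\<i> * p) + b * Im (\<i> * q) + c * Im (\<i> * r))
    = \<i> * (a * cnj p + b * cnj q + c * cnj r)" .
  show ?thesis
    unfolding 1 2 e vol_antiholo_def p_def[symmetric] q_def[symmetric] r_def[symmetric]
      a_def[symmetric] b_def[symmetric] c_def[symmetric] by simp
qed

text \<open>The parameter space is only real; \<open>e'\<close> acts as \<open>\<i>\<close> times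
  \<open>e\<close> when it moves every point by \<open>\<i>\<close> times the displacement along
  \<open>e\<close>. Each summand is a logarithm times a conjugated slope difference, as in
  \<open>ln_cnj_wirtinger\<close>.\<close>

lemma vol_antiholo_has_derivative:
  fixes X :: "'a::real_normed_vector \<Rightarrow> 'i \<Rightarrow> complex"
  assumes d: "\<And>i. ((\<lambda>z. X z i) has_derivative (\<lambda>h. X' h i)) (at z)"
    and o: "0 < orient (X z i) (X z j) (X z k)"
  obtains G where "((\<lambda>z. vol_antiholo (X z) i j k \<eta>) has_derivative G) (at z)"
    "\<And>e e'. X' e' = (\<lambda>l. \<i> * X' e l) \<Longrightarrow> (G e - \<i> * G e') / 2 = tri_form (X z) i j k (X' e) \<eta>"
proof -
  have n: "X z i \<noteq> X z j" "X z j \<noteq> X z k" "X z i \<noteq> X z k"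
    using o orient_distinct[of "X z i" "X z j" "X z k"] by auto
  define S where "S i j h = - ((\<eta> j - \<eta> i) / (X z j - X z i)\<^sup>2) * (X' h j - X' h i)" for i j h
  have s: "((\<lambda>z. slope (X z) \<eta> i j) has_derivative S i j) (at z)" if "X z i \<noteq> X z j" for i j
    unfolding slope_def S_def by (rule quotient_has_derivative[OF d d]) (use that in simp)
  have Si: "S i j e' = \<i> * S i j e" if "X' e' = (\<lambda>l. \<i> * X' e l)" for i j e e'
    unfolding S_def that by (simp add: algebra_simps)
  define T where "T a b p q h = complex_of_real (ln (cmod (X z b - X z a))) * cnj (S (fst p) (snd p) h - S (fst q) (snd q) h)
     + complex_of_real (Re ((X' h b - X' h a) / (X z b - X z a)))
       * cnj (slope (X z) \<eta> (fst p) (snd p) - slope (X z) \<eta> (fst q) (snd q))" for a b p q h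
  have t: "((\<lambda>z. complex_of_real (ln (cmod (X z b - X z a))) * cnj (slope (X z) \<eta> p p' - slope (X z) \<eta> q q'))
      has_derivative T a b (p, p') (q, q')) (at z)"
    if "X z b \<noteq> X z a" "X z p \<noteq> X z p'" "X z q \<noteq> X z q'" for a b p p' q q'
    unfolding T_def fst_conv snd_conv
    by (rule ln_cnj_has_derivative) (use that in \<open>auto intro!: has_derivative_diff d s\<close>)
  have w: "(T a b p q e - \<i> * T a b p q e') / 2
      = slope (X z) (X' e) a b * cnj (slope (X z) \<eta> (fst p) (snd p) - slope (X z) \<eta> (fst q) (snd q)) / 2"
    if "X' e' = (\<lambda>l. \<i> * X' e l)" for a b p q e e'
    unfolding T_def slope_def[of "X z" "X' e" a b]
    by (rule ln_cnj_wirtinger) (use that Si[OF that] in \<open>simp_all add: algebra_simps\<close>)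
  define G where "G h = (\<i> / 2) * (T j k (k, i) (i, j) h + T k i (i, j) (j, k) h + T i j (j, k) (k, i) h)" for h
  have "((\<lambda>z. vol_antiholo (X z) i j k \<eta>) has_derivative G) (at z)"
    unfolding vol_antiholo_def G_def
    by (intro has_derivative_mult_right has_derivative_add t) (use n in auto)
  moreover have "(G e - \<i> * G e') / 2 = tri_form (X z) i j k (X' e) \<eta>" if e: "X' e' = (\<lambda>l. \<i> * X' e l)" for e e'
  proof -
    have "(G e - \<i> * G e') / 2 = (\<i> / 2) * ((T j k (k, i) (i, j) e - \<i> * T j k (k, i) (i, j) e') / 2
       + (T k i (i, j) (j, k) e - \<i> * T k i (i, j) (j, k) e') / 2 + (T i j (j, k) (k, i) e - \<i> * T i j (j, k) (k, i) e') / 2)"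
      unfolding G_def by (simp add: algebra_simps add_divide_distrib diff_divide_distrib)
    also have "\<dots> = (\<i> / 4) * (slope (X z) (X' e) j k * cnj (slope (X z) \<eta> k i - slope (X z) \<eta> i j)
      + slope (X z) (X' e) k i * cnj (slope (X z) \<eta> i j - slope (X z) \<eta> j k)
      + slope (X z) (X' e) i j * cnj (slope (X z) \<eta> j k - slope (X z) \<eta> k i))"
      unfolding w[OF e] fst_conv snd_conv by (simp only: add_divide_distrib[symmetric]) simp
    also have "\<dots> = tri_form (X z) i j k (X' e) \<eta>" by (rule tri_form_slope[of "X z", OF o])
    finally show ?thesis .
  qed
  ultimately show ?thesis using that by blast
qed

lemma dir_deriv_eq:
  assumes "(g has_derivative g') (at z)"
  shows "dir_deriv g v z = g' v"
proof -
  have "((\<lambda>t. z + t *\<^sub>R v) has_derivative (\<lambda>t. t *\<^sub>R v)) (at 0)"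
    by (auto intro!: derivative_eq_intros)
  moreover have "(g has_derivative g') (at (z + 0 *\<^sub>R v))" using assms by simp
  ultimately have "((\<lambda>t. g (z + t *\<^sub>R v)) has_derivative (\<lambda>t. g' (t *\<^sub>R v))) (at 0)"
    by (rule has_derivative_compose)
  moreover have "g' (t *\<^sub>R v) = t *\<^sub>R g' v" for t
    using has_derivative_linear[OF assms] by (rule linear_scale)
  ultimately have "((\<lambda>t. g (z + t *\<^sub>R v)) has_vector_derivative g' v) (at 0)"
    by (simp add: has_vector_derivative_def)
  then show ?thesis unfolding dir_deriv_def by (rule vector_derivative_at)
qed

text \<open>The index type \<open>'n + 3\<close> adjoins the fixed vertices, so that triangles and
  Voronoi edges treat all points alike. In the numeral type \<open>3\<close> the element 3 equals 0
  and falls to the last branch.\<close>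

definition config :: "complex \<Rightarrow> complex \<Rightarrow> complex \<Rightarrow> complex ^ 'n \<Rightarrow> 'n + 3 \<Rightarrow> complex" where
  "config z1 z2 z3 z i = (case i of Inl u \<Rightarrow> z $ u | Inr k \<Rightarrow> if k = 1 then z1 else if k = 2 then z2 else z3)"

definition displacement :: "complex ^ 'n \<Rightarrow> 'n + 3 \<Rightarrow> complex" where
  "displacement h i = (case i of Inl u \<Rightarrow> h $ u | Inr k \<Rightarrow> 0)"

lemma config_has_derivative:
  "((\<lambda>z. config z1 z2 z3 z i) has_derivative (\<lambda>h. displacement h i)) (at z)"
  by (cases i) (simp_all add: config_def displacement_def bounded_linear_imp_has_derivative bounded_linear_vec_nth)

lemma displacement_axis:
  "displacement (axis u c) = (\<lambda>i. c * unit_fun (Inl u) i)"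
  by (rule ext) (auto simp: displacement_def axis_def split: sum.splits)

lemma range_config: "range (config z1 z2 z3 z) = config_points z1 z2 z3 z"
proof -
  have "config z1 z2 z3 z (Inl u) \<in> config_points z1 z2 z3 z" for u
    by (simp add: config_def config_points_def)
  moreover have "config z1 z2 z3 z (Inr k) \<in> config_points z1 z2 z3 z" for k
    by (simp add: config_def config_points_def)
  moreover have "z1 = config z1 z2 z3 z (Inr 1)" "z2 = config z1 z2 z3 z (Inr 2)"
    "z3 = config z1 z2 z3 z (Inr 3)" "z $ u = config z1 z2 z3 z (Inl u)" for u
    by (simp_all add: config_def)
  ultimately show ?thesis
    unfolding config_points_def image_def by (auto simp: split_sum_ex)
qed

lemma orient_line:
  assumes "U \<noteq> V" "orient U V a = 0" "orient U V b = 0" "orient U V c = 0"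
  shows "orient a b c = 0"
proof -
  define d p q where "d = V - U" and "p = b - a" and "q = c - a"
  have 1: "Re d * Im p - Im d * Re p = 0" "Re d * Im q - Im d * Re q = 0"
    using assms(2-4) by (simp_all add: orient_eq d_def p_def q_def algebra_simps)
  have "Re d * orient a b c = Re p * (Re d * Im q - Im d * Re q) - Re q * (Re d * Im p - Im d * Re p)"
    "Im d * orient a b c = Im p * (Re d * Im q - Im d * Re q) - Im q * (Re d * Im p - Im d * Re p)"
    by (simp_all add: orient_eq p_def q_def algebra_simps)
  then have "Re d * orient a b c = 0" "Im d * orient a b c = 0" unfolding 1 by simp_all
  moreover have "d \<noteq> 0" using assms(1) by (simp add: d_def)
  ultimately show ?thesis by (auto simp: complex_eq_iff)
qed

section \<open>Configurations inside the fixed triangle\<close>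

context
  fixes z1 z2 z3 :: complex
  assumes nc: "\<not> collinear {z1, z2, z3}"
begin

lemma admissible_inj:
  fixes z :: "complex ^ 'n"
  assumes "admissible z1 z2 z3 z"
  shows "inj (config z1 z2 z3 z)"
proof (rule injI)
  fix i j :: "'n + 3"
  assume eq: "config z1 z2 z3 z i = config z1 z2 z3 z j"
  have int: "z $ u \<noteq> z1" "z $ u \<noteq> z2" "z $ u \<noteq> z3" for u
    using assms not_in_interior_convex_hull_3[of z1 z2 z3] not_in_interior_convex_hull_3[of z2 z1 z3]
      not_in_interior_convex_hull_3[of z3 z1 z2] unfolding admissible_def by (metis insert_commute)+
  have z: "z1 \<noteq> z2" "z2 \<noteq> z3" "z1 \<noteq> z3" using nc by (auto simp: insert_commute)
  have inj: "z $ u = z $ v \<Longrightarrow> u = v" for u v using assms by (auto simp: admissible_def inj_def)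
  have 3: "k = 1 \<or> k = 2 \<or> k = 3" for k :: 3 by (rule exhaust_3)
  show "i = j"
    using eq int z inj 3 unfolding config_def
    by (cases i; cases j) (auto split: if_splits; metis)+
qed

text \<open>With the positive barycentric weights of \<open>U\<close>, the orientations of the three
  fixed vertices against the line \<open>U V\<close> average to \<open>orient U V U\<close>, which
  is 0. They do not all vanish, so both signs occur.\<close>

lemma admissible_two_sided:
  fixes z :: "complex ^ 'n"
  assumes "admissible z1 z2 z3 z"
  shows "two_sided (config z1 z2 z3 z) (Inl u)"
  unfolding two_sided_def
proof (intro allI impI)
  fix v :: "'n + 3" assume v: "v \<noteq> Inl u"
  let ?x = "config z1 z2 z3 z"
  define U V where "U = ?x (Inl u)" and "V = ?x v"
  have "U \<noteq> V" using admissible_inj[OF assms] v by (auto simp: U_def V_def inj_eq)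
  have "U \<in> interior (convex hull {z1, z2, z3})"
    using assms by (simp add: U_def config_def admissible_def)
  then obtain r s t where rst: "0 < r" "0 < s" "0 < t" "r + s + t = 1" "U = r *\<^sub>R z1 + s *\<^sub>R z2 + t *\<^sub>R z3"
    using interior_convex_hull_3_minimal[OF nc] by auto
  have sum: "r * orient U V z1 + s * orient U V z2 + t * orient U V z3 = 0"
    using orient_affine[OF rst(4), of U V z1 z2 z3] unfolding rst(5)[symmetric] by simp
  have nz: "\<not> (orient U V z1 = 0 \<and> orient U V z2 = 0 \<and> orient U V z3 = 0)"
    using orient_line[OF \<open>U \<noteq> V\<close>] nc by (auto simp: collinear_iff_orient)
  have Z: "?x (Inr 1) = z1" "?x (Inr 2) = z2" "?x (Inr 3) = z3" by (simp_all add: config_def)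
  have "0 < orient U V z1 \<or> 0 < orient U V z2 \<or> 0 < orient U V z3"
  proof (rule ccontr)
    assume "\<not> ?thesis"
    then have "r * orient U V z1 \<le> 0" "s * orient U V z2 \<le> 0" "t * orient U V z3 \<le> 0"
      using rst(1-3) by (simp_all add: mult_le_0_iff not_less)
    then have "r * orient U V z1 = 0" "s * orient U V z2 = 0" "t * orient U V z3 = 0"
      using sum by linarith+
    then show False using rst(1-3) nz by simp
  qed
  moreover have "orient U V z1 < 0 \<or> orient U V z2 < 0 \<or> orient U V z3 < 0"
  proof (rule ccontr)
    assume "\<not> ?thesis"
    then have "0 \<le> r * orient U V z1" "0 \<le> s * orient U V z2" "0 \<le> t * orient U V z3"
      using rst(1-3) by (simp_all add: not_less)
    then have "r * orient U V z1 = 0" "s * orient U V z2 = 0" "t * orient U V z3 = 0"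
      using sum by linarith+
    then show False using rst(1-3) nz by simp
  qed
  ultimately show "(\<exists>p. 0 < orient (?x (Inl u)) (?x v) (?x p)) \<and> (\<exists>p. orient (?x (Inl u)) (?x v) (?x p) < 0)"
    unfolding U_def V_def using Z by metis
qed

text \<open>The fixed vertices are not collinear, so the triple contains a moving point, which a
  rotation brings to the front.\<close>

lemma admissible_collinear:
  fixes z :: "complex ^ 'n"
  assumes adm: "admissible z1 z2 z3 z" and ijk: "i \<noteq> j" "j \<noteq> k" "i \<noteq> k"
    and o: "orient (config z1 z2 z3 z i) (config z1 z2 z3 z j) (config z1 z2 z3 z k) = 0"
  shows "\<exists>l. incirc sqn (config z1 z2 z3 z i) (config z1 z2 z3 z j) (config z1 z2 z3 z k) (config z1 z2 z3 z l) < 0"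
proof -
  let ?x = "config z1 z2 z3 z"
  note two = two_sided_collinear[OF admissible_inj[OF adm] admissible_two_sided[OF adm]]
  have o2: "orient (?x j) (?x k) (?x i) = 0" "orient (?x k) (?x i) (?x j) = 0"
    using o orient_cyclic[of "?x j" "?x k" "?x i"] orient_cyclic[of "?x k" "?x i" "?x j"] by simp_all
  have ic: "incirc sqn (?x j) (?x k) (?x i) q = incirc sqn (?x i) (?x j) (?x k) q"
    "incirc sqn (?x k) (?x i) (?x j) q = incirc sqn (?x i) (?x j) (?x k) q" for q
    by (simp_all only: incirc_cyclic)
  have "\<exists>u. i = Inl u \<or> j = Inl u \<or> k = Inl u"
  proof (rule ccontr)
    assume "\<not> ?thesis"
    then obtain a b c where abc: "i = Inr a" "j = Inr b" "k = Inr c" by (metis sum.exhaust)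
    have "orient z1 z2 z3 \<noteq> 0" using nc by (simp add: collinear_iff_orient)
    then have "orient z1 z2 z3 \<noteq> 0" "orient z2 z3 z1 \<noteq> 0" "orient z3 z1 z2 \<noteq> 0"
      "orient z2 z1 z3 \<noteq> 0" "orient z1 z3 z2 \<noteq> 0" "orient z3 z2 z1 \<noteq> 0"
      by (simp_all add: orient_eq algebra_simps)
    moreover have "a \<noteq> b" "b \<noteq> c" "a \<noteq> c" using ijk abc by auto
    ultimately show False using o exhaust_3[of a] exhaust_3[of b] exhaust_3[of c]
      unfolding abc config_def by auto
  qed
  then obtain u where "i = Inl u \<or> j = Inl u \<or> k = Inl u" by blast
  then show ?thesis
  proof (elim disjE)
    assume "i = Inl u" then show ?thesis using two[of u j k] ijk o by auto
  next
    assume "j = Inl u" then show ?thesis using two[of u k i] ijk o2 ic(1) by auto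
  next
    assume "k = Inl u" then show ?thesis using two[of u i j] ijk o2 ic(2) by auto
  qed
qed

lemma unique_region_generic:
  fixes z :: "complex ^ 'n"
  assumes "z \<in> unique_region z1 z2 z3"
  shows "admissible z1 z2 z3 z" "generic_heights sqn (range (config z1 z2 z3 z))"
  using assms unique_imp_generic[of "range (config z1 z2 z3 z)"]
  by (auto simp: unique_region_def range_config[symmetric])

lemma prepot_generic:
  fixes z :: "complex ^ 'n"
  assumes "inj (config z1 z2 z3 z)" "generic_heights sqn (range (config z1 z2 z3 z))"
  shows "prepot z1 z2 z3 z = - ((\<Sum>(i, j, k)\<in>delaunay_triples (config z1 z2 z3 z).
    ideal_vol (config z1 z2 z3 z i) (config z1 z2 z3 z j) (config z1 z2 z3 z k)) / 3)"
proof -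
  let ?P = "range (config z1 z2 z3 z)"
  have mem: "z1 \<in> ?P" "z2 \<in> ?P" "z3 \<in> ?P" unfolding range_config by (simp_all add: config_points_def)
  have "orient z1 z2 z3 \<noteq> 0" using nc by (simp add: collinear_iff_orient)
  then consider "0 < orient z1 z2 z3" | "0 < orient z1 z3 z2"
    using orient_swap'[of z1 z2 z3] by linarith
  then have "the_delaunay ?P = lower_triangles sqn ?P"
    by cases (rule delaunay_generic(2)[OF _ _ _ _ _ assms(2)]; use mem in simp)+
  then show ?thesis unfolding prepot_def range_config[symmetric] using sum_tri_vol[OF assms(1)] by simp
qed

text \<open>On \<open>U\<close> the prepotential becomes a sum over a frozen set of triples and can
  be differentiated term by term.\<close>

lemma unique_region_locally:
  fixes z0 :: "complex ^ 'n"
  assumes "z0 \<in> unique_region z1 z2 z3"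
  shows "\<exists>U. open U \<and> z0 \<in> U \<and>
    (\<forall>z\<in>U. prepot z1 z2 z3 z = - ((\<Sum>(i, j, k)\<in>delaunay_triples (config z1 z2 z3 z0).
      ideal_vol (config z1 z2 z3 z i) (config z1 z2 z3 z j) (config z1 z2 z3 z k)) / 3) \<and>
      (\<forall>i j k. (i, j, k) \<in> delaunay_triples (config z1 z2 z3 z0) \<longrightarrow>
        0 < orient (config z1 z2 z3 z i) (config z1 z2 z3 z j) (config z1 z2 z3 z k)))"
proof -
  let ?x = "config z1 z2 z3"
  note gen = unique_region_generic[OF assms]
  have inj: "inj (?x z0)" by (rule admissible_inj[OF gen(1)])
  have lim: "((\<lambda>z. ?x z i) \<longlongrightarrow> ?x z0 i) (nhds z0)" for i
    using has_derivative_continuous[OF config_has_derivative[of z1 z2 z3 i z0]]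
    unfolding isCont_def by (rule iffD1[OF tendsto_at_iff_tendsto_nhds])
  have "\<forall>\<^sub>F z in nhds z0. delaunay_triples (?x z) = delaunay_triples (?x z0) \<and> generic_heights sqn (range (?x z))"
    by (rule delaunay_triples_stable[OF lim inj gen(2) admissible_collinear[OF gen(1)]])
  moreover have "\<forall>\<^sub>F z in nhds z0. \<forall>i j. i \<noteq> j \<longrightarrow> ?x z i - ?x z j \<noteq> 0"
    by (intro eventually_all_finite eventually_const_imp tendsto_imp_eventually_ne[OF tendsto_diff[OF lim lim]])
      (use inj in \<open>auto simp: inj_eq\<close>)
  ultimately have "\<forall>\<^sub>F z in nhds z0. delaunay_triples (?x z) = delaunay_triples (?x z0)
      \<and> generic_heights sqn (range (?x z)) \<and> inj (?x z)"
    by eventually_elim (auto simp: inj_def)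
  then obtain U where "open U" "z0 \<in> U" "\<forall>z\<in>U. delaunay_triples (?x z) = delaunay_triples (?x z0)
      \<and> generic_heights sqn (range (?x z)) \<and> inj (?x z)"
    unfolding eventually_nhds by (elim exE conjE) (rule that)
  then have U: "open U" "z0 \<in> U" "\<And>z. z \<in> U \<Longrightarrow> delaunay_triples (?x z) = delaunay_triples (?x z0)"
      "\<And>z. z \<in> U \<Longrightarrow> generic_heights sqn (range (?x z))" "\<And>z. z \<in> U \<Longrightarrow> inj (?x z)"
    by blast+
  show ?thesis
  proof (intro exI[of _ U] conjI ballI allI impI)
    fix z assume z: "z \<in> U"
    show "prepot z1 z2 z3 z = - ((\<Sum>(i, j, k)\<in>delaunay_triples (?x z0). ideal_vol (?x z i) (?x z j) (?x z k)) / 3)"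
      using prepot_generic[OF U(5)[OF z] U(4)[OF z]] unfolding U(3)[OF z] .
  next
    fix z i j k assume "z \<in> U" "(i, j, k) \<in> delaunay_triples (?x z0)"
    then show "0 < orient (?x z i) (?x z j) (?x z k)"
      using U(3)[of z] delaunay_triples_iff[of i j k "?x z"] by blast
  qed (rule U(1) U(2))+
qed

end

lemma prepot_derivatives:
  fixes z0 :: "complex ^ 'n"
  assumes nc: "\<not> collinear {z1, z2, z3}" and z0: "z0 \<in> unique_region z1 z2 z3"
  shows "(\<lambda>y. complex_of_real (prepot z1 z2 z3 y)) differentiable (at z0)"
    and "(\<lambda>w. wirt_bar (\<lambda>y. complex_of_real (prepot z1 z2 z3 y)) v w) differentiable (at z0)"
    and "levi z1 z2 z3 z0 u v = levi_form (config z1 z2 z3 z0) (unit_fun (Inl u)) (unit_fun (Inl v))"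
proof -
  let ?x = "config z1 z2 z3"
  define D where "D = delaunay_triples (?x z0)"
  obtain U where U0: "open U" "z0 \<in> U"
    "\<forall>z\<in>U. prepot z1 z2 z3 z = - ((\<Sum>(i, j, k)\<in>D. ideal_vol (?x z i) (?x z j) (?x z k)) / 3) \<and>
      (\<forall>i j k. (i, j, k) \<in> D \<longrightarrow> 0 < orient (?x z i) (?x z j) (?x z k))"
    using unique_region_locally[OF nc z0, folded D_def] by (elim exE conjE) (rule that)
  then have U: "open U" "z0 \<in> U"
    "\<And>z. z \<in> U \<Longrightarrow> prepot z1 z2 z3 z = - ((\<Sum>(i, j, k)\<in>D. ideal_vol (?x z i) (?x z j) (?x z k)) / 3)"
    "\<And>z i j k. \<lbrakk>z \<in> U; (i, j, k) \<in> D\<rbrakk> \<Longrightarrow> 0 < orient (?x z i) (?x z j) (?x z k)"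
    by blast+
  define g where "g z h = - ((\<Sum>(i, j, k)\<in>D. vol_gradient (?x z) i j k (displacement h)) / 3)" for z h
  have prepot: "((\<lambda>y. complex_of_real (prepot z1 z2 z3 y)) has_derivative (\<lambda>h. complex_of_real (g z h))) (at z)"
    if z: "z \<in> U" for z
  proof -
    have "((\<lambda>y. case t of (i, j, k) \<Rightarrow> ideal_vol (?x y i) (?x y j) (?x y k)) has_derivative
       (\<lambda>h. case t of (i, j, k) \<Rightarrow> vol_gradient (?x z) i j k (displacement h))) (at z)" if t: "t \<in> D" for t
    proof -
      obtain i j k where ijk: "t = (i, j, k)" by (cases t)
      have "0 < orient (?x z i) (?x z j) (?x z k)" using U(4)[OF z] t ijk by simp
      from ideal_vol_has_derivative[OF this config_has_derivative config_has_derivative config_has_derivative]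
      show ?thesis unfolding ijk prod.case vol_gradient_def slope_def .
    qed
    then have "((\<lambda>y. \<Sum>t\<in>D. case t of (i, j, k) \<Rightarrow> ideal_vol (?x y i) (?x y j) (?x y k)) has_derivative
       (\<lambda>h. \<Sum>t\<in>D. case t of (i, j, k) \<Rightarrow> vol_gradient (?x z) i j k (displacement h))) (at z)"
      by (rule has_derivative_sum)
    from has_derivative_mult_right[OF this, of "- 1 / 3"]
    have "((\<lambda>y. - ((\<Sum>(i, j, k)\<in>D. ideal_vol (?x y i) (?x y j) (?x y k)) / 3)) has_derivative g z) (at z)"
      by (simp add: g_def[abs_def])
    then have "(prepot z1 z2 z3 has_derivative g z) (at z)"
      by (rule has_derivative_transform_within_open[OF _ U(1) z]) (simp add: U(3))
    then show ?thesis by (rule bounded_linear.has_derivative[OF bounded_linear_of_real])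
  qed
  show "(\<lambda>y. complex_of_real (prepot z1 z2 z3 y)) differentiable (at z0)"
    using prepot[OF U(2)] by (rule differentiableI)
  have disp: "displacement (axis w 1) = unit_fun (Inl w)"
    "displacement (axis w \<i>) = (\<lambda>l. \<i> * unit_fun (Inl w) l)" for w :: 'n
    unfolding displacement_axis by simp_all
  \<comment> \<open>Valid on all of \<open>U\<close> and not only at \<open>z0\<close>, so that it
    can be differentiated again.\<close>
  have wb: "wirt_bar (\<lambda>y. complex_of_real (prepot z1 z2 z3 y)) v z
      = (\<Sum>(i, j, k)\<in>D. vol_antiholo (?x z) i j k (unit_fun (Inl v))) / 3" if z: "z \<in> U" for z
  proof -
    have "wirt_bar (\<lambda>y. complex_of_real (prepot z1 z2 z3 y)) v z
      = (complex_of_real (g z (axis v 1)) + \<i> * complex_of_real (g z (axis v \<i>))) / 2"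
      unfolding wirt_bar_def dir_deriv_eq[OF prepot[OF z]] ..
    also have "\<dots> = (\<Sum>t\<in>D. (case t of (i, j, k) \<Rightarrow> (complex_of_real (- vol_gradient (?x z) i j k (unit_fun (Inl v)))
        + \<i> * complex_of_real (- vol_gradient (?x z) i j k (\<lambda>l. \<i> * unit_fun (Inl v) l))) / 2)) / 3"
    proof -
      have g_eq: "complex_of_real (g z h) = (\<Sum>t\<in>D. case t of (i, j, k) \<Rightarrow> complex_of_real (- vol_gradient (?x z) i j k (displacement h))) / 3" for h
        by (simp add: g_def sum_negf case_prod_unfold)
      have "((\<Sum>t\<in>D. a t) / 3 + \<i> * ((\<Sum>t\<in>D. b t) / 3)) / 2 = (\<Sum>t\<in>D. (a t + \<i> * b t) / 2) / 3" for a b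
        by (simp add: sum_distrib_left sum.distrib sum_divide_distrib add_divide_distrib)
      then show ?thesis unfolding g_eq disp by (simp only: case_prod_unfold)
    qed
    finally show ?thesis unfolding vol_gradient_wirtinger .
  qed
  have "\<exists>G. ((\<lambda>z. case t of (i, j, k) \<Rightarrow> vol_antiholo (?x z) i j k (unit_fun (Inl v))) has_derivative G) (at z0) \<and>
      (G (axis u 1) - \<i> * G (axis u \<i>)) / 2
        = (case t of (i, j, k) \<Rightarrow> tri_form (?x z0) i j k (unit_fun (Inl u)) (unit_fun (Inl v)))" if t: "t \<in> D" for t
  proof -
    obtain i j k where ijk: "t = (i, j, k)" by (cases t)
    have o: "0 < orient (?x z0 i) (?x z0 j) (?x z0 k)" using U(4)[OF U(2)] t ijk by simp
    obtain G where G: "((\<lambda>z. vol_antiholo (?x z) i j k (unit_fun (Inl v))) has_derivative G) (at z0)"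
      "\<And>e e'. displacement e' = (\<lambda>l. \<i> * displacement e l) \<Longrightarrow>
         (G e - \<i> * G e') / 2 = tri_form (?x z0) i j k (displacement e) (unit_fun (Inl v))"
      by (rule vol_antiholo_has_derivative[of ?x displacement, OF config_has_derivative o, of "unit_fun (Inl v)"])
        (rule that)
    have "(G (axis u 1) - \<i> * G (axis u \<i>)) / 2 = tri_form (?x z0) i j k (unit_fun (Inl u)) (unit_fun (Inl v))"
      using G(2)[of "axis u \<i>" "axis u 1"] unfolding disp by simp
    then show ?thesis using G(1) unfolding ijk by auto
  qed
  then obtain G where G: "\<And>t. t \<in> D \<Longrightarrow>
      ((\<lambda>z. case t of (i, j, k) \<Rightarrow> vol_antiholo (?x z) i j k (unit_fun (Inl v))) has_derivative G t) (at z0)"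
    "\<And>t. t \<in> D \<Longrightarrow> (G t (axis u 1) - \<i> * G t (axis u \<i>)) / 2
        = (case t of (i, j, k) \<Rightarrow> tri_form (?x z0) i j k (unit_fun (Inl u)) (unit_fun (Inl v)))"
    by metis
  have "((\<lambda>z. (1/3) * (\<Sum>t\<in>D. case t of (i, j, k) \<Rightarrow> vol_antiholo (?x z) i j k (unit_fun (Inl v))))
      has_derivative (\<lambda>h. (1/3) * (\<Sum>t\<in>D. G t h))) (at z0)"
    by (intro has_derivative_mult_right has_derivative_sum G(1))
  then have H: "((\<lambda>w. wirt_bar (\<lambda>y. complex_of_real (prepot z1 z2 z3 y)) v w)
      has_derivative (\<lambda>h. (1/3) * (\<Sum>t\<in>D. G t h))) (at z0)"
    by (rule has_derivative_transform_within_open[OF _ U(1,2)]) (simp add: wb)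
  then show "(\<lambda>w. wirt_bar (\<lambda>y. complex_of_real (prepot z1 z2 z3 y)) v w) differentiable (at z0)"
    by (rule differentiableI)
  have "levi z1 z2 z3 z0 u v
    = ((1/3) * (\<Sum>t\<in>D. G t (axis u 1)) - \<i> * ((1/3) * (\<Sum>t\<in>D. G t (axis u \<i>)))) / 2"
    unfolding levi_def wirt_def dir_deriv_eq[OF H] ..
  also have "\<dots> = (1/3) * (\<Sum>t\<in>D. (G t (axis u 1) - \<i> * G t (axis u \<i>)) / 2)"
    by (simp add: sum_distrib_left sum_subtractf sum_divide_distrib diff_divide_distrib)
  also have "\<dots> = levi_form (?x z0) (unit_fun (Inl u)) (unit_fun (Inl v))"
    unfolding levi_form_def D_def[symmetric] using G(2) by simp
  finally show "levi z1 z2 z3 z0 u v = levi_form (?x z0) (unit_fun (Inl u)) (unit_fun (Inl v))" .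
qed

section \<open>Positivity and the continuous extension\<close>

lemma levi_form_nonneg:
  fixes x :: "'n::finite + 3 \<Rightarrow> complex" and \<xi> :: "complex ^ 'n"
  shows "\<exists>r\<ge>0. (\<Sum>u\<in>UNIV. \<Sum>v\<in>UNIV. \<xi> $ u * levi_form x (unit_fun (Inl u)) (unit_fun (Inl v)) * cnj (\<xi> $ v))
    = complex_of_real r"
proof -
  define S where "S = (\<lambda>(i, j, k). \<Sum>u\<in>UNIV. \<xi> $ u * ddiff x i j k (unit_fun (Inl u)))"
  \<comment> \<open>The 6 combines the 2 of the area formula with the 3 orderings of each
    triangle.\<close>
  define m where "m = (\<lambda>(i, j, k). orient (x i) (x j) (x k) / 6)"
  define d where "d t u = (case t of (i, j, k) \<Rightarrow> ddiff x i j k (unit_fun (Inl u :: 'n + 3)))" for t and u :: 'n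
  have lf: "levi_form x (unit_fun (Inl u)) (unit_fun (Inl v))
      = (\<Sum>t\<in>delaunay_triples x. complex_of_real (m t) * d t u * cnj (d t v))" for u v
    unfolding levi_form_def m_def d_def tri_form_def
    by (simp add: sum_divide_distrib case_prod_unfold)
  have "(\<Sum>u\<in>UNIV. \<Sum>v\<in>UNIV. \<xi> $ u * levi_form x (unit_fun (Inl u)) (unit_fun (Inl v)) * cnj (\<xi> $ v))
    = (\<Sum>u\<in>UNIV. \<Sum>v\<in>UNIV. \<Sum>t\<in>delaunay_triples x. complex_of_real (m t) * ((\<xi> $ u * d t u) * cnj (\<xi> $ v * d t v)))"
    unfolding lf by (simp add: sum_distrib_left sum_distrib_right ac_simps)
  also have "\<dots> = (\<Sum>u\<in>UNIV. \<Sum>t\<in>delaunay_triples x. \<Sum>v\<in>UNIV. complex_of_real (m t) * ((\<xi> $ u * d t u) * cnj (\<xi> $ v * d t v)))"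
    by (rule sum.cong[OF refl], rule sum.swap)
  also have "\<dots> = (\<Sum>t\<in>delaunay_triples x. \<Sum>u\<in>UNIV. \<Sum>v\<in>UNIV. complex_of_real (m t) * ((\<xi> $ u * d t u) * cnj (\<xi> $ v * d t v)))"
    by (rule sum.swap)
  also have "\<dots> = (\<Sum>t\<in>delaunay_triples x. complex_of_real (m t) * (S t * cnj (S t)))"
  proof (rule sum.cong[OF refl])
    fix t
    have S: "S t = (\<Sum>u\<in>UNIV. \<xi> $ u * d t u)" by (simp add: S_def d_def case_prod_unfold)
    show "(\<Sum>u\<in>UNIV. \<Sum>v\<in>UNIV. complex_of_real (m t) * ((\<xi> $ u * d t u) * cnj (\<xi> $ v * d t v)))
      = complex_of_real (m t) * (S t * cnj (S t))"
      unfolding S cnj_sum sum_product by (simp only: sum_distrib_left)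
  qed
  also have "\<dots> = complex_of_real (\<Sum>t\<in>delaunay_triples x. m t * (cmod (S t))\<^sup>2)"
    by (simp add: complex_norm_square del: of_real_power)
  finally have "(\<Sum>u\<in>UNIV. \<Sum>v\<in>UNIV. \<xi> $ u * levi_form x (unit_fun (Inl u)) (unit_fun (Inl v)) * cnj (\<xi> $ v))
    = complex_of_real (\<Sum>t\<in>delaunay_triples x. m t * (cmod (S t))\<^sup>2)" .
  moreover have "0 \<le> (\<Sum>t\<in>delaunay_triples x. m t * (cmod (S t))\<^sup>2)"
    by (intro sum_nonneg mult_nonneg_nonneg) (auto simp: m_def delaunay_triples_def)
  ultimately show ?thesis by blast
qed

text \<open>Continuity is tested on sequences, the form in which dominated convergence
  applies.\<close>

lemma edge_weight_config_continuous:
  assumes nc: "\<not> collinear {z1, z2, z3}" and "i \<noteq> j"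
  shows "continuous_on {z :: complex ^ 'n. admissible z1 z2 z3 z} (\<lambda>z. edge_weight (config z1 z2 z3 z) i j)"
  unfolding continuous_on_sequentially o_def
proof (intro allI ballI impI)
  fix Z :: "nat \<Rightarrow> complex ^ 'n" and z
  assume z: "z \<in> {z. admissible z1 z2 z3 z}"
    and "(\<forall>n. Z n \<in> {z. admissible z1 z2 z3 z}) \<and> Z \<longlonglongrightarrow> z"
  then have lim: "Z \<longlonglongrightarrow> z" by simp
  have "(\<lambda>n. config z1 z2 z3 (Z n) p) \<longlonglongrightarrow> config z1 z2 z3 z p" for p
    by (rule isCont_tendsto_compose[OF has_derivative_continuous[OF config_has_derivative] lim])
  then show "(\<lambda>n. edge_weight (config z1 z2 z3 (Z n)) i j) \<longlonglongrightarrow> edge_weight (config z1 z2 z3 z) i j"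
    by (rule edge_weight_tendsto) (use admissible_inj[OF nc] z assms(2) in auto)
qed

theorem theorem5:
  fixes z1 z2 z3 :: complex
  assumes "\<not> collinear {z1, z2, z3}"
  shows
    \<comment> \<open>D is well defined: A_T is differentiable, and so are its first Wirtinger derivatives\<close>
    "(\<forall>z\<in>(unique_region z1 z2 z3 :: (complex ^ 'n) set).
        (\<lambda>y. complex_of_real (prepot z1 z2 z3 y)) differentiable (at z) \<and>
        (\<forall>v. (\<lambda>w. wirt_bar (\<lambda>y. complex_of_real (prepot z1 z2 z3 y)) v w) differentiable (at z)))
     \<and>
    \<comment> \<open>positivity of the Hermitian form\<close>
     (\<forall>z\<in>(unique_region z1 z2 z3 :: (complex ^ 'n) set). \<forall>\<xi> :: complex ^ 'n.
        (\<Sum>u\<in>UNIV. \<Sum>v\<in>UNIV. \<xi> $ u * levi z1 z2 z3 z u v * cnj (\<xi> $ v)) \<in> \<real> \<and>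
        0 \<le> Re (\<Sum>u\<in>UNIV. \<Sum>v\<in>UNIV. \<xi> $ u * levi z1 z2 z3 z u v * cnj (\<xi> $ v)))
     \<and>
    \<comment> \<open>continuous extension to all admissible configurations\<close>
     (\<exists>E :: complex ^ 'n \<Rightarrow> 'n \<Rightarrow> 'n \<Rightarrow> complex.
        (\<forall>u v. continuous_on {z. admissible z1 z2 z3 z} (\<lambda>z. E z u v)) \<and>
        (\<forall>z\<in>unique_region z1 z2 z3. \<forall>u v. E z u v = levi z1 z2 z3 z u v))"
proof (intro conjI ballI allI)
  fix z :: "complex ^ 'n" and v assume "z \<in> unique_region z1 z2 z3"
  then show "(\<lambda>y. complex_of_real (prepot z1 z2 z3 y)) differentiable (at z)"
    "(\<lambda>w. wirt_bar (\<lambda>y. complex_of_real (prepot z1 z2 z3 y)) v w) differentiable (at z)"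
    by (rule prepot_derivatives[OF assms])+
next
  fix z \<xi> :: "complex ^ 'n" assume z: "z \<in> unique_region z1 z2 z3"
  obtain r where r: "0 \<le> r" "(\<Sum>u\<in>UNIV. \<Sum>v\<in>UNIV. \<xi> $ u * levi z1 z2 z3 z u v * cnj (\<xi> $ v)) = complex_of_real r"
    unfolding prepot_derivatives(3)[OF assms z] using levi_form_nonneg by blast
  show "(\<Sum>u\<in>UNIV. \<Sum>v\<in>UNIV. \<xi> $ u * levi z1 z2 z3 z u v * cnj (\<xi> $ v)) \<in> \<real>"
    "0 \<le> Re (\<Sum>u\<in>UNIV. \<Sum>v\<in>UNIV. \<xi> $ u * levi z1 z2 z3 z u v * cnj (\<xi> $ v))"
    unfolding r(2) using r(1) by simp_all
next
  \<comment> \<open>Voronoi weights make sense without any choice of triangulation. On the diagonal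
    \<open>q\<close> also runs over the three fixed vertices.\<close>
  define E :: "complex ^ 'n \<Rightarrow> 'n \<Rightarrow> 'n \<Rightarrow> complex" where
    "E z u v = (if u = v then - (\<Sum>q\<in>- {Inl u}. edge_weight (config z1 z2 z3 z) (Inl u) q)
      else edge_weight (config z1 z2 z3 z) (Inl u) (Inl v))" for z u v
  have "continuous_on {z. admissible z1 z2 z3 z} (\<lambda>z. E z u v)" for u v
    unfolding E_def
    by (cases "u = v") (auto intro!: continuous_on_minus continuous_on_sum edge_weight_config_continuous[OF assms])
  moreover have "E z u v = levi z1 z2 z3 z u v" if z: "z \<in> unique_region z1 z2 z3" for z u v
  proof -
    note gen = unique_region_generic[OF assms z]
    note x = admissible_inj[OF assms gen(1)] gen(2) admissible_two_sided[OF assms gen(1)]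
    show ?thesis
      unfolding prepot_derivatives(3)[OF assms z] E_def
      using levi_form_vertex[OF x] levi_form_edge[OF x, where q = "Inl v"] by simp
  qed
  ultimately show "\<exists>E :: complex ^ 'n \<Rightarrow> 'n \<Rightarrow> 'n \<Rightarrow> complex.
        (\<forall>u v. continuous_on {z. admissible z1 z2 z3 z} (\<lambda>z. E z u v)) \<and>
        (\<forall>z\<in>unique_region z1 z2 z3. \<forall>u v. E z u v = levi z1 z2 z3 z u v)"
    by blast
qed

end
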